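(* Let $p,M,\ell\ge1$ be integers, $N=\ell M$, $n=Np$, and let $\{\{F_j^{(k)}\}_{j=0}^{M-1}\}_{k=1}^{\ell}\subset\mathbb{S}^+$ be a prescribed sequence that is non-increasing within each cycle ($F_j^{(k)}\ge F_{j+1}^{(k)}$ for $0\le j\le M-2$) and strictly decreasing at the transitions ($F_{M-1}^{(k)}>F_0^{(k+1)}$ for $1\le k\le \ell-1$). (i) Suppose that no stagnation with respect to any direction is specified, i.e. $F_j^{(k)}>F_{j+1}^{(k)}$ for all $1\le k\le\ell$ and $0\le j\le M-2$. Then the eigenvalues and the Ritz values of each individual block Hessenberg matrix of each cycle can be assigned arbitrarily: for every choice, for each $k=1,\dots,\ell$, of a multiset of $(M+1)p$ complex numbers and, for each $j=1,\dots,M$, of a multiset of $jp$ non-zero complex numbers, there exist $A\in\mathbb{C}^{n\times n}$ and $\mathbf{B}\in\mathbb{C}^{n\times p}$ for which restarted block GMRES with cycle length $M$ produces $\|\mathbf{R}_j^{(k)}\|_{\mathbb S}=F_j^{(k)}$ for all $0\le j\le M-1$, $1\le k\le\ell$, and whose associated block upper Hessenberg matrices $\mathcal{H}^{(k)}$ have the prescribed $(M+1)p$ numbers as eigenvalues and, for each $j=1,\dots,M$, the prescribed $jp$ numbers as Ritz values at iteration $j$ of cycle $k$ (all with multiplicity). (ii) If a stagnation is specified at iteration $j$ of cycle $k$, i.e. there is a non-zero $\mathbf{u}\in\mathbb{C}^p$ with $\mathbf{u}^*(F_{j}^{(k)})^*F_{j}^{(k)}\mathbf{u}=\mathbf{u}^*(F_{j-1}^{(k)})^*F_{j-1}^{(k)}\mathbf{u}$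 for some $1\le j\le M-1$, then at least one Ritz value at iteration $j$ of cycle $k$ (eigenvalue of $\mathcal{H}_j^{(k)}$) must be zero.
   Context: $\mathbb{S}^+$ denotes the set of upper triangular matrices in $\mathbb{C}^{p\times p}$ with positive diagonal entries. For such matrices, $R_1\le R_2$ (resp. $R_1<R_2$) means that $R_2^*R_2-R_1^*R_1$ is positive semidefinite (resp. positive definite). For $\mathbf{Z}\in\mathbb{C}^{n\times p}$ of full column rank, $\|\mathbf{Z}\|_{\mathbb S}\in\mathbb{S}^+$ is the unique element with $\|\mathbf{Z}\|_{\mathbb S}^*\|\mathbf{Z}\|_{\mathbb S}=\mathbf{Z}^*\mathbf{Z}$. Block Krylov subspace: $\mathbb{K}_j(A,\mathbf{R})=\{\sum_{i=0}^{j-1}A^i\mathbf{R}S_i : S_i\in\mathbb{C}^{p\times p}\}$. Restarted block GMRES for $A\mathbf{X}=\mathbf{B}$ with cycle length $M$: $\mathbf{X}_0^{(1)}=0$, $\mathbf{R}_0^{(1)}=\mathbf{B}$; in cycle $k$, $\mathbf{X}_j^{(k)}\in\mathbf{X}_0^{(k)}+\mathbb{K}_j(A,\mathbf{R}_0^{(k)})$ minimizes the Frobenius norm of $\mathbf{R}_j^{(k)}=\mathbf{B}-A\mathbf{X}_j^{(k)}$; then $\mathbf{X}_0^{(k+1)}=\mathbf{X}_M^{(k)}$, $\mathbf{R}_0^{(k+1)}=\mathbf{R}_M^{(k)}$. Block Hessenberg matrices: for each $k$, let $\mathcal{V}^{(k)}\in\mathbb{C}^{n\times Mp}$ be the matrix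 with orthonormal columns whose $M$ block columns ($n\times p$) are the block Arnoldi vectors of cycle $k$; the first block column is $\mathbf{R}_0^{(k)}\|\mathbf{R}_0^{(k)}\|_{\mathbb S}^{-1}$. The matrix $\mathcal{H}^{(k)}\in\mathbb{C}^{(M+1)p\times(M+1)p}$ is block upper Hessenberg (with $p\times p$ blocks and subdiagonal blocks in $\mathbb{S}^+$), and $\underline{\mathcal{H}^{(k)}}\in\mathbb{C}^{(M+1)p\times Mp}$ is obtained from it by deleting the last block column. It is associated with $(A,\mathbf{B})$ through the block Arnoldi relations $A\mathcal{V}^{(k)}=[\mathcal{V}^{(k)}\ \ \mathbf{V}^{(k)}_{M+1}]\,\underline{\mathcal{H}^{(k)}}$ for $k=1,\dots,\ell-1$, where $\mathbf{V}^{(k)}_{M+1}\in\mathbb{C}^{n\times p}$ has orthonormal columns orthogonal to those of $\mathcal{V}^{(k)}$, and, in the last cycle, $A\mathcal{V}^{(\ell)}=\mathcal{V}^{(\ell)}\mathcal{H}^{(\ell)}_{M\times M}$, where $\mathcal{H}^{(\ell)}_{M\times M}$ consists of the first $M$ block rows of $\underline{\mathcal{H}^{(\ell)}}$. For $1\le j\le M$, $\mathcal{H}_j^{(k)}\in\mathbb{C}^{jp\times jp}$ is the leading principal submatrix of $\mathcal{H}^{(k)}$, and its eigenvalues are the Ritz values at iteration $j$ of cycle $k$. *)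

theory Defs
  imports "Jordan_Normal_Form.Schur_Decomposition"
begin

text \<open>Matrices are those of \<^theory>\<open>Jordan_Normal_Form.Matrix\<close>, with dimensions carried by the
  value; \<^const>\<open>mat_adjoint\<close> is the conjugate transpose.  Cycles \<open>k\<close> are numbered from 1,
  iterations \<open>j\<close> within a cycle from 0, and matrix and block indices from 0.\<close>

subsection \<open>Upper triangular matrices with positive diagonal\<close>

definition Splus :: "nat \<Rightarrow> complex mat set" where
  "Splus p = {R \<in> carrier_mat p p. upper_triangular R \<and>
     (\<forall>i<p. R $$ (i,i) \<in> \<real> \<and> 0 < Re (R $$ (i,i)))}"

text \<open>Since \<open>v \<bullet>c w\<close> conjugates its second argument, \<open>(G *\<^sub>v v) \<bullet>c v\<close> is \<open>v\<^sup>* G v\<close>.\<close>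

definition pos_semidefinite :: "complex mat \<Rightarrow> bool" where
  "pos_semidefinite G \<longleftrightarrow> square_mat G \<and> mat_adjoint G = G \<and>
     (\<forall>v \<in> carrier_vec (dim_row G). 0 \<le> Re ((G *\<^sub>v v) \<bullet>c v))"

definition pos_definite :: "complex mat \<Rightarrow> bool" where
  "pos_definite G \<longleftrightarrow> square_mat G \<and> mat_adjoint G = G \<and>
     (\<forall>v \<in> carrier_vec (dim_row G). v \<noteq> 0\<^sub>v (dim_row G) \<longrightarrow> 0 < Re ((G *\<^sub>v v) \<bullet>c v))"

definition gram_le :: "complex mat \<Rightarrow> complex mat \<Rightarrow> bool" where
  "gram_le R1 R2 \<longleftrightarrow> pos_semidefinite (mat_adjoint R2 * R2 - mat_adjoint R1 * R1)"

definition gram_less :: "complex mat \<Rightarrow> complex mat \<Rightarrow> bool" where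
  "gram_less R1 R2 \<longleftrightarrow> pos_definite (mat_adjoint R2 * R2 - mat_adjoint R1 * R1)"

text \<open>\<open>has_block_norm Z R\<close> is the graph of the partial function sending \<open>Z\<close> to the block norm
  \<open>\<parallel>Z\<parallel>\<close> with values in \<^const>\<open>Splus\<close>.  Such an \<open>R\<close> exists only if \<open>Z\<close> has full column rank,
  because \<open>R\<close> is invertible; it is unique by \<open>has_block_norm_unique\<close> below.\<close>

definition has_block_norm :: "complex mat \<Rightarrow> complex mat \<Rightarrow> bool" where
  "has_block_norm Z R \<longleftrightarrow> R \<in> Splus (dim_col Z) \<and> mat_adjoint R * R = mat_adjoint Z * Z"

subsection \<open>Restarted block GMRES\<close>

definition frobenius_norm :: "complex mat \<Rightarrow> real" where
  "frobenius_norm Z = sqrt (\<Sum>i<dim_row Z. \<Sum>j<dim_col Z. (cmod (Z $$ (i,j)))\<^sup>2)"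

text \<open>The elements are the sums of the \<open>A\<^sup>i R S\<^sub>i\<close> for \<open>i < j\<close>, written entrywise because the
  matrix type is not a commutative monoid.\<close>

definition block_krylov :: "nat \<Rightarrow> complex mat \<Rightarrow> complex mat \<Rightarrow> complex mat set" where
  "block_krylov j A R =
     {mat (dim_row R) (dim_col R) (\<lambda>rc. \<Sum>i<j. ((A ^\<^sub>m i) * R * S i) $$ rc) | S.
        \<forall>i<j. S i \<in> carrier_mat (dim_col R) (dim_col R)}"

definition residual :: "complex mat \<Rightarrow> complex mat \<Rightarrow> complex mat \<Rightarrow> complex mat" where
  "residual A B X = B - A * X"

definition gmres_iterate ::
  "complex mat \<Rightarrow> complex mat \<Rightarrow> complex mat \<Rightarrow> nat \<Rightarrow> complex mat \<Rightarrow> bool" where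
  "gmres_iterate A B X0 j X \<longleftrightarrow>
     is_arg_min (\<lambda>Y. frobenius_norm (residual A B Y))
       (\<lambda>Y. Y \<in> {X0 + K | K. K \<in> block_krylov j A (residual A B X0)}) X"

text \<open>\<open>X k j\<close> is iterate \<open>j\<close> of cycle \<open>k\<close>.  This is a relation because a minimizing iterate need
  not be unique for singular \<open>A\<close>; its residual is the distance vector from a linear subspace and
  hence is unique.\<close>

definition restarted_block_gmres ::
  "complex mat \<Rightarrow> complex mat \<Rightarrow> nat \<Rightarrow> nat \<Rightarrow> (nat \<Rightarrow> nat \<Rightarrow> complex mat) \<Rightarrow> bool" where
  "restarted_block_gmres A B M l X \<longleftrightarrow>
     X 1 0 = 0\<^sub>m (dim_row B) (dim_col B) \<and>
     (\<forall>k\<in>{1..l}. \<forall>j\<in>{1..M}. gmres_iterate A B (X k 0) j (X k j)) \<and>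
     (\<forall>k\<in>{1..<l}. X (k + 1) 0 = X k M)"

subsection \<open>Block Hessenberg matrices and the block Arnoldi relations\<close>

definition leading_part :: "nat \<Rightarrow> nat \<Rightarrow> complex mat \<Rightarrow> complex mat" where
  "leading_part r c Z = mat r c (\<lambda>(i,j). Z $$ (i,j))"

definition block_entry :: "nat \<Rightarrow> complex mat \<Rightarrow> nat \<Rightarrow> nat \<Rightarrow> complex mat" where
  "block_entry p H i j = mat p p (\<lambda>(r,c). H $$ (i * p + r, j * p + c))"

definition block_hessenberg :: "nat \<Rightarrow> nat \<Rightarrow> complex mat \<Rightarrow> bool" where
  "block_hessenberg p m H \<longleftrightarrow> H \<in> carrier_mat (m * p) (m * p) \<and>
     (\<forall>i<m. \<forall>j<m. j + 1 < i \<longrightarrow> block_entry p H i j = 0\<^sub>m p p) \<and>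
     (\<forall>j. j + 1 < m \<longrightarrow> block_entry p H (j + 1) j \<in> Splus p)"

definition append_columns :: "complex mat \<Rightarrow> complex mat \<Rightarrow> complex mat" where
  "append_columns V W = mat_of_cols (dim_row V) (cols V @ cols W)"

text \<open>\<open>V\<close> has \<open>M\<close> block columns, orthonormal columns, and first block column \<open>R0 \<parallel>R0\<parallel>\<^sup>-\<^sup>1\<close>;
  here \<open>T\<close> is the inverse of \<open>S = \<parallel>R0\<parallel>\<close>.\<close>

definition orthonormal_start :: "nat \<Rightarrow> nat \<Rightarrow> complex mat \<Rightarrow> complex mat \<Rightarrow> bool" where
  "orthonormal_start p M R0 V \<longleftrightarrow> V \<in> carrier_mat (dim_row R0) (M * p) \<and>
     mat_adjoint V * V = 1\<^sub>m (M * p) \<and>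
     (\<exists>S T. has_block_norm R0 S \<and> inverts_mat S T \<and> inverts_mat T S \<and>
        leading_part (dim_row R0) p V = R0 * T)"

definition block_arnoldi ::
  "nat \<Rightarrow> nat \<Rightarrow> complex mat \<Rightarrow> complex mat \<Rightarrow> complex mat \<Rightarrow> bool" where
  "block_arnoldi p M A R0 H \<longleftrightarrow> (\<exists>V W. orthonormal_start p M R0 V \<and>
     W \<in> carrier_mat (dim_row R0) p \<and> mat_adjoint W * W = 1\<^sub>m p \<and>
     mat_adjoint V * W = 0\<^sub>m (M * p) p \<and>
     A * V = append_columns V W * leading_part ((M + 1) * p) (M * p) H)"

definition block_arnoldi_final ::
  "nat \<Rightarrow> nat \<Rightarrow> complex mat \<Rightarrow> complex mat \<Rightarrow> complex mat \<Rightarrow> bool" where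
  "block_arnoldi_final p M A R0 H \<longleftrightarrow> (\<exists>V. orthonormal_start p M R0 V \<and>
     A * V = V * leading_part (M * p) (M * p) H)"

text \<open>\<open>R0 k\<close> is the initial residual of cycle \<open>k\<close>.  The last block column of every \<open>H k\<close> and the
  last subdiagonal block of \<open>H l\<close> do not occur in the Arnoldi relations, so these entries are
  free apart from the Hessenberg condition.\<close>

definition associated_hessenberg ::
  "nat \<Rightarrow> nat \<Rightarrow> nat \<Rightarrow> complex mat \<Rightarrow> (nat \<Rightarrow> complex mat) \<Rightarrow> (nat \<Rightarrow> complex mat) \<Rightarrow> bool" where
  "associated_hessenberg p M l A R0 H \<longleftrightarrow>
     (\<forall>k\<in>{1..l}. block_hessenberg p (M + 1) (H k)) \<and>
     (\<forall>k\<in>{1..<l}. block_arnoldi p M A (R0 k) (H k)) \<and>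
     block_arnoldi_final p M A (R0 l) (H l)"

text \<open>The eigenvalues, counted with algebraic multiplicity.\<close>

definition eigenvalue_mset :: "complex mat \<Rightarrow> complex multiset" where
  "eigenvalue_mset Z = proots (char_poly Z)"

definition ritz_values :: "nat \<Rightarrow> nat \<Rightarrow> complex mat \<Rightarrow> complex multiset" where
  "ritz_values p j H = eigenvalue_mset (leading_part (j * p) (j * p) H)"

text \<open>The pair \<open>(A, B)\<close> realizes the prescribed block norms \<open>F\<close>, with associated block
  Hessenberg matrices \<open>H\<close>.\<close>

definition realizes :: "nat \<Rightarrow> nat \<Rightarrow> nat \<Rightarrow> nat \<Rightarrow> (nat \<Rightarrow> nat \<Rightarrow> complex mat) \<Rightarrow>
    complex mat \<Rightarrow> complex mat \<Rightarrow> (nat \<Rightarrow> complex mat) \<Rightarrow> bool" where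
  "realizes n p M l F A B H \<longleftrightarrow> A \<in> carrier_mat n n \<and> B \<in> carrier_mat n p \<and>
     (\<exists>X. restarted_block_gmres A B M l X \<and>
        (\<forall>k\<in>{1..l}. \<forall>j<M. has_block_norm (residual A B (X k j)) (F k j)) \<and>
        associated_hessenberg p M l A (\<lambda>k. residual A B (X k 0)) H)"

subsection \<open>Uniqueness of the block norm\<close>

lemma mat_adjoint_mult_entry:
  assumes "Z \<in> carrier_mat n p" "i < p" "j < p"
  shows "(mat_adjoint Z * Z) $$ (i,j) = (\<Sum>r<n. cnj (Z $$ (r,i)) * Z $$ (r,j))"
  using assms by (auto simp: mat_adjoint_def mat_of_rows_def scalar_prod_def cols_def col_def
      lessThan_atLeast0 intro!: sum.cong)

lemma Splus_gram_entry:
  assumes R: "R \<in> Splus p" and ij: "i \<le> j" "j < p"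
  shows "(mat_adjoint R * R) $$ (i,j) =
    (\<Sum>r<i. cnj (R $$ (r,i)) * R $$ (r,j)) + cnj (R $$ (i,i)) * R $$ (i,j)"
proof -
  have c: "R \<in> carrier_mat p p" and ut: "upper_triangular R"
    using R by (auto simp: Splus_def)
  have z: "R $$ (r,i) = 0" if "i < r" "r < p" for r
    using ut c that by (auto simp: upper_triangular_def)
  have "(mat_adjoint R * R) $$ (i,j) = (\<Sum>r<p. cnj (R $$ (r,i)) * R $$ (r,j))"
    using mat_adjoint_mult_entry[OF c] ij by simp
  also have "\<dots> = (\<Sum>r<Suc i. cnj (R $$ (r,i)) * R $$ (r,j))"
    by (rule sum.mono_neutral_right) (use ij z in auto)
  finally show ?thesis by simp
qed

lemma has_block_norm_unique:
  assumes "has_block_norm Z R" "has_block_norm Z S"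
  shows "R = S"
proof -
  define p where "p = dim_col Z"
  have RS: "R \<in> Splus p" "S \<in> Splus p" and G: "mat_adjoint R * R = mat_adjoint S * S"
    using assms by (auto simp: has_block_norm_def p_def)
  have c: "R \<in> carrier_mat p p" "S \<in> carrier_mat p p"
    and ut: "upper_triangular R" "upper_triangular S"
    and d: "\<And>i. i < p \<Longrightarrow> R $$ (i,i) \<in> \<real> \<and> 0 < Re (R $$ (i,i))"
      "\<And>i. i < p \<Longrightarrow> S $$ (i,i) \<in> \<real> \<and> 0 < Re (S $$ (i,i))"
    using RS by (auto simp: Splus_def)
  have row: "i < p \<Longrightarrow> \<forall>j<p. R $$ (i,j) = S $$ (i,j)" for i
  proof (induction i rule: less_induct)
    case (less i)
    have e: "cnj (R $$ (i,i)) * R $$ (i,j) = cnj (S $$ (i,i)) * S $$ (i,j)"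
      if "i \<le> j" "j < p" for j
    proof -
      have "(\<Sum>r<i. cnj (R $$ (r,i)) * R $$ (r,j)) = (\<Sum>r<i. cnj (S $$ (r,i)) * S $$ (r,j))"
        by (rule sum.cong) (use less that in auto)
      then show ?thesis
        using Splus_gram_entry[OF RS(1) that] Splus_gram_entry[OF RS(2) that] G by simp
    qed
    obtain a b where ab: "R $$ (i,i) = complex_of_real a" "S $$ (i,i) = complex_of_real b"
      "0 < a" "0 < b"
      using d[OF less.prems] by (auto elim!: Reals_cases)
    have "a * a = b * b"
      using e[of i] less.prems ab by (simp flip: of_real_mult)
    then have "a = b"
      using ab(3,4) by (metis abs_of_pos real_sqrt_abs2)
    then have ge: "R $$ (i,j) = S $$ (i,j)" if "i \<le> j" "j < p" for j
      using e[OF that] ab by simp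
    have lt: "R $$ (i,j) = S $$ (i,j)" if "j < i" for j
      using ut c less.prems that by (auto simp: upper_triangular_def)
    show ?case using ge lt by (meson not_le)
  qed
  show ?thesis by (rule eq_matI) (use row c in auto)
qed

end

theory Submission
  imports Defs
begin

text \<open>Within a cycle let \<open>v\<^sub>0, v\<^sub>1, \<dots>\<close> be the block Arnoldi vectors and \<open>H\<close> the block Hessenberg
  matrix.  If \<open>g\<^sub>0 = F\<^sub>0\<^sup>-\<^sup>1, g\<^sub>1, \<dots>\<close> are blocks with \<open>\<Sum>\<^sub>i g\<^sub>i H\<^sub>i\<^sub>j = 0\<close> for all \<open>j\<close>, the residual after
  \<open>j\<close> steps is \<open>\<Sum>\<^sub>i v\<^sub>i g\<^sub>i\<^sup>* G\<close> with \<open>i \<le> j\<close> and Gram matrix \<open>G = (\<Sum>\<^sub>i g\<^sub>i g\<^sub>i\<^sup>*)\<^sup>-\<^sup>1\<close>, so strictly decreasing Gram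
  matrices can be prescribed through the \<open>g\<^sub>i\<close>.  The blocks \<open>g\<^sub>i H\<^sub>i\<^sub>j g\<^sub>j\<^sup>-\<^sup>1\<close> have vanishing column sums and
  the same Ritz values; choosing them diagonal leaves \<open>p\<close> scalar problems, each solved by the matrix
  of multiplication by \<open>x\<close> in a basis of polynomials \<open>\<phi>\<^sub>j\<close> with \<open>\<phi>\<^sub>j(0) = 1\<close> whose roots are the Ritz
  values of step \<open>j\<close>.  The cycles are coupled by letting the last residual of one cycle start the
  next one and taking all further Arnoldi vectors to be fresh unit vectors, which determines \<open>A\<close>.

  If \<open>u\<close> is a direction of stagnation, then \<open>R\<^sub>j u = R\<^sub>j\<^sub>-\<^sub>1 u = V\<^sub>j y\<close> with \<open>y \<noteq> 0\<close>, and orthogonality of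
  \<open>R\<^sub>j\<close> to \<open>A V\<^sub>j\<close> gives \<open>H\<^sub>j\<^sup>* y = V\<^sub>j\<^sup>* A\<^sup>* V\<^sub>j y = 0\<close>, so \<open>H\<^sub>j\<close> is singular.\<close>

section \<open>Matrices\<close>

text \<open>The block setting adds one constraint: subdiagonal blocks must lie in
  \<open>Splus\<close>, while the prescribed norms fix only \<open>g_i * adj g_i\<close>, that is,
  \<open>g_i\<close> up to a unitary right factor. The scalar Hessenberg entries are therefore
  chosen first, and the unitary factor of \<open>g_(i+1)\<close> is then spent on making the next
  subdiagonal block triangular, so norms and Ritz values do not compete. Non-zero Ritz values are
  what permits \<open>\<phi>_j(0) = 1\<close> for j up to M; the polynomial of degree M+1 enters
  only through the last block column, which is free, so the eigenvalues of the whole matrix may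
  include zero. Since \<open>A\<close> may be singular, residuals are followed rather than iterates:
  a predicted residual occurs if it is orthogonal to the image of the Krylov space under
  \<open>A\<close> and differs from the initial residual by an element of that image. At a
  transition the new start vector contains the last Arnoldi vector of the old cycle with an
  invertible coefficient, so prescribing \<open>A\<close> on the start vector amounts to prescribing
  it on that unit vector, and the cycles impose no contradictory conditions.\<close>

abbreviation adj :: "complex mat \<Rightarrow> complex mat" where
  "adj \<equiv> mat_adjoint"

lemma adj_dim [simp]: "dim_row (adj A) = dim_col A" "dim_col (adj A) = dim_row A"
  by (simp_all add: mat_adjoint_def)

lemma adj_entry [simp]:
  "i < dim_col A \<Longrightarrow> j < dim_row A \<Longrightarrow> adj A $$ (i,j) = cnj (A $$ (j,i))"
  by (simp add: mat_adjoint_def mat_of_rows_def cols_def col_def)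

lemma mult_entry:
  "i < dim_row A \<Longrightarrow> j < dim_col B \<Longrightarrow> dim_col A = dim_row B \<Longrightarrow>
    (A * B) $$ (i,j) = (\<Sum>k<dim_row B. A $$ (i,k) * B $$ (k,j))"
  by (auto simp: scalar_prod_def lessThan_atLeast0 intro!: sum.cong)

lemma mult_vec_entry:
  "i < dim_row A \<Longrightarrow> dim_col A = dim_vec v \<Longrightarrow>
    (A *\<^sub>v v) $ i = (\<Sum>k<dim_vec v. A $$ (i,k) * v $ k)"
  by (auto simp: scalar_prod_def lessThan_atLeast0 intro!: sum.cong)

lemma mat_carrier_iff [simp]:
  "A * B \<in> carrier_mat n p \<longleftrightarrow> dim_row A = n \<and> dim_col B = p"
  "A + B \<in> carrier_mat n p \<longleftrightarrow> dim_row B = n \<and> dim_col B = p"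
  "A - B \<in> carrier_mat n p \<longleftrightarrow> dim_row B = n \<and> dim_col B = p"
  "adj C \<in> carrier_mat n p \<longleftrightarrow> dim_row C = p \<and> dim_col C = n"
  unfolding carrier_mat_def by auto

declare assoc_mult_mat [simp del] index_mult_mat(1) [simp del]

text \<open>Matrix algebra with dimension premises the simplifier can discharge: the library versions
  have carrier premises with variables that do not occur in the equation.\<close>

lemma mat_assoc: "dim_col A = dim_row B \<Longrightarrow> dim_col B = dim_row C \<Longrightarrow>
    (A * B) * C = A * (B * (C :: complex mat))"
  by (rule assoc_mult_mat) auto

lemma mat_distrib_left: "dim_col A = dim_row B \<Longrightarrow> dim_row B = dim_row C \<Longrightarrow> dim_col B = dim_col C \<Longrightarrow>
    A * (B + C) = A * B + A * (C :: complex mat)"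
  by (rule mult_add_distrib_mat) auto

lemma mat_distrib_right: "dim_col A = dim_row C \<Longrightarrow> dim_row A = dim_row B \<Longrightarrow> dim_col A = dim_col B \<Longrightarrow>
    (A + B) * C = A * C + B * (C :: complex mat)"
  by (rule add_mult_distrib_mat) auto

lemma mat_diff_left: "dim_col A = dim_row B \<Longrightarrow> dim_row B = dim_row C \<Longrightarrow> dim_col B = dim_col C \<Longrightarrow>
    A * (B - C) = A * B - A * (C :: complex mat)"
  by (rule mult_minus_distrib_mat) auto

lemma mat_diff_right: "dim_col A = dim_row C \<Longrightarrow> dim_row A = dim_row B \<Longrightarrow> dim_col A = dim_col B \<Longrightarrow>
    (A - B) * C = A * C - B * (C :: complex mat)"
  by (rule minus_mult_distrib_mat) auto

lemma adj_adj [simp]: "adj (adj A) = A"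
  by (rule eq_matI) auto

lemma adj_mult: "dim_col A = dim_row B \<Longrightarrow> adj (A * B) = adj B * adj A"
  by (rule eq_matI) (auto simp: mult_entry mult.commute)

lemma adj_one [simp]: "adj (1\<^sub>m n) = 1\<^sub>m n"
  by (rule eq_matI) auto

lemma adj_zero [simp]: "adj (0\<^sub>m n m) = 0\<^sub>m m n"
  by (rule eq_matI) auto

lemma adj_add: "dim_row A = dim_row B \<Longrightarrow> dim_col A = dim_col B \<Longrightarrow> adj (A + B) = adj A + adj B"
  by (rule eq_matI) auto

text \<open>Entrywise finite sums, as the matrix type carries no commutative monoid structure.\<close>

definition msum :: "nat \<Rightarrow> nat \<Rightarrow> ('i \<Rightarrow> complex mat) \<Rightarrow> 'i set \<Rightarrow> complex mat" where
  "msum r c f I = mat r c (\<lambda>rc. \<Sum>i\<in>I. f i $$ rc)"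

lemma msum_dim [simp]: "dim_row (msum r c f I) = r" "dim_col (msum r c f I) = c"
  by (auto simp: msum_def)

lemma msum_carrier [simp]: "msum r c f I \<in> carrier_mat r c"
  by (auto simp: msum_def)

lemma msum_entry [simp]: "i < r \<Longrightarrow> j < c \<Longrightarrow> msum r c f I $$ (i,j) = (\<Sum>k\<in>I. f k $$ (i,j))"
  by (auto simp: msum_def)

lemma msum_cong: "I = J \<Longrightarrow> (\<And>i. i \<in> J \<Longrightarrow> f i = g i) \<Longrightarrow> msum r c f I = msum r c g J"
  by (auto simp: msum_def)

lemma msum_empty: "msum r c f {} = 0\<^sub>m r c"
  by (rule eq_matI) auto

lemma msum_Suc: "f n \<in> carrier_mat r c \<Longrightarrow> msum r c f {..<Suc n} = msum r c f {..<n} + f n"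
  by (rule eq_matI) auto

lemma msum_Suc_shift: "f 0 \<in> carrier_mat r c \<Longrightarrow>
    msum r c f {..<Suc n} = f 0 + msum r c (\<lambda>i. f (Suc i)) {..<n}"
  by (rule eq_matI) (auto simp: sum.lessThan_Suc_shift simp del: sum.lessThan_Suc)

lemma msum_mult:
  assumes "\<And>i. i \<in> I \<Longrightarrow> f i \<in> carrier_mat r c" "dim_row B = c"
  shows "msum r c f I * B = msum r (dim_col B) (\<lambda>i. f i * B) I"
proof (rule eq_matI)
  fix i j assume ij: "i < dim_row (msum r (dim_col B) (\<lambda>i. f i * B) I)"
    "j < dim_col (msum r (dim_col B) (\<lambda>i. f i * B) I)"
  have "(msum r c f I * B) $$ (i,j) = (\<Sum>k<c. \<Sum>m\<in>I. f m $$ (i,k) * B $$ (k,j))"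
    using ij assms(2) by (simp add: mult_entry sum_distrib_right del: index_mult_mat(1))
  also have "\<dots> = (\<Sum>m\<in>I. \<Sum>k<c. f m $$ (i,k) * B $$ (k,j))"
    by (rule sum.swap)
  also have "\<dots> = (\<Sum>m\<in>I. (f m * B) $$ (i,j))"
    by (rule sum.cong[OF refl], subst mult_entry)
      (use ij assms assms(1)[THEN carrier_matD(1)] assms(1)[THEN carrier_matD(2)] in auto)
  finally show "(msum r c f I * B) $$ (i,j) = msum r (dim_col B) (\<lambda>i. f i * B) I $$ (i,j)"
    using ij by simp
qed auto

lemma mult_msum:
  assumes "\<And>i. i \<in> I \<Longrightarrow> f i \<in> carrier_mat r c" "dim_col A = r"
  shows "A * msum r c f I = msum (dim_row A) c (\<lambda>i. A * f i) I"
proof (rule eq_matI)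
  fix i j assume ij: "i < dim_row (msum (dim_row A) c (\<lambda>i. A * f i) I)"
    "j < dim_col (msum (dim_row A) c (\<lambda>i. A * f i) I)"
  have "(A * msum r c f I) $$ (i,j) = (\<Sum>k<r. \<Sum>m\<in>I. A $$ (i,k) * f m $$ (k,j))"
    using ij assms(2) by (simp add: mult_entry sum_distrib_left del: index_mult_mat(1))
  also have "\<dots> = (\<Sum>m\<in>I. \<Sum>k<r. A $$ (i,k) * f m $$ (k,j))"
    by (rule sum.swap)
  also have "\<dots> = (\<Sum>m\<in>I. (A * f m) $$ (i,j))"
    by (rule sum.cong[OF refl], subst mult_entry)
      (use ij assms assms(1)[THEN carrier_matD(1)] assms(1)[THEN carrier_matD(2)] in auto)
  finally show "(A * msum r c f I) $$ (i,j) = msum (dim_row A) c (\<lambda>i. A * f i) I $$ (i,j)"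
    using ij by simp
qed auto

lemma adj_msum:
  assumes "\<And>i. i \<in> I \<Longrightarrow> f i \<in> carrier_mat r c"
  shows "adj (msum r c f I) = msum c r (\<lambda>i. adj (f i)) I"
  using assms[THEN carrier_matD(1)] assms[THEN carrier_matD(2)]
  by (intro eq_matI) (auto intro!: sum.cong)

lemma msum_diff:
  assumes "\<And>i. i \<in> I \<Longrightarrow> g i \<in> carrier_mat r c"
  shows "msum r c (\<lambda>i. f i - g i) I = msum r c f I - msum r c g I"
  using assms[THEN carrier_matD(1)] assms[THEN carrier_matD(2)]
  by (intro eq_matI) (auto simp: sum_subtractf[symmetric] intro!: sum.cong)

lemma msum_single: "finite I \<Longrightarrow> k \<in> I \<Longrightarrow> f k \<in> carrier_mat r c \<Longrightarrow>
    (\<And>i. i \<in> I \<Longrightarrow> i \<noteq> k \<Longrightarrow> f i = 0\<^sub>m r c) \<Longrightarrow> msum r c f I = f k"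
  apply (rule eq_matI)
    apply (auto)
  apply (subst sum.remove[of _ k])
    apply (auto intro!: sum.neutral)
  done

lemma msum_zero: "(\<And>i. i \<in> I \<Longrightarrow> f i = 0\<^sub>m r c) \<Longrightarrow> msum r c f I = 0\<^sub>m r c"
  by (rule eq_matI) (auto intro!: sum.neutral)

lemma msum_mono_neutral: "finite J \<Longrightarrow> I \<subseteq> J \<Longrightarrow> (\<And>i. i \<in> J - I \<Longrightarrow> f i = 0\<^sub>m r c) \<Longrightarrow>
    msum r c f J = msum r c f I"
  by (rule eq_matI) (auto intro!: sum.mono_neutral_right)

subsection \<open>Inverses\<close>

text \<open>An inverse as a total function, so that it can be written inside formulas; for singular
  \<open>A\<close> the value is arbitrary, hence the \<open>nonsing\<close> premises
  throughout.\<close>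

definition minv :: "complex mat \<Rightarrow> complex mat" where
  "minv A = (SOME B. B \<in> carrier_mat (dim_row A) (dim_row A) \<and>
     A * B = 1\<^sub>m (dim_row A) \<and> B * A = 1\<^sub>m (dim_row A))"

definition nonsing :: "nat \<Rightarrow> complex mat \<Rightarrow> bool" where
  "nonsing p A \<longleftrightarrow> A \<in> carrier_mat p p \<and> det A \<noteq> 0"

lemma nonsing_minv:
  assumes "nonsing p A"
  shows "minv A \<in> carrier_mat p p" "A * minv A = 1\<^sub>m p" "minv A * A = 1\<^sub>m p"
proof -
  have A: "A \<in> carrier_mat p p" and d: "det A \<noteq> 0" using assms by (auto simp: nonsing_def)
  obtain B where "B \<in> carrier_mat p p" "A * B = 1\<^sub>m p" "B * A = 1\<^sub>m p"
    using det_non_zero_imp_unit[OF A d, of undefined] by (auto simp: Units_def ring_mat_def)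
  then have "\<exists>B. B \<in> carrier_mat (dim_row A) (dim_row A) \<and>
     A * B = 1\<^sub>m (dim_row A) \<and> B * A = 1\<^sub>m (dim_row A)" using A by auto
  from someI_ex[OF this] A show "minv A \<in> carrier_mat p p" "A * minv A = 1\<^sub>m p" "minv A * A = 1\<^sub>m p"
    by (auto simp: minv_def)
qed

lemma nonsingI: "A \<in> carrier_mat p p \<Longrightarrow> B \<in> carrier_mat p p \<Longrightarrow> A * B = 1\<^sub>m p \<Longrightarrow> nonsing p A"
  unfolding nonsing_def by (metis det_mult det_one mult_eq_0_iff zero_neq_one)

lemma nonsing_carrier: "nonsing p A \<Longrightarrow> A \<in> carrier_mat p p"
  by (simp add: nonsing_def)

lemma nonsing_mult: "nonsing p A \<Longrightarrow> nonsing p B \<Longrightarrow> nonsing p (A * B)"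
  by (auto simp: nonsing_def det_mult)

lemma nonsing_inv: "nonsing p A \<Longrightarrow> nonsing p (minv A)"
  using nonsing_minv by (intro nonsingI[of _ _ A]) (auto simp: nonsing_def)

lemma nonsing_adj: "nonsing p A \<Longrightarrow> nonsing p (adj A)"
  using nonsing_minv[of p A] nonsing_carrier[of p A]
  by (intro nonsingI[of _ _ "adj (minv A)"]) (auto simp flip: adj_mult)

lemma minv_cancel:
  assumes "nonsing p A" "dim_row B = p"
  shows "A * (minv A * B) = B" "minv A * (A * B) = B"
  using nonsing_minv[OF assms(1)] nonsing_carrier[OF assms(1)] assms(2)
  by (simp_all flip: mat_assoc)

lemma adj_minv_cancel:
  assumes "nonsing p A"
  shows "adj A * adj (minv A) = 1\<^sub>m p" "adj (minv A) * adj A = 1\<^sub>m p"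
    "dim_row B = p \<Longrightarrow> adj A * (adj (minv A) * B) = B"
    "dim_row B = p \<Longrightarrow> adj (minv A) * (adj A * B) = B"
  using nonsing_minv[OF assms(1)] nonsing_carrier[OF assms(1)]
  by (simp_all flip: mat_assoc adj_mult)

section \<open>Minimal residuals\<close>

definition fro2 :: "complex mat \<Rightarrow> real" where
  "fro2 Z = (\<Sum>i<dim_row Z. \<Sum>j<dim_col Z. (cmod (Z $$ (i,j)))\<^sup>2)"

lemma fro2_nonneg: "0 \<le> fro2 Z"
  by (auto simp: fro2_def intro!: sum_nonneg)

lemma frobenius_norm_eq: "frobenius_norm Z = sqrt (fro2 Z)"
  by (simp add: frobenius_norm_def fro2_def)

lemma fro2_eq_0: assumes "fro2 Z = 0" shows "Z = 0\<^sub>m (dim_row Z) (dim_col Z)"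
proof (rule eq_matI)
  fix i j assume ij: "i < dim_row (0\<^sub>m (dim_row Z) (dim_col Z) :: complex mat)"
    "j < dim_col (0\<^sub>m (dim_row Z) (dim_col Z) :: complex mat)"
  have "\<forall>i\<in>{..<dim_row Z}. (\<Sum>j<dim_col Z. (cmod (Z $$ (i,j)))\<^sup>2) = 0"
    using assms unfolding fro2_def by (subst (asm) sum_nonneg_eq_0_iff) (auto intro!: sum_nonneg)
  then have "(\<Sum>j<dim_col Z. (cmod (Z $$ (i,j)))\<^sup>2) = 0" using ij by auto
  then have "\<forall>j\<in>{..<dim_col Z}. (cmod (Z $$ (i,j)))\<^sup>2 = 0"
    by (subst (asm) sum_nonneg_eq_0_iff) auto
  then show "Z $$ (i,j) = 0\<^sub>m (dim_row Z) (dim_col Z) $$ (i,j)" using ij by auto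
qed auto

lemma fro2_trace: "of_real (fro2 Z) = (\<Sum>j<dim_col Z. (adj Z * Z) $$ (j,j))"
proof -
  have "(\<Sum>j<dim_col Z. (adj Z * Z) $$ (j,j)) =
      (\<Sum>j<dim_col Z. \<Sum>i<dim_row Z. of_real ((cmod (Z $$ (i,j)))\<^sup>2))"
    by (rule sum.cong[OF refl], subst mult_entry)
      (auto simp: complex_norm_square mult.commute simp del: of_real_power intro!: sum.cong)
  also have "\<dots> = of_real (fro2 Z)"
    by (subst sum.swap) (simp add: fro2_def)
  finally show ?thesis by simp
qed

lemma cmod_add_scaled:
  "(cmod (r + of_real c * y))\<^sup>2 = (cmod r)\<^sup>2 + 2 * c * Re (cnj y * r) + c\<^sup>2 * (cmod y)\<^sup>2"
  unfolding cmod_power2 by (simp add: power2_eq_square algebra_simps)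

lemma fro2_add_scaled:
  assumes "R \<in> carrier_mat n p" "Y \<in> carrier_mat n p"
  shows "fro2 (R + of_real c \<cdot>\<^sub>m Y) =
    fro2 R + 2 * c * Re (\<Sum>j<p. (adj Y * R) $$ (j,j)) + c\<^sup>2 * fro2 Y"
proof -
  have "fro2 (R + of_real c \<cdot>\<^sub>m Y) = (\<Sum>i<n. \<Sum>j<p. (cmod (R $$ (i,j)))\<^sup>2 +
      2 * c * Re (cnj (Y $$ (i,j)) * R $$ (i,j)) + c\<^sup>2 * (cmod (Y $$ (i,j)))\<^sup>2)"
    using assms by (auto simp: fro2_def cmod_add_scaled intro!: sum.cong)
  also have "\<dots> = fro2 R + 2 * c * (\<Sum>i<n. \<Sum>j<p. Re (cnj (Y $$ (i,j)) * R $$ (i,j))) + c\<^sup>2 * fro2 Y"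
    using assms by (simp add: fro2_def sum.distrib sum_distrib_left algebra_simps)
  also have "(\<Sum>i<n. \<Sum>j<p. Re (cnj (Y $$ (i,j)) * R $$ (i,j))) = Re (\<Sum>j<p. (adj Y * R) $$ (j,j))"
    using assms by (subst sum.swap) (auto simp: mult_entry intro!: sum.cong)
  finally show ?thesis .
qed

lemma fro2_pythagoras:
  assumes "R \<in> carrier_mat n p" "Y \<in> carrier_mat n p" "adj Y * R = 0\<^sub>m p p"
  shows "fro2 (R + Y) = fro2 R + fro2 Y"
proof -
  have "complex_of_real 1 \<cdot>\<^sub>m Y = Y" by (rule eq_matI) auto
  then show ?thesis using fro2_add_scaled[OF assms(1,2), of 1] assms(3) by simp
qed

text \<open>The first-order condition at a minimum: \<open>a\<close> is the slope and
  \<open>b\<close> the curvature of the squared norm along a line through the minimizer.\<close>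

lemma quadratic_dominates_linear:
  fixes a b :: real
  assumes "0 \<le> a" "0 \<le> b" "\<And>c. 0 \<le> 2 * c * a + c\<^sup>2 * b"
  shows "a = 0"
proof (rule ccontr)
  assume "a \<noteq> 0"
  then have a: "a > 0" using assms(1) by simp
  \<comment> \<open>Close to the vertex \<open>- a / b\<close> of the parabola; the added 1 keeps
    the quotient defined when \<open>b = 0\<close>.\<close>
  define c where "c = - a / (b + 1)"
  have c: "c < 0" using a assms(2) by (simp add: c_def field_simps)
  have "c * b \<ge> - a" using a assms(2) by (simp add: c_def field_simps)
  then have "c * (c * b) \<le> c * (- a)" using c by (intro mult_left_mono_neg) auto
  then have "2 * c * a + c\<^sup>2 * b \<le> c * a" by (simp add: power2_eq_square algebra_simps)
  also have "\<dots> < 0" using c a by (simp add: mult_neg_pos)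
  finally show False using assms(3)[of c] by simp
qed

subsection \<open>Block Krylov spaces\<close>

locale krylov =
  fixes n p :: nat and A R :: "complex mat"
  assumes A: "A \<in> carrier_mat n n" and R: "R \<in> carrier_mat n p"
begin

abbreviation "K j \<equiv> block_krylov j A R"

lemma pow_carrier [simp]: "A ^\<^sub>m i \<in> carrier_mat n n"
  using A by (simp add: pow_carrier_mat)

lemma dims [simp]: "dim_row A = n" "dim_col A = n" "dim_row R = n" "dim_col R = p"
  "dim_row (A ^\<^sub>m i) = n" "dim_col (A ^\<^sub>m i) = n"
  using A R carrier_matD[OF pow_carrier] by auto

lemma K_eq: "K j = {msum n p (\<lambda>i. A ^\<^sub>m i * R * S i) {..<j} | S. \<forall>i<j. S i \<in> carrier_mat p p}"
  by (simp add: block_krylov_def msum_def lessThan_def)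

lemma K_I: "(\<And>i. i < j \<Longrightarrow> S i \<in> carrier_mat p p) \<Longrightarrow> msum n p (\<lambda>i. A ^\<^sub>m i * R * S i) {..<j} \<in> K j"
  unfolding K_eq by auto

lemma K_carrier: "X \<in> K j \<Longrightarrow> X \<in> carrier_mat n p"
  by (auto simp: K_eq)

lemma K_zero: "0\<^sub>m n p \<in> K j"
  unfolding K_eq by (auto intro!: exI[of _ "\<lambda>_. 0\<^sub>m p p"] msum_zero[symmetric])

lemma K_add:
  assumes "X \<in> K j" "Y \<in> K j" shows "X + Y \<in> K j"
proof -
  obtain S T where S: "\<forall>i<j. S i \<in> carrier_mat p p" "X = msum n p (\<lambda>i. A ^\<^sub>m i * R * S i) {..<j}"
    and T: "\<forall>i<j. T i \<in> carrier_mat p p" "Y = msum n p (\<lambda>i. A ^\<^sub>m i * R * T i) {..<j}"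
    using assms unfolding K_eq by blast
  have "A ^\<^sub>m i * R * (S i + T i) = A ^\<^sub>m i * R * S i + A ^\<^sub>m i * R * T i" if "i < j" for i
  proof -
    have "S i \<in> carrier_mat p p" "T i \<in> carrier_mat p p" using S T that by auto
    then show ?thesis by (simp add: mat_distrib_left)
  qed
  then have "msum n p (\<lambda>i. A ^\<^sub>m i * R * (S i + T i)) {..<j} =
      msum n p (\<lambda>i. A ^\<^sub>m i * R * S i + A ^\<^sub>m i * R * T i) {..<j}"
    by (intro msum_cong) auto
  also have "\<dots> = X + Y"
    unfolding S T using T(1)[rule_format, THEN carrier_matD(1)] T(1)[rule_format, THEN carrier_matD(2)]
    by (intro eq_matI) (auto simp: sum.distrib)
  finally have "X + Y = msum n p (\<lambda>i. A ^\<^sub>m i * R * (S i + T i)) {..<j}" by simp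
  moreover have "\<forall>i<j. S i + T i \<in> carrier_mat p p"
    using T(1)[rule_format, THEN carrier_matD(1)] T(1)[rule_format, THEN carrier_matD(2)] by simp
  ultimately show ?thesis using K_I by simp
qed

lemma K_mult:
  assumes "X \<in> K j" "C \<in> carrier_mat p p" shows "X * C \<in> K j"
proof -
  obtain S where S: "\<forall>i<j. S i \<in> carrier_mat p p" "X = msum n p (\<lambda>i. A ^\<^sub>m i * R * S i) {..<j}"
    using assms unfolding K_eq by blast
  have "X * C = msum n p (\<lambda>i. A ^\<^sub>m i * R * (S i * C)) {..<j}"
    unfolding S using S(1) assms(2)
    by (subst msum_mult) (auto intro!: msum_cong simp: mat_assoc)
  moreover have "\<forall>i<j. S i * C \<in> carrier_mat p p"
    using S(1)[rule_format, THEN carrier_matD(1)] assms(2) by simp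
  ultimately show ?thesis using K_I by simp
qed

lemma K_diff:
  assumes "X \<in> K j" "Y \<in> K j" shows "X - Y \<in> K j"
proof -
  have "X - Y = X + Y * (- 1\<^sub>m p)"
    using K_carrier[OF assms(1)] K_carrier[OF assms(2)] by (intro eq_matI) auto
  then show ?thesis using K_add[OF assms(1) K_mult[OF assms(2), of "- 1\<^sub>m p"]] by simp
qed

lemma K_mono: assumes "X \<in> K i" "i \<le> j" shows "X \<in> K j"
proof -
  obtain S where S: "\<forall>m<i. S m \<in> carrier_mat p p" "X = msum n p (\<lambda>m. A ^\<^sub>m m * R * S m) {..<i}"
    using assms unfolding K_eq by blast
  define T where "T m = (if m < i then S m else 0\<^sub>m p p)" for m
  have "X = msum n p (\<lambda>m. A ^\<^sub>m m * R * T m) {..<i}"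
    unfolding S by (rule msum_cong) (auto simp: T_def)
  also have "\<dots> = msum n p (\<lambda>m. A ^\<^sub>m m * R * T m) {..<j}"
    by (rule msum_mono_neutral[symmetric]) (use assms in \<open>auto simp: T_def\<close>)
  finally show ?thesis unfolding K_eq using S by (auto simp: T_def intro!: exI[of _ T])
qed

lemma K_base: "R \<in> K (Suc j)"
proof -
  have "R = msum n p (\<lambda>m. A ^\<^sub>m m * R * 1\<^sub>m p) {..<1}"
    using R by (intro eq_matI) auto
  then have "R \<in> K 1" unfolding K_eq by (auto intro!: exI[of _ "\<lambda>_. 1\<^sub>m p"])
  then show ?thesis by (rule K_mono) simp
qed

lemma pow_Suc_left: "A ^\<^sub>m Suc i = A * A ^\<^sub>m i"
  using A by (induction i) (auto simp: mat_assoc)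

lemma K_step:
  assumes "X \<in> K j" shows "A * X \<in> K (Suc j)"
proof -
  obtain S where S: "\<forall>i<j. S i \<in> carrier_mat p p" "X = msum n p (\<lambda>i. A ^\<^sub>m i * R * S i) {..<j}"
    using assms unfolding K_eq by blast
  define T where "T i = (case i of 0 \<Rightarrow> 0\<^sub>m p p | Suc i \<Rightarrow> S i)" for i
  have "A * X = msum n p (\<lambda>i. A ^\<^sub>m Suc i * R * S i) {..<j}"
    unfolding S using S(1)
    by (subst mult_msum) (auto intro!: msum_cong simp: mat_assoc pow_Suc_left simp del: pow_mat.simps)
  also have "\<dots> = msum n p (\<lambda>i. A ^\<^sub>m i * R * T i) {..<Suc j}"
    by (subst msum_Suc_shift) (auto simp: T_def simp del: pow_mat.simps)
  finally show ?thesis unfolding K_eq using S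
    by (auto intro!: exI[of _ T] simp: T_def split: nat.split)
qed

lemma K_msum:
  assumes "finite I" "\<And>i. i \<in> I \<Longrightarrow> f i \<in> K j" shows "msum n p f I \<in> K j"
  using assms
proof (induction I rule: finite_induct)
  case empty
  then show ?case by (simp add: msum_empty K_zero)
next
  case (insert x I)
  have "msum n p f (insert x I) = f x + msum n p f I"
    using insert K_carrier[of "f x" j] by (intro eq_matI) auto
  then show ?case using insert by (auto intro!: K_add)
qed

text \<open>Compares any graded family with the Krylov spaces through closure properties alone,
  without powers of \<open>A\<close>. The degree \<open>i\<close> is carried along because in
  \<open>K_span\<close> multiplication by \<open>A\<close> is controlled only below degree
  \<open>M\<close>.\<close>

lemma K_induct:
  assumes X: "X \<in> K j"
    and zero: "\<And>i. i \<le> j \<Longrightarrow> P i (0\<^sub>m n p)" and base: "0 < j \<Longrightarrow> P (Suc 0) R"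
    and add: "\<And>i X Y. i \<le> j \<Longrightarrow> P i X \<Longrightarrow> P i Y \<Longrightarrow> X \<in> carrier_mat n p \<Longrightarrow> Y \<in> carrier_mat n p \<Longrightarrow> P i (X + Y)"
    and mult: "\<And>i X C. i \<le> j \<Longrightarrow> P i X \<Longrightarrow> X \<in> carrier_mat n p \<Longrightarrow> C \<in> carrier_mat p p \<Longrightarrow> P i (X * C)"
    and step: "\<And>i X. i < j \<Longrightarrow> P i X \<Longrightarrow> X \<in> carrier_mat n p \<Longrightarrow> P (Suc i) (A * X)"
    and mono: "\<And>i X. i < j \<Longrightarrow> P i X \<Longrightarrow> P (Suc i) X"
  shows "P j X"
proof -
  obtain S where S: "\<forall>i<j. S i \<in> carrier_mat p p" "X = msum n p (\<lambda>i. A ^\<^sub>m i * R * S i) {..<j}"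
    using X unfolding K_eq by blast
  have pw: "i < j \<Longrightarrow> P (Suc i) (A ^\<^sub>m i * R)" for i
  proof (induction i)
    case 0
    then show ?case using base R by simp
  next
    case (Suc i)
    have "P (Suc (Suc i)) (A * (A ^\<^sub>m i * R))" using Suc by (intro step) auto
    then show ?case by (simp add: pow_Suc_left mat_assoc del: pow_mat.simps)
  qed
  have "i \<le> j \<Longrightarrow> P i (msum n p (\<lambda>i. A ^\<^sub>m i * R * S i) {..<i})" for i
  proof (induction i)
    case 0
    then show ?case using zero by (simp add: msum_empty)
  next
    case (Suc i)
    have "P (Suc i) (msum n p (\<lambda>i. A ^\<^sub>m i * R * S i) {..<i})" using Suc by (intro mono) auto
    moreover have "P (Suc i) (A ^\<^sub>m i * R * S i)" using Suc S pw[of i] by (intro mult[of "Suc i" "A ^\<^sub>m i * R"]) auto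
    moreover have "dim_col (S i) = p" using Suc.prems S(1)[rule_format, THEN carrier_matD(2)] by simp
    ultimately show ?case using Suc.prems by (subst msum_Suc) (auto intro!: add)
  qed
  then show ?thesis using S by simp
qed

end

subsection \<open>Characterization of the iterates by orthogonality\<close>

lemma residual_add:
  assumes "A \<in> carrier_mat n n" "B \<in> carrier_mat n p" "X0 \<in> carrier_mat n p" "K \<in> carrier_mat n p"
  shows "residual A B (X0 + K) = residual A B X0 - A * K"
  using assms by (auto simp: residual_def mat_distrib_left intro!: eq_matI)

text \<open>Any competitor has the residual of \<open>X0 + K\<close> plus an element of the image of
  the Krylov space, so Pythagoras applies. No uniqueness of the iterate is involved.\<close>

lemma gmres_iterateI:
  assumes A: "A \<in> carrier_mat n n" and B: "B \<in> carrier_mat n p" and X0: "X0 \<in> carrier_mat n p"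
    and K: "K \<in> block_krylov j A (residual A B X0)"
    and orth: "\<And>K'. K' \<in> block_krylov j A (residual A B X0) \<Longrightarrow>
      adj (A * K') * (residual A B X0 - A * K) = 0\<^sub>m p p"
  shows "gmres_iterate A B X0 j (X0 + K)"
proof -
  define R where "R = residual A B X0"
  have R: "R \<in> carrier_mat n p" using A B X0 unfolding R_def residual_def by (intro minus_carrier_mat) auto
  interpret krylov n p A R by unfold_locales (use A R in auto)
  have Kc: "K \<in> carrier_mat n p" using K_carrier[of K j] K by (simp add: R_def)
  have "frobenius_norm (residual A B (X0 + K)) \<le> frobenius_norm (residual A B (X0 + Y))"
    if Y: "Y \<in> block_krylov j A R" for Y
  proof -
    have Yc: "Y \<in> carrier_mat n p" using K_carrier[OF Y] by simp
    define D where "D = A * (K - Y)"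
    have D: "D \<in> carrier_mat n p" using A Kc Yc unfolding D_def by auto
    have "residual A B (X0 + Y) = (R - A * K) + D"
      using R A Kc Yc carrier_matD[OF Kc] carrier_matD[OF Yc] unfolding residual_add[OF A B X0 Yc] D_def R_def[symmetric]
      by (subst mat_diff_left) (auto intro!: eq_matI)
    moreover have "fro2 ((R - A * K) + D) = fro2 (R - A * K) + fro2 D"
    proof (rule fro2_pythagoras[of _ n p])
      show "R - A * K \<in> carrier_mat n p" using R A Kc by (intro minus_carrier_mat) auto
      show "adj D * (R - A * K) = 0\<^sub>m p p"
        unfolding D_def R_def by (rule orth) (use K_diff K Y in \<open>auto simp: R_def\<close>)
    qed (rule D)
    ultimately show ?thesis
      using residual_add[OF A B X0 Kc] fro2_nonneg[of D] by (simp add: frobenius_norm_eq R_def)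
  qed
  then show ?thesis unfolding gmres_iterate_def is_arg_min_def R_def[symmetric]
    using K by (auto simp: R_def not_less)
qed

text \<open>Minimality of one real number gives orthogonality of whole blocks because Krylov spaces
  are closed under right multiplication by \<open>p x p\<close> matrices: the direction
  \<open>K'\<close> may be multiplied by the very matrix \<open>T\<close> that is to vanish.\<close>

lemma gmres_iterateD:
  assumes A: "A \<in> carrier_mat n n" and B: "B \<in> carrier_mat n p" and X0: "X0 \<in> carrier_mat n p"
    and g: "gmres_iterate A B X0 j X"
  obtains K where "K \<in> block_krylov j A (residual A B X0)" "X = X0 + K"
    "residual A B X = residual A B X0 - A * K"
    "\<And>K'. K' \<in> block_krylov j A (residual A B X0) \<Longrightarrow> adj (A * K') * residual A B X = 0\<^sub>m p p"
proof -
  define R where "R = residual A B X0"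
  have R: "R \<in> carrier_mat n p" using A B X0 unfolding R_def residual_def by (intro minus_carrier_mat) auto
  interpret krylov n p A R by unfold_locales (use A R in auto)
  obtain K where K: "K \<in> block_krylov j A R" "X = X0 + K"
    and mn: "\<And>Y. Y \<in> block_krylov j A R \<Longrightarrow>
      frobenius_norm (residual A B X) \<le> frobenius_norm (residual A B (X0 + Y))"
    using g unfolding gmres_iterate_def is_arg_min_def R_def[symmetric] by (auto simp: not_less)
  have Kc: "K \<in> carrier_mat n p" using K_carrier[OF K(1)] by simp
  have res: "residual A B X = R - A * K" unfolding K R_def by (rule residual_add[OF A B X0 Kc])
  define S where "S = R - A * K"
  have S: "S \<in> carrier_mat n p" using R A Kc unfolding S_def by (intro minus_carrier_mat) auto
  have orth: "adj (A * K') * S = 0\<^sub>m p p" if K': "K' \<in> block_krylov j A R" for K'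
  proof -
    have K'c: "K' \<in> carrier_mat n p" using K_carrier[OF K'] by simp
    define D where "D = A * K'"
    have D: "D \<in> carrier_mat n p" using A K'c by (simp add: D_def)
    define T where "T = adj D * S"
    have T: "T \<in> carrier_mat p p" using D S by (simp add: T_def)
    have DT: "D * T \<in> carrier_mat n p" using D T by simp
    have "0 \<le> 2 * c * fro2 T + c\<^sup>2 * fro2 (D * T)" for c
    proof -
      \<comment> \<open>With this perturbation the linear term in \<open>c\<close> is
        \<open>2 * c * fro2 T\<close>, which forces \<open>T\<close> to be zero.\<close>
      define Y where "Y = K - K' * (of_real c \<cdot>\<^sub>m T)"
      have Y: "Y \<in> block_krylov j A R"
        unfolding Y_def by (intro K_diff K_mult K K') (use T in auto)
      have "residual A B (X0 + Y) = R - A * Y"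
        unfolding R_def by (rule residual_add[OF A B X0]) (rule K_carrier[OF Y])
      also have "A * Y = A * K - of_real c \<cdot>\<^sub>m (D * T)"
      proof -
        have "K' * (of_real c \<cdot>\<^sub>m T) = of_real c \<cdot>\<^sub>m (K' * T)"
          by (rule mult_smult_distrib[OF K'c T])
        then have "A * (K' * (of_real c \<cdot>\<^sub>m T)) = of_real c \<cdot>\<^sub>m (A * (K' * T))"
          using mult_smult_distrib[OF A, of "K' * T" p] K'c T by simp
        then show ?thesis unfolding Y_def D_def
          using A Kc K'c T by (subst mat_diff_left) (auto simp: mat_assoc)
      qed
      also have "R - (A * K - of_real c \<cdot>\<^sub>m (D * T)) = S + of_real c \<cdot>\<^sub>m (D * T)"
        using R A Kc DT unfolding S_def by (intro eq_matI) (auto)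
      finally have "frobenius_norm (residual A B (X0 + Y)) = sqrt (fro2 (S + of_real c \<cdot>\<^sub>m (D * T)))"
        by (simp add: frobenius_norm_eq)
      then have "fro2 S \<le> fro2 (S + of_real c \<cdot>\<^sub>m (D * T))"
        using mn[OF Y] unfolding res S_def[symmetric] by (simp add: frobenius_norm_eq)
      moreover have "adj (D * T) * S = adj T * T"
        using D S T by (simp add: adj_mult T_def mat_assoc)
      moreover have "Re (\<Sum>j<p. (adj T * T) $$ (j,j)) = fro2 T"
        using fro2_trace[of T] T by (metis Re_complex_of_real carrier_matD(2))
      ultimately show ?thesis unfolding fro2_add_scaled[OF S DT] by simp
    qed
    then have "fro2 T = 0"
      by (intro quadratic_dominates_linear[of "fro2 T" "fro2 (D * T)"]) (auto simp: fro2_nonneg)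
    from fro2_eq_0[OF this] have "T = 0\<^sub>m p p" using T by (metis carrier_matD)
    then show ?thesis by (simp add: T_def D_def)
  qed
  show ?thesis
    by (rule that[of K]) (use K res orth in \<open>auto simp: R_def S_def\<close>)
qed

section \<open>Block matrices\<close>

lemma block_index: "i < m \<Longrightarrow> c < p \<Longrightarrow> i * p + c < m * (p::nat)"
proof -
  assume "i < m" "c < p"
  then have "i * p + c < Suc i * p" by simp
  also have "\<dots> \<le> m * p" using \<open>i < m\<close> by (intro mult_le_mono1) simp
  finally show ?thesis .
qed

lemma block_div_mod: "j < m * p \<Longrightarrow> j div p < m \<and> j mod p < (p::nat)"
  by (metis less_mult_imp_div_less mod_less_divisor mult_0_right not_gr0 not_less0)

lemma sum_block: "sum f {..<m * p} = (\<Sum>i<m. \<Sum>c<p. f (i * p + c))" for f :: "nat \<Rightarrow> complex"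
proof (induction m)
  case (Suc m)
  have "{..<Suc m * p} = {..<m * p} \<union> {m * p..<m * p + p}" by auto
  then have "sum f {..<Suc m * p} = sum f {..<m * p} + sum f {m * p..<m * p + p}"
    by (simp add: sum.union_disjoint ivl_disj_int)
  also have "sum f {m * p..<m * p + p} = (\<Sum>c<p. f (m * p + c))"
    using sum.shift_bounds_nat_ivl[of f 0 "m * p" p] by (simp add: lessThan_atLeast0 add.commute)
  finally show ?case using Suc by simp
qed simp

definition bcols :: "nat \<Rightarrow> nat \<Rightarrow> nat \<Rightarrow> (nat \<Rightarrow> complex mat) \<Rightarrow> complex mat" where
  "bcols n p m f = mat n (m * p) (\<lambda>(i,j). f (j div p) $$ (i, j mod p))"

definition bcol :: "nat \<Rightarrow> nat \<Rightarrow> complex mat \<Rightarrow> nat \<Rightarrow> complex mat" where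
  "bcol n p V i = mat n p (\<lambda>(r,c). V $$ (r, i * p + c))"

definition bmat :: "nat \<Rightarrow> nat \<Rightarrow> nat \<Rightarrow> (nat \<Rightarrow> nat \<Rightarrow> complex mat) \<Rightarrow> complex mat" where
  "bmat p a b f = mat (a * p) (b * p) (\<lambda>(i,j). f (i div p) (j div p) $$ (i mod p, j mod p))"

lemma block_dims [simp]:
  "dim_row (bcols n p m f) = n" "dim_col (bcols n p m f) = m * p"
  "dim_row (bcol n p V i) = n" "dim_col (bcol n p V i) = p"
  "dim_row (bmat p a b g) = a * p" "dim_col (bmat p a b g) = b * p"
  "dim_row (block_entry p H i j) = p" "dim_col (block_entry p H i j) = p"
  "dim_row (leading_part r c H) = r" "dim_col (leading_part r c H) = c"
  by (auto simp: bcols_def bcol_def bmat_def block_entry_def leading_part_def)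

lemma block_carrier [simp]:
  "bcols n p m f \<in> carrier_mat n (m * p)" "bcol n p V i \<in> carrier_mat n p"
  "bmat p a b g \<in> carrier_mat (a * p) (b * p)" "block_entry p H i j \<in> carrier_mat p p"
  "leading_part r c H \<in> carrier_mat r c"
  by (auto intro!: carrier_matI)

lemma bcol_entry [simp]: "r < n \<Longrightarrow> c < p \<Longrightarrow> bcol n p V i $$ (r,c) = V $$ (r, i * p + c)"
  by (simp add: bcol_def)

lemma block_entry_entry [simp]:
  "r < p \<Longrightarrow> c < p \<Longrightarrow> block_entry p H i j $$ (r,c) = H $$ (i * p + r, j * p + c)"
  by (simp add: block_entry_def)

lemma leading_part_entry [simp]: "i < r \<Longrightarrow> j < c \<Longrightarrow> leading_part r c H $$ (i,j) = H $$ (i,j)"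
  by (simp add: leading_part_def)

lemma bcols_entry [simp]:
  "r < n \<Longrightarrow> i < m \<Longrightarrow> c < p \<Longrightarrow> bcols n p m f $$ (r, i * p + c) = f i $$ (r,c)"
  using block_index[of i m c p] by (simp add: bcols_def)

lemma bmat_entry [simp]:
  "i < a \<Longrightarrow> j < b \<Longrightarrow> r < p \<Longrightarrow> c < p \<Longrightarrow>
    bmat p a b f $$ (i * p + r, j * p + c) = f i j $$ (r,c)"
  using block_index[of i a r p] block_index[of j b c p] by (simp add: bmat_def)

lemma block_mat_eqI:
  assumes "A \<in> carrier_mat (a * p) (b * p)" "B \<in> carrier_mat (a * p) (b * p)"
    "\<And>i j r c. i < a \<Longrightarrow> j < b \<Longrightarrow> r < p \<Longrightarrow> c < p \<Longrightarrow>
      A $$ (i * p + r, j * p + c) = B $$ (i * p + r, j * p + c)"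
  shows "A = B"
proof (rule eq_matI)
  fix i j assume "i < dim_row B" "j < dim_col B"
  then have "i div p < a" "i mod p < p" "j div p < b" "j mod p < p"
    using assms(2) block_div_mod[of i a p] block_div_mod[of j b p] by auto
  from assms(3)[OF this(1,3,2,4)] show "A $$ (i,j) = B $$ (i,j)" by simp
qed (use assms in auto)

lemma block_cols_eqI:
  assumes "A \<in> carrier_mat n (m * p)" "B \<in> carrier_mat n (m * p)"
    "\<And>i. i < m \<Longrightarrow> bcol n p A i = bcol n p B i"
  shows "A = B"
proof (rule eq_matI)
  fix i j assume ij: "i < dim_row B" "j < dim_col B"
  then have *: "j div p < m" "j mod p < p"
    using assms(2) block_div_mod[of j m p] by auto
  have "bcol n p A (j div p) $$ (i, j mod p) = bcol n p B (j div p) $$ (i, j mod p)"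
    using assms(3)[OF *(1)] by simp
  then show "A $$ (i,j) = B $$ (i,j)" using * ij assms(1,2) by simp
qed (use assms in auto)

lemma bcol_bcols [simp]: "i < m \<Longrightarrow> f i \<in> carrier_mat n p \<Longrightarrow> bcol n p (bcols n p m f) i = f i"
  by (rule eq_matI) auto

lemma block_entry_bmat [simp]:
  "i < a \<Longrightarrow> j < b \<Longrightarrow> f i j \<in> carrier_mat p p \<Longrightarrow> block_entry p (bmat p a b f) i j = f i j"
  by (rule eq_matI) auto

lemma leading_part_bmat: "a' \<le> a \<Longrightarrow> b' \<le> b \<Longrightarrow>
    leading_part (a' * p) (b' * p) (bmat p a b f) = bmat p a' b' f"
  by (rule block_mat_eqI[of _ a' p b']) (auto simp: block_index)

lemma block_entry_leading_part [simp]: "i < a \<Longrightarrow> j < b \<Longrightarrow>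
    block_entry p (leading_part (a * p) (b * p) H) i j = block_entry p H i j"
  by (rule eq_matI) (auto simp: block_index)

lemma bcol_mult:
  assumes "V \<in> carrier_mat n (m * p)" "H \<in> carrier_mat (m * p) (b * p)" "j < b"
  shows "bcol n p (V * H) j = msum n p (\<lambda>i. bcol n p V i * block_entry p H i j) {..<m}"
  by (rule eq_matI) (use assms in \<open>auto simp: mult_entry block_index sum_block\<close>)

lemma bcol_mult_left:
  assumes "A \<in> carrier_mat n n" "V \<in> carrier_mat n (m * p)" "i < m"
  shows "bcol n p (A * V) i = A * bcol n p V i"
  by (rule eq_matI) (use assms in \<open>auto simp: mult_entry block_index\<close>)

lemma block_entry_mult:
  assumes "F \<in> carrier_mat (a * p) (m * p)" "G \<in> carrier_mat (m * p) (b * p)" "i < a" "j < b"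
  shows "block_entry p (F * G) i j = msum p p (\<lambda>k. block_entry p F i k * block_entry p G k j) {..<m}"
  by (rule eq_matI) (use assms in \<open>auto simp: mult_entry block_index sum_block\<close>)

lemma bmat_mult:
  assumes "\<And>i k. i < a \<Longrightarrow> k < m \<Longrightarrow> F i k \<in> carrier_mat p p"
    "\<And>k j. k < m \<Longrightarrow> j < b \<Longrightarrow> G k j \<in> carrier_mat p p"
  shows "bmat p a m F * bmat p m b G = bmat p a b (\<lambda>i j. msum p p (\<lambda>k. F i k * G k j) {..<m})"
proof (rule block_mat_eqI[of _ a p b])
  fix i j r c assume *: "i < a" "j < b" "r < p" "c < p"
  have "(bmat p a m F * bmat p m b G) $$ (i * p + r, j * p + c) =
      (\<Sum>k<m. \<Sum>s<p. F i k $$ (r,s) * G k j $$ (s,c))"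
    using * by (simp add: mult_entry block_index sum_block)
  also have "\<dots> = (\<Sum>k<m. (F i k * G k j) $$ (r,c))"
    by (rule sum.cong[OF refl], subst mult_entry)
      (use * assms[THEN carrier_matD(1)] assms[THEN carrier_matD(2)] in auto)
  finally show "(bmat p a m F * bmat p m b G) $$ (i * p + r, j * p + c) =
      bmat p a b (\<lambda>i j. msum p p (\<lambda>k. F i k * G k j) {..<m}) $$ (i * p + r, j * p + c)"
    using * by simp
qed auto

lemma block_entry_gram:
  assumes "V \<in> carrier_mat n (a * p)" "W \<in> carrier_mat n (b * p)" "i < a" "j < b"
  shows "block_entry p (adj V * W) i j = adj (bcol n p V i) * bcol n p W j"
  by (rule eq_matI) (use assms in \<open>auto simp: mult_entry block_index\<close>)

lemma block_entry_one: "i < m \<Longrightarrow> j < m \<Longrightarrow>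
    block_entry p (1\<^sub>m (m * p)) i j = (if i = j then 1\<^sub>m p else 0\<^sub>m p p)"
proof (rule eq_matI)
  fix r c assume "i < m" "j < m" "r < dim_row (if i = j then 1\<^sub>m p else 0\<^sub>m p p :: complex mat)"
    "c < dim_col (if i = j then 1\<^sub>m p else 0\<^sub>m p p :: complex mat)"
  then have *: "i < m" "j < m" "r < p" "c < p" by (auto split: if_splits)
  have "i * p + r = j * p + c \<longleftrightarrow> i = j \<and> r = c"
  proof -
    have "(i * p + r) div p = i" "(i * p + r) mod p = r" "(j * p + c) div p = j" "(j * p + c) mod p = c"
      using * by auto
    then show ?thesis by metis
  qed
  then show "block_entry p (1\<^sub>m (m * p)) i j $$ (r,c) = (if i = j then 1\<^sub>m p else 0\<^sub>m p p) $$ (r,c)"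
    using * by (auto simp: block_index)
qed auto

lemma block_entry_eqI:
  assumes "A \<in> carrier_mat (a * p) (b * p)" "B \<in> carrier_mat (a * p) (b * p)"
    "\<And>i j. i < a \<Longrightarrow> j < b \<Longrightarrow> block_entry p A i j = block_entry p B i j"
  shows "A = B"
proof (rule block_mat_eqI[OF assms(1,2)])
  fix i j r c assume *: "i < a" "j < b" "r < p" "c < p"
  show "A $$ (i * p + r, j * p + c) = B $$ (i * p + r, j * p + c)"
    using arg_cong[OF assms(3)[OF *(1,2)], of "\<lambda>X. X $$ (r,c)"] * by simp
qed

lemma append_columns_dims [simp]: "dim_row (append_columns V W) = dim_row V"
  "dim_col (append_columns V W) = dim_col V + dim_col W"
  by (auto simp: append_columns_def)

lemma bcol_append_columns:
  assumes "V \<in> carrier_mat n (m * p)" "W \<in> carrier_mat n p" "i \<le> m"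
  shows "bcol n p (append_columns V W) i = (if i < m then bcol n p V i else W)"
proof (rule eq_matI)
  fix r c assume "r < dim_row (if i < m then bcol n p V i else W)"
    "c < dim_col (if i < m then bcol n p V i else W)"
  then have *: "r < n" "c < p" using assms by (auto split: if_splits)
  have "i * p + c < m * p + p" using block_index[of i "Suc m" c p] assms * by simp
  then show "bcol n p (append_columns V W) i $$ (r,c) = (if i < m then bcol n p V i else W) $$ (r,c)"
    using assms * block_index[of i m c p]
    by (auto simp: append_columns_def mat_of_cols_index nth_append cols_nth)
qed (use assms in auto)

lemma leading_part_bcol: "p \<le> dim_col V \<Longrightarrow> dim_row V = n \<Longrightarrow> leading_part n p V = bcol n p V 0"
  by (rule eq_matI) auto

lemma bcol_arnoldi:
  assumes "V \<in> carrier_mat n (M * p)" "W \<in> carrier_mat n p" "j < M"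
    and H: "H \<in> carrier_mat ((M + 1) * p) ((M + 1) * p)"
  shows "bcol n p (append_columns V W * leading_part ((M + 1) * p) (M * p) H) j =
    msum n p (\<lambda>i. (if i < M then bcol n p V i else W) * block_entry p H i j) {..<M + 1}"
proof -
  have "bcol n p (append_columns V W * leading_part ((M + 1) * p) (M * p) H) j =
    msum n p (\<lambda>i. bcol n p (append_columns V W) i *
      block_entry p (leading_part ((M + 1) * p) (M * p) H) i j) {..<M + 1}"
    by (rule bcol_mult[where b = M]) (use assms in \<open>auto intro: carrier_matI simp: add_mult_distrib\<close>)
  also have "\<dots> = msum n p (\<lambda>i. (if i < M then bcol n p V i else W) * block_entry p H i j) {..<M + 1}"
    using assms by (intro msum_cong refl) (simp add: bcol_append_columns del: add_Suc_right One_nat_def)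
  finally show ?thesis .
qed

section \<open>Block Arnoldi vectors and Krylov spaces\<close>

text \<open>The relation is required only for \<open>Suc j < M\<close>, where ordinary cycles and
  the last cycle agree; they differ only in the image of the last block vector. Orthogonality is
  left out, since the comparison with Krylov spaces needs only invertible subdiagonal
  blocks.\<close>

locale arnoldi = krylov n p A R for n p A R +
  fixes M :: nat and v :: "nat \<Rightarrow> complex mat" and H :: "nat \<Rightarrow> nat \<Rightarrow> complex mat" and S :: "complex mat"
  assumes v [simp]: "v i \<in> carrier_mat n p" and H [simp]: "H i j \<in> carrier_mat p p"
    and start: "R = v 0 * S" and S: "nonsing p S"
    and rel: "Suc j < M \<Longrightarrow> A * v j = msum n p (\<lambda>i. v i * H i j) {..<Suc (Suc j)}"
    and sub: "Suc j < M \<Longrightarrow> nonsing p (H (Suc j) j)"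
begin

lemma vH_dims [simp]: "dim_row (v i) = n" "dim_col (v i) = p" "dim_row (H i j) = p" "dim_col (H i j) = p"
  using carrier_matD[OF v] carrier_matD[OF H] by auto

text \<open>The relation for column \<open>j\<close> is solved for \<open>v (Suc j)\<close>: all
  other terms lie in the Krylov space by induction, and the subdiagonal block can be
  inverted.\<close>

lemma v_in_K: "i < M \<Longrightarrow> v i \<in> K (Suc i)"
proof (induction i rule: less_induct)
  case (less i)
  show ?case
  proof (cases i)
    case 0
    have "v 0 = R * minv S"
      using nonsing_minv[OF S] nonsing_carrier[OF S] by (simp add: start mat_assoc)
    then show ?thesis using 0 K_mult[OF K_base] nonsing_minv[OF S] by auto
  next
    case (Suc j)
    have "A * v j - msum n p (\<lambda>i. v i * H i j) {..<Suc j} = v i * H i j"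
    proof -
      have "A * v j = msum n p (\<lambda>i. v i * H i j) {..<Suc j} + v i * H i j"
        using rel[of j] less.prems Suc msum_Suc[of "\<lambda>i. v i * H i j" "Suc j" n p] by simp
      then show ?thesis by (simp only:) (rule eq_matI, auto)
    qed
    moreover have "A * v j - msum n p (\<lambda>i. v i * H i j) {..<Suc j} \<in> K (Suc i)"
    proof (rule K_diff)
      show "A * v j \<in> K (Suc i)" unfolding Suc by (rule K_step) (use less Suc in auto)
      show "msum n p (\<lambda>i. v i * H i j) {..<Suc j} \<in> K (Suc i)"
      proof (intro K_msum K_mult)
        fix m assume "m \<in> {..<Suc j}"
        then show "v m \<in> K (Suc i)"
          using less.prems Suc by (intro K_mono[OF less.IH[of m]]) auto
      qed auto
    qed
    ultimately have "v i * H i j * minv (H i j) \<in> K (Suc i)"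
      using sub[of j] less.prems Suc nonsing_minv(1)[of p "H i j"] by (auto intro!: K_mult)
    then show ?thesis
      using sub[of j] less.prems Suc nonsing_minv[of p "H i j"] by (simp add: mat_assoc)
  qed
qed

definition span :: "nat \<Rightarrow> complex mat set" where
  "span j = {msum n p (\<lambda>m. v m * Y m) {..<j} | Y. \<forall>m. Y m \<in> carrier_mat p p}"

lemma spanI: "(\<And>m. Y m \<in> carrier_mat p p) \<Longrightarrow> X = msum n p (\<lambda>m. v m * Y m) {..<j} \<Longrightarrow> X \<in> span j"
  by (auto simp: span_def)

lemma span_carrier: "X \<in> span j \<Longrightarrow> X \<in> carrier_mat n p"
  by (auto simp: span_def)

lemma span_mono: assumes "X \<in> span i" "i \<le> j" shows "X \<in> span j"
proof -
  obtain Y where Y: "\<And>m. Y m \<in> carrier_mat p p" "X = msum n p (\<lambda>m. v m * Y m) {..<i}"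
    using assms by (auto simp: span_def)
  have "X = msum n p (\<lambda>m. v m * (if m < i then Y m else 0\<^sub>m p p)) {..<i}"
    unfolding Y by (rule msum_cong) auto
  also have "\<dots> = msum n p (\<lambda>m. v m * (if m < i then Y m else 0\<^sub>m p p)) {..<j}"
    by (rule msum_mono_neutral[symmetric]) (use assms in auto)
  finally show ?thesis by (intro spanI) (use Y in auto)
qed

lemma span_add: assumes "X \<in> span j" "X' \<in> span j" shows "X + X' \<in> span j"
proof -
  obtain Y Y' where Y: "\<And>m. Y m \<in> carrier_mat p p" "X = msum n p (\<lambda>m. v m * Y m) {..<j}"
    and Y': "\<And>m. Y' m \<in> carrier_mat p p" "X' = msum n p (\<lambda>m. v m * Y' m) {..<j}"
    using assms by (auto simp: span_def)
  note d = carrier_matD[OF Y(1)] carrier_matD[OF Y'(1)]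
  have "msum n p (\<lambda>m. v m * (Y m + Y' m)) {..<j} = msum n p (\<lambda>m. v m * Y m + v m * Y' m) {..<j}"
    by (rule msum_cong) (auto simp: mat_distrib_left d)
  also have "\<dots> = X + X'" unfolding Y Y' by (rule eq_matI) (auto simp: d sum.distrib)
  finally show ?thesis by (intro spanI[of "\<lambda>m. Y m + Y' m"]) (auto simp: d)
qed

lemma span_mult: assumes "X \<in> span j" "C \<in> carrier_mat p p" shows "X * C \<in> span j"
proof -
  obtain Y where Y: "\<And>m. Y m \<in> carrier_mat p p" "X = msum n p (\<lambda>m. v m * Y m) {..<j}"
    using assms by (auto simp: span_def)
  note d = carrier_matD[OF Y(1)]
  have "X * C = msum n p (\<lambda>m. v m * (Y m * C)) {..<j}"
    unfolding Y using assms by (subst msum_mult) (auto intro!: msum_cong simp: d mat_assoc)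
  then show ?thesis by (intro spanI[of "\<lambda>m. Y m * C"]) (use assms in \<open>auto simp: d\<close>)
qed

lemma span_zero: "0\<^sub>m n p \<in> span j"
  by (rule spanI[of "\<lambda>_. 0\<^sub>m p p"]) (auto intro!: msum_zero[symmetric])

lemma v_in_span: "i < j \<Longrightarrow> v i * C \<in> span j" if "C \<in> carrier_mat p p"
proof -
  assume "i < j"
  have "msum n p (\<lambda>m. v m * (if m = i then C else 0\<^sub>m p p)) {..<j} = v i * C"
    by (subst msum_single[of _ i]) (use that \<open>i < j\<close> in auto)
  then show ?thesis by (intro spanI[of "\<lambda>m. if m = i then C else 0\<^sub>m p p"]) (use that in auto)
qed

lemma span_msum: "finite I \<Longrightarrow> (\<And>i. i \<in> I \<Longrightarrow> f i \<in> span j) \<Longrightarrow> msum n p f I \<in> span j"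
proof (induction I rule: finite_induct)
  case (insert x I)
  have "f x \<in> carrier_mat n p" using insert span_carrier[of "f x" j] by auto
  then have "msum n p f (insert x I) = f x + msum n p f I"
    using insert by (intro eq_matI) auto
  then show ?case using insert by (auto intro!: span_add)
qed (simp add: msum_empty span_zero)

lemma span_step: assumes "X \<in> span i" "i < M" shows "A * X \<in> span (Suc i)"
proof -
  obtain Y where Y: "\<And>m. Y m \<in> carrier_mat p p" "X = msum n p (\<lambda>m. v m * Y m) {..<i}"
    using assms by (auto simp: span_def)
  note d = carrier_matD[OF Y(1)]
  have "A * X = msum n p (\<lambda>m. A * v m * Y m) {..<i}"
    unfolding Y by (subst mult_msum) (auto simp: d mat_assoc)
  moreover have "A * v m * Y m \<in> span (Suc i)" if "m < i" for m
  proof (rule span_mult)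
    show "A * v m \<in> span (Suc i)"
      using assms that by (subst rel) (auto intro!: span_msum v_in_span)
  qed (rule Y)
  ultimately show ?thesis by (auto intro!: span_msum)
qed

text \<open>The converse of \<open>v_in_K\<close>: the Hessenberg shape lets \<open>A\<close> raise
  the number of spanning vectors by at most one.\<close>

lemma K_span:
  assumes "X \<in> K j" "j \<le> M" shows "X \<in> span j"
proof (rule K_induct[where P = "\<lambda>i X. X \<in> span i", OF assms(1)])
  show "R \<in> span (Suc 0)" using v_in_span[of S 0 1] nonsing_carrier[OF S] by (simp add: start)
qed (use assms(2) in \<open>auto intro: span_zero span_add span_mult span_step span_mono\<close>)

text \<open>Makes the optimality condition of GMRES checkable on finitely many vectors, the images
  \<open>A * v m\<close>.\<close>

lemma K_orth:
  assumes "X \<in> K j" "j \<le> M" "Z \<in> carrier_mat n p"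
    and orth: "\<And>m. m < j \<Longrightarrow> adj (A * v m) * Z = 0\<^sub>m p p"
  shows "adj (A * X) * Z = 0\<^sub>m p p"
proof -
  obtain Y where Y: "\<And>m. Y m \<in> carrier_mat p p" "X = msum n p (\<lambda>m. v m * Y m) {..<j}"
    using K_span[OF assms(1,2)] by (auto simp: span_def)
  note d = carrier_matD[OF Y(1)]
  have "A * X = msum n p (\<lambda>m. A * v m * Y m) {..<j}"
    unfolding Y by (subst mult_msum) (auto simp: d mat_assoc)
  then have "adj (A * X) * Z = msum p p (\<lambda>m. adj (Y m) * (adj (A * v m) * Z)) {..<j}"
    using assms(3) by (simp add: adj_msum msum_mult d adj_mult mat_assoc)
  also have "\<dots> = 0\<^sub>m p p" by (rule msum_zero) (auto simp: orth d)
  finally show ?thesis .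
qed

end

section \<open>Stagnation forces a zero Ritz value\<close>

lemma adj_inner:
  assumes "Z \<in> carrier_mat n p" "w \<in> carrier_vec n" "u \<in> carrier_vec p"
  shows "(adj Z *\<^sub>v w) \<bullet>c u = w \<bullet>c (Z *\<^sub>v u)"
proof -
  have "(adj Z *\<^sub>v w) \<bullet>c u = (\<Sum>i<p. \<Sum>k<n. cnj (Z $$ (k,i)) * w $ k * cnj (u $ i))"
    using assms by (auto simp: scalar_prod_def lessThan_atLeast0 sum_distrib_right intro!: sum.cong)
  also have "\<dots> = (\<Sum>k<n. \<Sum>i<p. w $ k * cnj (Z $$ (k,i) * u $ i))"
    by (subst sum.swap) (auto simp: mult_ac intro!: sum.cong)
  also have "\<dots> = w \<bullet>c (Z *\<^sub>v u)"
    using assms by (auto simp: scalar_prod_def lessThan_atLeast0 sum_distrib_left intro!: sum.cong)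
  finally show ?thesis .
qed

lemma gram_form:
  assumes "Z \<in> carrier_mat n p" "u \<in> carrier_vec p"
  shows "((adj Z * Z) *\<^sub>v u) \<bullet>c u = (Z *\<^sub>v u) \<bullet>c (Z *\<^sub>v u)"
  using adj_inner[OF assms(1) _ assms(2), of "Z *\<^sub>v u"] assms
  by (simp add: assoc_mult_mat_vec[where n\<^sub>1 = p and n\<^sub>2 = n and n\<^sub>3 = p])

lemma Splus_nonsing: "R \<in> Splus p \<Longrightarrow> nonsing p R"
proof -
  assume R: "R \<in> Splus p"
  then have "det R = prod_list (diag_mat R)"
    by (intro det_upper_triangular[of _ p]) (auto simp: Splus_def)
  then show ?thesis using R by (auto simp: nonsing_def Splus_def diag_mat_def prod_list_zero_iff)
qed

lemma zero_in_eigenvalue_mset: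
  assumes A: "A \<in> carrier_mat n n" and "\<not> nonsing n A"
  shows "0 \<in># eigenvalue_mset A"
proof -
  have "det A = 0" using assms by (simp add: nonsing_def)
  then obtain v where "v \<in> carrier_vec n" "v \<noteq> 0\<^sub>v n" "A *\<^sub>v v = 0\<^sub>v n"
    using det_0_iff_vec_prod_zero[OF A] by auto
  then have "eigenvalue A 0" using A by (auto simp: eigenvalue_def eigenvector_def intro!: exI[of _ v])
  then have "poly (char_poly A) 0 = 0" using eigenvalue_root_char_poly[OF A] by simp
  moreover have "char_poly A \<noteq> 0" using degree_monic_char_poly[OF A] by auto
  ultimately show ?thesis by (simp add: eigenvalue_mset_def)
qed

lemma block_entry_adj: "A \<in> carrier_mat (a * p) (b * p) \<Longrightarrow> i < b \<Longrightarrow> j < a \<Longrightarrow>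
    block_entry p (adj A) i j = adj (block_entry p A j i)"
  by (rule eq_matI) (auto simp: block_index)

text \<open>\<open>compress\<close> also covers the last column \<open>j = M - 1\<close>, about
  which \<open>rel\<close> is silent; it identifies the leading parts of \<open>H\<close> with
  compressions of \<open>A\<close>.\<close>

locale orth_arnoldi = arnoldi +
  assumes orth: "i < M \<Longrightarrow> j < M \<Longrightarrow> adj (v i) * v j = (if i = j then 1\<^sub>m p else 0\<^sub>m p p)"
    and compress: "i < M \<Longrightarrow> j < M \<Longrightarrow> adj (v i) * (A * v j) = H i j"
begin

text \<open>\<open>Z\<close> and \<open>Z'\<close> stand for the residuals after
  \<open>j - 1\<close> and \<open>j\<close> steps. In general \<open>Z'\<close> needs one more
  Arnoldi vector than \<open>Z\<close>, but in the direction \<open>u\<close> both agree, so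
  \<open>Z'\<close> applied to \<open>u\<close> stays in the span of the first \<open>j\<close>
  vectors. There its orthogonality to the images of these vectors becomes a kernel vector of
  \<open>adj G\<close>.\<close>

lemma stagnation:
  assumes j: "j \<le> M" and Z: "Z \<in> span j" and Z': "Z' \<in> carrier_mat n p"
    and D: "Z = Z' + A * X" "X \<in> K j"
    and orthZ': "\<And>X. X \<in> K j \<Longrightarrow> adj (A * X) * Z' = 0\<^sub>m p p"
    and F: "nonsing p F" "adj F * F = adj Z * Z"
    and u: "u \<in> carrier_vec p" "u \<noteq> 0\<^sub>v p"
    and stag: "((adj Z' * Z') *\<^sub>v u) \<bullet>c u = ((adj Z * Z) *\<^sub>v u) \<bullet>c u"
    and G: "G \<in> carrier_mat (j * p) (j * p)" "\<And>i m. i < j \<Longrightarrow> m < j \<Longrightarrow> block_entry p G i m = H i m"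
  shows "\<not> nonsing (j * p) G"
proof
  assume ns: "nonsing (j * p) G"
  have Xc: "X \<in> carrier_mat n p" using K_carrier[OF D(2)] .
  have Zc: "Z \<in> carrier_mat n p" using span_carrier[OF Z] .
  define E where "E = A * X"
  have E: "E \<in> carrier_mat n p" using Xc by (simp add: E_def)
  have EZ: "adj E * Z' = 0\<^sub>m p p" unfolding E_def by (rule orthZ'[OF D(2)])
  then have ZE: "adj Z' * E = 0\<^sub>m p p"
    using adj_mult[of "adj E" Z'] E Z' by simp
  \<comment> \<open>The correction \<open>E\<close> is orthogonal to the new residual, so Gram
    matrices add and stagnation along \<open>u\<close> says exactly that \<open>E\<close>
    annihilates \<open>u\<close>.\<close>
  have gram: "adj Z * Z = adj Z' * Z' + adj E * E"
    unfolding D E_def[symmetric] using E Z' EZ ZE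
    by (simp add: adj_add mat_distrib_left mat_distrib_right) 
  have "((adj Z * Z) *\<^sub>v u) \<bullet>c u = ((adj Z' * Z') *\<^sub>v u) \<bullet>c u + ((adj E * E) *\<^sub>v u) \<bullet>c u"
    unfolding gram using E Z' u
    by (subst add_mult_distrib_mat_vec[of _ p p]) (auto intro!: add_scalar_prod_distrib[of _ p])
  then have "(E *\<^sub>v u) \<bullet>c (E *\<^sub>v u) = 0" using stag gram_form[OF E u(1)] by simp
  then have Eu: "E *\<^sub>v u = 0\<^sub>v n"
    using E u conjugate_square_eq_0_vec[of "E *\<^sub>v u" n] by auto
  \<comment> \<open>All columns equal \<open>u\<close>, which keeps the rest of the argument within
    products of \<open>p x p\<close> blocks.\<close>
  define C where "C = mat p p (\<lambda>(i,j). u $ i)"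
  have C: "C \<in> carrier_mat p p" by (simp add: C_def)
  have "E * C = 0\<^sub>m n p"
  proof (rule eq_matI)
    fix i c assume "i < dim_row (0\<^sub>m n p :: complex mat)" "c < dim_col (0\<^sub>m n p :: complex mat)"
    then have ic: "i < n" "c < p" by auto
    have "(E * C) $$ (i,c) = (E *\<^sub>v u) $ i"
      using ic E u C by (simp add: mult_entry mult_vec_entry C_def del: index_mult_mat_vec)
    then show "(E * C) $$ (i,c) = 0\<^sub>m n p $$ (i,c)" using Eu ic by simp
  qed (use E C in auto)
  then have ZC: "Z * C = Z' * C"
    unfolding D E_def[symmetric] using E Z' C by (simp add: mat_distrib_right)
  obtain Y where Y: "\<And>m. Y m \<in> carrier_mat p p" "Z = msum n p (\<lambda>m. v m * Y m) {..<j}"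
    using Z by (auto simp: span_def)
  note d = carrier_matD[OF Y(1)]
  have sys: "msum p p (\<lambda>i. adj (H i m) * (Y i * C)) {..<j} = 0\<^sub>m p p" if m: "m < j" for m
  proof -
    have "0\<^sub>m p p = adj (A * v m) * Z' * C"
      using orthZ'[of "v m"] K_mono[OF v_in_K, of m j] m j C by simp
    also have "\<dots> = adj (A * v m) * (Z * C)"
      using ZC Z' C by (simp add: mat_assoc)
    also have "\<dots> = msum p p (\<lambda>i. adj (A * v m) * (v i * Y i) * C) {..<j}"
      unfolding Y using C by (simp add: msum_mult mult_msum d mat_assoc)
    also have "\<dots> = msum p p (\<lambda>i. adj (H i m) * (Y i * C)) {..<j}"
    proof (rule msum_cong[OF refl])
      fix i assume "i \<in> {..<j}"
      then have "adj (H i m) = adj (A * v m) * v i"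
        using compress[of i m] m j by (auto simp: adj_mult[symmetric] dest!: sym[of _ "H i m"]) (simp add: adj_mult)
      then show "adj (A * v m) * (v i * Y i) * C = adj (H i m) * (Y i * C)"
        using C by (simp add: mat_assoc d)
    qed
    finally show ?thesis by simp
  qed
  \<comment> \<open>The coordinates of \<open>Z * C\<close> stacked into one block column;
    \<open>sys\<close> says that it lies in the kernel of \<open>adj G\<close>.\<close>
  define N where "N = bmat p j 1 (\<lambda>i _. Y i * C)"
  have N: "N \<in> carrier_mat (j * p) (1 * p)" unfolding N_def by (rule block_carrier)
  have Nb: "block_entry p N i 0 = Y i * C" if "i < j" for i
    unfolding N_def using that C by (subst block_entry_bmat) (auto simp: d)
  have "adj G * N = 0\<^sub>m (j * p) (1 * p)"
  proof (rule block_entry_eqI[of _ j p 1])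
    fix m b assume "m < j" "b < (1::nat)"
    then have m: "m < j" "b = 0" by auto
    have "block_entry p (adj G * N) m b = msum p p (\<lambda>i. block_entry p (adj G) m i * block_entry p N i b) {..<j}"
      using m G N by (intro block_entry_mult[of _ j p j _ 1]) auto
    also have "\<dots> = msum p p (\<lambda>i. adj (H i m) * (Y i * C)) {..<j}"
      using m G Nb by (intro msum_cong refl) (simp add: block_entry_adj[OF G(1)])
    also have "\<dots> = block_entry p (0\<^sub>m (j * p) (1 * p)) m b"
      using sys[OF m(1)] m block_index[of m j _ p] by (auto intro!: eq_matI)
    finally show "block_entry p (adj G * N) m b = block_entry p (0\<^sub>m (j * p) (1 * p)) m b" .
  qed (use G N in auto)
  then have "N = 0\<^sub>m (j * p) (1 * p)"
    using minv_cancel(2)[OF nonsing_adj[OF ns], of N] N nonsing_minv[OF nonsing_adj[OF ns]] by auto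
  then have YC: "Y i * C = 0\<^sub>m p p" if "i < j" for i
  proof -
    have "block_entry p N i 0 = 0\<^sub>m p p"
      using \<open>N = 0\<^sub>m (j * p) (1 * p)\<close> that block_index[of i j _ p] by (intro eq_matI) auto
    then show ?thesis using Nb[OF that] by simp
  qed
  have "Z * C = msum n p (\<lambda>m. v m * (Y m * C)) {..<j}"
    unfolding Y using C by (simp add: msum_mult d mat_assoc)
  also have "\<dots> = 0\<^sub>m n p" by (rule msum_zero) (auto simp: YC)
  \<comment> \<open>\<open>Z\<close> has the invertible block norm \<open>F\<close>, hence full
    column rank, so \<open>Z * C = 0\<close> forces \<open>u\<close> to vanish.\<close>
  finally have "adj Z * (Z * C) = 0\<^sub>m p p" using Zc by simp
  then have "adj F * (F * C) = 0\<^sub>m p p"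
    using F nonsing_carrier[OF F(1)] Zc C by (simp flip: mat_assoc)
  then have "minv F * (minv (adj F) * (adj F * (F * C))) = 0\<^sub>m p p"
    using nonsing_minv[OF F(1)] nonsing_minv[OF nonsing_adj[OF F(1)]] by simp
  then have "C = 0\<^sub>m p p"
    using minv_cancel(2)[OF F(1)] minv_cancel(2)[OF nonsing_adj[OF F(1)]] C nonsing_carrier[OF F(1)] by simp
  then have "C $$ (i,i) = 0" if "i < p" for i using that by simp
  then have "u = 0\<^sub>v p" using u by (intro eq_vecI) (auto simp: C_def)
  then show False using u by simp
qed

end

text \<open>Treats both kinds of cycle at once: \<open>W\<close> is the additional Arnoldi vector of
  an ordinary cycle and zero in the last one. Only its orthogonality to the other vectors enters,
  not its normalization.\<close>

lemma orth_arnoldiI: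
  assumes A: "A \<in> carrier_mat n n" and R: "R \<in> carrier_mat n p" and M: "1 \<le> M"
    and hess: "block_hessenberg p (M + 1) H"
    and start: "orthonormal_start p M R V"
    and W: "W \<in> carrier_mat n p" "\<And>i. i < M \<Longrightarrow> adj (bcol n p V i) * W = 0\<^sub>m p p"
    and AV: "\<And>j. j < M \<Longrightarrow> bcol n p (A * V) j =
      msum n p (\<lambda>i. (if i < M then bcol n p V i else W) * block_entry p H i j) {..<M + 1}"
  shows "\<exists>S. orth_arnoldi n p A R M (bcol n p V) (block_entry p H) S"
proof -
  obtain S T where V: "V \<in> carrier_mat n (M * p)" "adj V * V = 1\<^sub>m (M * p)"
    and S: "has_block_norm R S" and ST: "inverts_mat S T" "inverts_mat T S"
    and VT: "leading_part n p V = R * T"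
    using start R unfolding orthonormal_start_def by auto
  have Sp: "S \<in> Splus p" using S R by (simp add: has_block_norm_def)
  have Sc: "S \<in> carrier_mat p p" using Sp by (simp add: Splus_def)
  have TS: "T * S = 1\<^sub>m (dim_row T)" "S * T = 1\<^sub>m p" using ST Sc by (auto simp: inverts_mat_def)
  have "dim_row T = p" using arg_cong[OF TS(1), of dim_col] Sc by simp
  moreover have "dim_col T = p" using arg_cong[OF TS(2), of dim_col] by simp
  ultimately have Tc: "T \<in> carrier_mat p p" by auto
  have g: "adj (bcol n p V i) * bcol n p V j = (if i = j then 1\<^sub>m p else 0\<^sub>m p p)" if "i < M" "j < M" for i j
    using block_entry_gram[OF V(1) V(1) that] block_entry_one[OF that, of p] V(2) by simp
  have AVb: "A * bcol n p V j = bcol n p (A * V) j" if "j < M" for j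
    using bcol_mult_left[OF A V(1) that] by simp
  show ?thesis
  proof (intro exI[of _ S], unfold_locales)
    show "nonsing p S" by (rule Splus_nonsing[OF Sp])
    show "R = bcol n p V 0 * S"
    proof -
      have "p \<le> dim_col V" using V M by simp
      then have "bcol n p V 0 = R * T" using VT V leading_part_bcol[of p V n] by simp
      then show ?thesis using R Tc Sc TS by (simp add: mat_assoc)
    qed
    fix j assume j: "Suc j < M"
    show "nonsing p (block_entry p H (Suc j) j)"
      using hess j by (intro Splus_nonsing) (auto simp: block_hessenberg_def)
    show "A * bcol n p V j = msum n p (\<lambda>i. bcol n p V i * block_entry p H i j) {..<Suc (Suc j)}"
    proof -
      have "A * bcol n p V j = msum n p (\<lambda>i. (if i < M then bcol n p V i else W) * block_entry p H i j) {..<M + 1}"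
        using AV[of j] AVb[of j] j by simp
      also have "\<dots> = msum n p (\<lambda>i. (if i < M then bcol n p V i else W) * block_entry p H i j) {..<Suc (Suc j)}"
        by (rule msum_mono_neutral) (use j hess W in \<open>auto simp: block_hessenberg_def\<close>)
      also have "\<dots> = msum n p (\<lambda>i. bcol n p V i * block_entry p H i j) {..<Suc (Suc j)}"
        by (rule msum_cong) (use j in auto)
      finally show ?thesis .
    qed
  next
    fix i j assume ij: "i < M" "j < M"
    show "adj (bcol n p V i) * bcol n p V j = (if i = j then 1\<^sub>m p else 0\<^sub>m p p)" by (rule g[OF ij])
    have "adj (bcol n p V i) * (A * bcol n p V j) =
      msum p p (\<lambda>m. adj (bcol n p V i) * ((if m < M then bcol n p V m else W) * block_entry p H m j)) {..<M + 1}"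
      unfolding AVb[OF ij(2)] AV[OF ij(2)] using W by (subst mult_msum) auto
    also have "\<dots> = msum p p (\<lambda>m. if m = i then block_entry p H i j else 0\<^sub>m p p) {..<M + 1}"
    proof (rule msum_cong[OF refl])
      fix m assume "m \<in> {..<M + 1}"
      have "adj (bcol n p V i) * ((if m < M then bcol n p V m else W) * block_entry p H m j) =
        (adj (bcol n p V i) * (if m < M then bcol n p V m else W)) * block_entry p H m j"
        using W by (simp add: mat_assoc)
      then show "adj (bcol n p V i) * ((if m < M then bcol n p V m else W) * block_entry p H m j) =
          (if m = i then block_entry p H i j else 0\<^sub>m p p)"
        using g[OF ij(1), of m] W(2)[OF ij(1)] ij by auto
    qed
    also have "\<dots> = block_entry p H i j"
      by (subst msum_single[of _ i]) (use ij in auto)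
    finally show "adj (bcol n p V i) * (A * bcol n p V j) = block_entry p H i j" .
  qed (use A R in auto)
qed

lemma orth_arnoldi_block_arnoldi:
  assumes A: "A \<in> carrier_mat n n" and R: "R \<in> carrier_mat n p" and M: "1 \<le> M"
    and hess: "block_hessenberg p (M + 1) H"
    and ar: "block_arnoldi p M A R H \<or> block_arnoldi_final p M A R H"
  shows "\<exists>v S. orth_arnoldi n p A R M v (block_entry p H) S"
  using ar
proof
  assume "block_arnoldi p M A R H"
  then obtain V W where V: "orthonormal_start p M R V" and W: "W \<in> carrier_mat n p" "adj V * W = 0\<^sub>m (M * p) p"
    and AV: "A * V = append_columns V W * leading_part ((M + 1) * p) (M * p) H"
    using R unfolding block_arnoldi_def by auto
  have Vc: "V \<in> carrier_mat n (M * p)" using V R by (auto simp: orthonormal_start_def)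
  have Hc: "H \<in> carrier_mat ((M + 1) * p) ((M + 1) * p)" using hess by (simp add: block_hessenberg_def)
  have "adj (bcol n p V i) * W = 0\<^sub>m p p" if "i < M" for i
  proof -
    have "bcol n p W 0 = W" using W by (intro eq_matI) auto
    then have "adj (bcol n p V i) * W = block_entry p (0\<^sub>m (M * p) p) i 0"
      using block_entry_gram[OF Vc, of W 1 i 0] W that by simp
    also have "\<dots> = 0\<^sub>m p p" using that block_index[of i M _ p] by (intro eq_matI) auto
    finally show ?thesis .
  qed
  then show ?thesis
    using orth_arnoldiI[OF A R M hess V W(1)] bcol_arnoldi[OF Vc W(1) _ Hc] unfolding AV by blast
next
  assume "block_arnoldi_final p M A R H"
  then obtain V where V: "orthonormal_start p M R V"
    and AV: "A * V = V * leading_part (M * p) (M * p) H"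
    using R unfolding block_arnoldi_final_def by auto
  have Vc: "V \<in> carrier_mat n (M * p)" using V R by (auto simp: orthonormal_start_def)
  have "bcol n p (A * V) j =
      msum n p (\<lambda>i. (if i < M then bcol n p V i else 0\<^sub>m n p) * block_entry p H i j) {..<M + 1}" if "j < M" for j
  proof -
    have "bcol n p (A * V) j = msum n p (\<lambda>i. bcol n p V i * block_entry p (leading_part (M * p) (M * p) H) i j) {..<M}"
      unfolding AV by (rule bcol_mult[OF Vc _ that]) simp
    also have "\<dots> = msum n p (\<lambda>i. (if i < M then bcol n p V i else 0\<^sub>m n p) * block_entry p H i j) {..<M}"
      using that by (intro msum_cong) auto
    also have "\<dots> = msum n p (\<lambda>i. (if i < M then bcol n p V i else 0\<^sub>m n p) * block_entry p H i j) {..<M + 1}"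
      by (rule msum_mono_neutral[symmetric]) auto
    finally show ?thesis .
  qed
  then show ?thesis
    using orth_arnoldiI[OF A R M hess V, of "0\<^sub>m n p"] by auto
qed

theorem stagnation_zero_ritz_value:
  assumes M: "M \<ge> 1" and re: "realizes n p M l F A B H"
    and k: "k \<in> {1..l}" and j: "j \<in> {1..M - 1}"
    and F: "F k (j - 1) \<in> Splus p"
    and u: "u \<in> carrier_vec p" "u \<noteq> 0\<^sub>v p"
    and stag: "((adj (F k j) * F k j) *\<^sub>v u) \<bullet>c u = ((adj (F k (j - 1)) * F k (j - 1)) *\<^sub>v u) \<bullet>c u"
  shows "0 \<in># ritz_values p j (H k)"
proof -
  obtain X where A: "A \<in> carrier_mat n n" and B: "B \<in> carrier_mat n p"
    and gm: "restarted_block_gmres A B M l X"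
    and bn: "\<And>k j. k \<in> {1..l} \<Longrightarrow> j < M \<Longrightarrow> has_block_norm (residual A B (X k j)) (F k j)"
    and as: "associated_hessenberg p M l A (\<lambda>k. residual A B (X k 0)) H"
    using re unfolding realizes_def by auto
  have jM: "j < M" "j - 1 < M" using j M by auto
  have it: "gmres_iterate A B (X k 0) j (X k j)" if "k \<in> {1..l}" "j \<in> {1..M}" for k j
    using gm that unfolding restarted_block_gmres_def by blast
  have res_carrier: "residual A B Y \<in> carrier_mat n p" if "Y \<in> carrier_mat n p" for Y
    using that A B by (simp add: residual_def)
  \<comment> \<open>The GMRES relation does not record the dimensions of the later start iterates;
    they are recovered cycle by cycle from the Krylov corrections.\<close>
  have X0: "k < l \<Longrightarrow> X (Suc k) 0 \<in> carrier_mat n p" for k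
  proof (induction k)
    case 0
    then show ?case using gm B by (simp add: restarted_block_gmres_def)
  next
    case (Suc k)
    have c: "X (Suc k) 0 \<in> carrier_mat n p" using Suc by simp
    obtain Y where Y: "Y \<in> block_krylov M A (residual A B (X (Suc k) 0))" "X (Suc k) M = X (Suc k) 0 + Y"
      using gmres_iterateD[OF A B c it[of "Suc k" M]] Suc.prems M by auto
    interpret krylov n p A "residual A B (X (Suc k) 0)"
      by unfold_locales (use A res_carrier[OF c] in auto)
    have "X (Suc k + 1) 0 = X (Suc k) M"
      using gm Suc.prems unfolding restarted_block_gmres_def by auto
    then show ?case using K_carrier[OF Y(1)] Y(2) by simp
  qed
  have Xc: "X k 0 \<in> carrier_mat n p" using X0[of "k - 1"] k by (cases k) auto
  define R where "R = residual A B (X k 0)"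
  have R: "R \<in> carrier_mat n p" unfolding R_def by (rule res_carrier[OF Xc])
  have hess: "block_hessenberg p (M + 1) (H k)"
    and ar: "block_arnoldi p M A R (H k) \<or> block_arnoldi_final p M A R (H k)"
    using as k unfolding associated_hessenberg_def R_def by (auto simp: le_less)
  obtain v S where "orth_arnoldi n p A R M v (block_entry p (H k)) S"
    using orth_arnoldi_block_arnoldi[OF A R M hess ar] by blast
  then interpret orth_arnoldi n p A R M v "block_entry p (H k)" S .
  obtain Y' where Y': "Y' \<in> K j" "residual A B (X k j) = R - A * Y'"
    and orthR: "\<And>Y. Y \<in> K j \<Longrightarrow> adj (A * Y) * residual A B (X k j) = 0\<^sub>m p p"
  proof -
    have "j \<in> {1..M}" using j by auto
    from gmres_iterateD[OF A B Xc it[OF k this]] that show ?thesis unfolding R_def[symmetric] by blast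
  qed
  obtain Y where Y: "Y \<in> K (j - 1)" "residual A B (X k (j - 1)) = R - A * Y"
  \<comment> \<open>Iterate 0 is the start of the cycle and is not characterized by minimality, so
    its correction is taken to be zero.\<close>
  proof (cases "j = 1")
    case True
    have "R - A * 0\<^sub>m n p = R" using R by (intro eq_matI) auto
    then show ?thesis using that[of "0\<^sub>m n p"] K_zero[of 0] True by (auto simp: R_def)
  next
    case False
    then have "j - 1 \<in> {1..M}" using j by auto
    from gmres_iterateD[OF A B Xc it[OF k this]] that show ?thesis unfolding R_def[symmetric] by blast
  qed
  have Yc: "Y \<in> carrier_mat n p" "Y' \<in> carrier_mat n p" using K_carrier Y Y' by blast+
  have "\<not> nonsing (j * p) (leading_part (j * p) (j * p) (H k))"
  proof (rule stagnation[of j "residual A B (X k (j - 1))" "residual A B (X k j)" "Y' - Y" "F k (j - 1)" u])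
    show "residual A B (X k (j - 1)) \<in> span j"
    proof -
      have "R + A * Y * (- 1\<^sub>m p) \<in> span j"
      proof (rule span_add[OF _ span_mult])
        show "R \<in> span j" using K_span[OF K_base[of "j - 1"]] j by auto
        have "A * Y \<in> span (Suc (j - 1))" using j K_span[OF Y(1)] by (intro span_step) auto
        then show "A * Y \<in> span j" using j by simp
      qed simp
      moreover have "R + A * Y * (- 1\<^sub>m p) = R - A * Y"
        using R Yc by (intro eq_matI) auto
      ultimately show ?thesis using Y by simp
    qed
    show "residual A B (X k j) \<in> carrier_mat n p" unfolding Y' using Yc R by simp
    show "residual A B (X k (j - 1)) = residual A B (X k j) + A * (Y' - Y)"
      unfolding Y Y' using Yc R by (subst mat_diff_left) (auto intro!: eq_matI)
    show "Y' - Y \<in> K j" using K_diff[OF Y'(1) K_mono[OF Y(1)]] by simp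
    show "nonsing p (F k (j - 1))" by (rule Splus_nonsing[OF F])
    show "adj (F k (j - 1)) * F k (j - 1) = adj (residual A B (X k (j - 1))) * residual A B (X k (j - 1))"
      using bn[OF k jM(2)] by (simp add: has_block_norm_def)
    then show "((adj (residual A B (X k j)) * residual A B (X k j)) *\<^sub>v u) \<bullet>c u =
       ((adj (residual A B (X k (j - 1))) * residual A B (X k (j - 1))) *\<^sub>v u) \<bullet>c u"
      using bn[OF k jM(1)] stag by (simp add: has_block_norm_def)
  qed (use j orthR u in auto)
  then show ?thesis unfolding ritz_values_def
    by (intro zero_in_eigenvalue_mset[of _ "j * p"]) auto
qed

section \<open>Hessenberg matrices from polynomial bases\<close>

text \<open>The bound on \<open>q\<close> is expressed by coefficients, not by its degree, so that
  the case \<open>d = 0\<close> means precisely the zero polynomial. Each step removes the leading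
  term.\<close>

lemma poly_basis_exists:
  fixes \<phi> :: "nat \<Rightarrow> 'a :: field poly"
  assumes "\<And>i. i < d \<Longrightarrow> degree (\<phi> i) = i \<and> \<phi> i \<noteq> 0" "\<And>i. d \<le> i \<Longrightarrow> coeff q i = 0"
  shows "\<exists>c. q = (\<Sum>i<d. smult (c i) (\<phi> i))"
  using assms
proof (induction d arbitrary: q)
  case 0
  then show ?case by (auto intro: poly_eqI)
next
  case (Suc d)
  have d: "degree (\<phi> d) = d" "\<phi> d \<noteq> 0" using Suc.prems(1)[of d] by auto
  define c where "c = coeff q d / coeff (\<phi> d) d"
  have l: "coeff (\<phi> d) d \<noteq> 0" using d leading_coeff_neq_0 by metis
  have "\<exists>e. q - smult c (\<phi> d) = (\<Sum>i<d. smult (e i) (\<phi> i))"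
  proof (rule Suc.IH)
    fix i assume "d \<le> i"
    show "coeff (q - smult c (\<phi> d)) i = 0"
    proof (cases "i = d")
      case True
      then show ?thesis using l by (simp add: c_def)
    next
      case False
      then show ?thesis using Suc.prems(2)[of i] \<open>d \<le> i\<close> d coeff_eq_0[of "\<phi> d" i] by simp
    qed
  qed (use Suc.prems in auto)
  then obtain e where "q - smult c (\<phi> d) = (\<Sum>i<d. smult (e i) (\<phi> i))" by blast
  then have "q = (\<Sum>i<Suc d. smult ((e(d := c)) i) (\<phi> i))" by (simp add: algebra_simps)
  then show ?case by blast
qed

lemma poly_basis_independent:
  fixes \<phi> :: "nat \<Rightarrow> 'a :: field poly"
  assumes "\<And>i. i < d \<Longrightarrow> degree (\<phi> i) = i \<and> \<phi> i \<noteq> 0"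
    "(\<Sum>i<d. smult (c i) (\<phi> i)) = 0" "i < d"
  shows "c i = 0"
  using assms
proof (induction d arbitrary: i)
  case (Suc d)
  have d: "degree (\<phi> d) = d" "\<phi> d \<noteq> 0" using Suc.prems(1)[of d] by auto
  have "0 = coeff (\<Sum>i<Suc d. smult (c i) (\<phi> i)) d" using Suc.prems by simp
  also have "\<dots> = c d * coeff (\<phi> d) d"
    using Suc.prems(1) by (auto simp: coeff_sum coeff_eq_0 intro!: sum.neutral)
  finally have "c d = 0" using d leading_coeff_neq_0[of "\<phi> d"] by auto
  then show ?case using Suc.IH[of i] Suc.prems by (cases "i = d") auto
qed simp

lemma poly_basis_unique:
  fixes \<phi> :: "nat \<Rightarrow> 'a :: field poly"
  assumes "\<And>i. i < d \<Longrightarrow> degree (\<phi> i) = i \<and> \<phi> i \<noteq> 0"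
    "(\<Sum>i<d. smult (a i) (\<phi> i)) = (\<Sum>i<d. smult (b i) (\<phi> i))" "i < d"
  shows "a i = b i"
proof -
  have "(\<Sum>i<d. smult (a i - b i) (\<phi> i)) = 0"
    using assms(2) by (simp add: smult_diff_left sum_subtractf)
  from poly_basis_independent[OF assms(1) this assms(3)] show ?thesis by simp
qed

text \<open>Padding the coordinates by zeros gives one coefficient function for every length
  \<open>e\<close> of the expansion, so expansions of different polynomials can be compared over a
  common range.\<close>

lemma poly_basis_triangular:
  fixes \<phi> :: "nat \<Rightarrow> 'a :: field poly"
  assumes \<phi>: "\<And>i. i \<le> d \<Longrightarrow> degree (\<phi> i) = i \<and> \<phi> i \<noteq> 0" and q: "degree q = d" "q \<noteq> 0"
  shows "\<exists>c. (\<forall>e>d. q = (\<Sum>i<e. smult (c i) (\<phi> i))) \<and> c d \<noteq> 0 \<and> (\<forall>i>d. c i = 0)"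
proof -
  obtain c where c: "q = (\<Sum>i<Suc d. smult (c i) (\<phi> i))"
    using poly_basis_exists[of "Suc d" \<phi> q] assms coeff_eq_0[of q] by (auto simp: less_Suc_eq_le)
  have "coeff q d = c d * coeff (\<phi> d) d"
    unfolding c using \<phi> by (auto simp: coeff_sum coeff_eq_0 intro!: sum.neutral)
  then have "c d \<noteq> 0" using q leading_coeff_neq_0[of q] by auto
  define b where "b i = (if i \<le> d then c i else 0)" for i
  have "q = (\<Sum>i<e. smult (b i) (\<phi> i))" if "e > d" for e
  proof -
    have "q = (\<Sum>i<Suc d. smult (b i) (\<phi> i))"
      unfolding c by (rule sum.cong) (auto simp: b_def)
    also have "\<dots> = (\<Sum>i<e. smult (b i) (\<phi> i))"
      by (rule sum.mono_neutral_left) (use that in \<open>auto simp: b_def\<close>)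
    finally show ?thesis .
  qed
  then show ?thesis using \<open>c d \<noteq> 0\<close> by (intro exI[of _ b]) (auto simp: b_def)
qed

text \<open>The matrix \<open>h\<close> represents multiplication by the variable in a basis of polynomials
  \<open>\<phi>\<^sub>0, \<phi>\<^sub>1, \<dots>\<close> where \<open>\<phi>\<^sub>j\<close> has the roots \<open>\<theta> j 0, \<dots>, \<theta> j (j - 1)\<close>; its leading part of
  order \<open>j\<close> is multiplication modulo \<open>\<phi>\<^sub>j\<close>, which the Newton basis (coordinates \<open>P j\<close>) turns into a
  bidiagonal matrix.  The normalization \<open>\<phi>\<^sub>j(0) = 1\<close> makes the column sums vanish.\<close>

lemma hessenberg_with_ritz_values:
  fixes \<theta> :: "nat \<Rightarrow> nat \<Rightarrow> complex"
  assumes nz: "\<And>j i. j \<le> M \<Longrightarrow> i < j \<Longrightarrow> \<theta> j i \<noteq> 0"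
  shows "\<exists>h P. (\<forall>i j. j \<le> M \<longrightarrow> j + 1 < i \<longrightarrow> h i j = 0) \<and> (\<forall>j<M. h (Suc j) j \<noteq> 0) \<and>
    (\<forall>j<M. (\<Sum>i<M + 1. h i j) = 0) \<and>
    (\<forall>j\<le>M + 1. (\<forall>i<j. P j i i \<noteq> 0) \<and> (\<forall>i t. t < i \<longrightarrow> P j i t = 0) \<and>
      (\<forall>i<j. \<forall>t<j. (\<Sum>m<j. h i m * P j m t) =
        P j i t * \<theta> j t + (if Suc t < j then P j i (Suc t) else 0)))"
proof -
  define \<nu> where "\<nu> j t = (\<Prod>i<t. [:- \<theta> j i, 1:])" for j t
  define \<phi> where "\<phi> j = smult (if j \<le> M then inverse (poly (\<nu> j j) 0) else 1) (\<nu> j j)" for j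
  have \<nu>: "degree (\<nu> j t) = t \<and> \<nu> j t \<noteq> 0" for j t
    unfolding \<nu>_def by (subst degree_prod_eq_sum_degree) auto
  have \<nu>0: "poly (\<nu> j j) 0 \<noteq> 0" if "j \<le> M" for j
    using nz[OF that] by (auto simp: \<nu>_def poly_prod)
  have \<phi>: "degree (\<phi> j) = j \<and> \<phi> j \<noteq> 0" for j
    using \<nu>[of j j] \<nu>0[of j] by (auto simp: \<phi>_def)
  have \<phi>0: "poly (\<phi> j) 0 = 1" if "j \<le> M" for j
    using \<nu>0[OF that] that by (simp add: \<phi>_def)
  have \<nu>\<phi>: "\<exists>d. \<nu> j j = smult d (\<phi> j)" for j
    using \<nu>0[of j] by (auto simp: \<phi>_def intro!: exI[of _ "if j \<le> M then poly (\<nu> j j) 0 else 1"])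
  have "\<exists>c. (\<forall>e>Suc j. pCons 0 (\<phi> j) = (\<Sum>i<e. smult (c i) (\<phi> i))) \<and> c (Suc j) \<noteq> 0 \<and> (\<forall>i>Suc j. c i = 0)" for j
    by (rule poly_basis_triangular) (use \<phi> in \<open>auto simp: degree_pCons_eq\<close>)
  then obtain g where g: "\<And>j e. e > Suc j \<Longrightarrow> pCons 0 (\<phi> j) = (\<Sum>i<e. smult (g j i) (\<phi> i))"
    "\<And>j. g j (Suc j) \<noteq> 0" "\<And>i j. i > Suc j \<Longrightarrow> g j i = 0"
    by metis
  define q where "q j t c \<longleftrightarrow> (\<forall>e>t. \<nu> j t = (\<Sum>i<e. smult (c i) (\<phi> i))) \<and> c t \<noteq> 0 \<and> (\<forall>i>t. c i = 0)"
    for j t and c :: "nat \<Rightarrow> complex"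
  have "\<forall>j t. \<exists>c. q j t c"
    unfolding q_def using poly_basis_triangular[of _ \<phi>] \<phi> \<nu> by blast
  then obtain Q where "\<forall>j t. q j t (Q j t)" by metis
  then have Q: "\<And>j t e. e > t \<Longrightarrow> \<nu> j t = (\<Sum>i<e. smult (Q j t i) (\<phi> i))"
    "\<And>j t. Q j t t \<noteq> 0" "\<And>j t i. i > t \<Longrightarrow> Q j t i = 0"
    unfolding q_def by blast+
  \<comment> \<open>Evaluation of \<open>x * \<phi>_j\<close> at 0; for \<open>j < M\<close> its
    expansion involves only polynomials with value 1 at 0.\<close>
  have cs: "(\<Sum>i<M + 1. g j i) = 0" if "j < M" for j
  proof -
    have "0 = poly (pCons 0 (\<phi> j)) 0" by simp
    also have "\<dots> = (\<Sum>i<M + 1. g j i * poly (\<phi> i) 0)"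
      using that by (subst g(1)[of j "M + 1"]) (auto simp: poly_sum)
    also have "\<dots> = (\<Sum>i<M + 1. g j i)" by (rule sum.cong) (auto simp: \<phi>0)
    finally show ?thesis by simp
  qed
  have eq: "(\<Sum>m<j. g m i * Q j t m) = Q j t i * \<theta> j t + (if Suc t < j then Q j (Suc t) i else 0)"
    if it: "i < j" "t < j" for i j t
  proof -
    obtain d where d: "\<nu> j j = smult d (\<phi> j)" using \<nu>\<phi> by blast
    \<comment> \<open>For \<open>t = j - 1\<close> the product with \<open>x - \<theta> j t\<close>
      is \<open>\<nu> j j\<close>, a multiple \<open>d\<close> of \<open>\<phi> j\<close>. This
      contributes only in row \<open>i = j\<close>, which the leading part of order \<open>j\<close>
      omits; that is the reduction modulo \<open>\<phi> j\<close>.\<close>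
    let ?b = "\<lambda>i. Q j t i * \<theta> j t + (if Suc t < j then Q j (Suc t) i else if i = j then d else 0)"
    have "(\<Sum>i<Suc j. smult (\<Sum>m<j. g m i * Q j t m) (\<phi> i)) =
        (\<Sum>m<j. \<Sum>i<Suc j. smult (Q j t m) (smult (g m i) (\<phi> i)))"
      by (subst sum.swap) (simp add: smult_sum mult.commute)
    also have "\<dots> = (\<Sum>m<j. smult (Q j t m) (pCons 0 (\<phi> m)))"
    proof (rule sum.cong[OF refl])
      fix m assume "m \<in> {..<j}"
      then have "pCons 0 (\<phi> m) = (\<Sum>i<Suc j. smult (g m i) (\<phi> i))" by (intro g(1)) auto
      then show "(\<Sum>i<Suc j. smult (Q j t m) (smult (g m i) (\<phi> i))) = smult (Q j t m) (pCons 0 (\<phi> m))"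
        by (simp only: smult_sum2)
    qed
    also have "\<dots> = (\<Sum>m<j. [:0,1:] * smult (Q j t m) (\<phi> m))"
      by (rule sum.cong) auto
    also have "\<dots> = [:0,1:] * \<nu> j t"
      unfolding sum_distrib_left[symmetric] using Q(1)[of t j j] it by simp
    also have "\<dots> = smult (\<theta> j t) (\<nu> j t) + \<nu> j (Suc t)"
      by (simp add: \<nu>_def algebra_simps)
    also have "\<nu> j (Suc t) = (\<Sum>i<Suc j. smult (if Suc t < j then Q j (Suc t) i else if i = j then d else 0) (\<phi> i))"
    proof (cases "Suc t < j")
      case True
      then show ?thesis by (subst Q(1)[of "Suc t" "Suc j"]) auto
    next
      case False
      then have "Suc t = j" using it by simp
      then show ?thesis using d by simp
    qed
    also have "\<nu> j t = (\<Sum>i<Suc j. smult (Q j t i) (\<phi> i))"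
      using it by (intro Q(1)) auto
    finally have "(\<Sum>i<Suc j. smult (\<Sum>m<j. g m i * Q j t m) (\<phi> i)) = (\<Sum>i<Suc j. smult (?b i) (\<phi> i))"
      by (simp add: smult_sum2 sum.distrib smult_add_left mult.commute del: sum.lessThan_Suc)
    from poly_basis_unique[OF \<phi> this, of i] it show ?thesis by auto
  qed
  show ?thesis
    by (rule exI[of _ "\<lambda>i j. g j i"], rule exI[of _ "\<lambda>j i t. Q j t i"])
      (use g Q cs eq in auto)
qed

section \<open>Positive definite matrices\<close>

text \<open>Induction on the size through the Schur complement \<open>G'\<close> of the first entry.
  Index functions are used in place of matrices so that deleting the first row and column is a mere
  shift.\<close>

lemma cholesky_fun:
  fixes G :: "nat \<Rightarrow> nat \<Rightarrow> complex"
  assumes "\<And>i j. i < p \<Longrightarrow> j < p \<Longrightarrow> G j i = cnj (G i j)"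
    "\<And>v. \<exists>i<p. v i \<noteq> 0 \<Longrightarrow> 0 < Re (\<Sum>i<p. cnj (v i) * (\<Sum>j<p. G i j * v j))"
  shows "\<exists>R. (\<forall>i j. j < i \<longrightarrow> R i j = 0) \<and> (\<forall>i<p. R i i \<in> \<real> \<and> 0 < Re (R i i)) \<and>
    (\<forall>i<p. \<forall>j<p. (\<Sum>k<p. cnj (R k i) * R k j) = G i j)"
  using assms
proof (induction p arbitrary: G)
  case 0
  then show ?case by (intro exI[of _ "\<lambda>_ _. 0"]) auto
next
  case (Suc p)
  have herm: "G j i = cnj (G i j)" if "i < Suc p" "j < Suc p" for i j using Suc.prems(1) that by blast
  define a where "a = Re (G 0 0)"
  have G00: "G 0 0 = of_real a" using herm[of 0 0] by (auto simp: a_def complex_eq_iff)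
  have "0 < Re (\<Sum>i<Suc p. cnj (if i = 0 then 1 else 0) * (\<Sum>j<Suc p. G i j * (if j = 0 then 1 else 0)))"
    by (rule Suc.prems(2)) auto
  then have a: "a > 0" by (simp add: sum.lessThan_Suc_shift G00 del: sum.lessThan_Suc)
  define G' where "G' i j = G (Suc i) (Suc j) - G (Suc i) 0 * G 0 (Suc j) / of_real a" for i j
  have "\<exists>R. (\<forall>i j. j < i \<longrightarrow> R i j = 0) \<and> (\<forall>i<p. R i i \<in> \<real> \<and> 0 < Re (R i i)) \<and>
    (\<forall>i<p. \<forall>j<p. (\<Sum>k<p. cnj (R k i) * R k j) = G' i j)"
  proof (rule Suc.IH)
    fix i j assume ij: "i < p" "j < p"
    show "G' j i = cnj (G' i j)"
      using herm[of "Suc i" "Suc j"] herm[of 0 "Suc j"] herm[of "Suc i" 0] ij by (simp add: G'_def)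
  next
    fix v :: "nat \<Rightarrow> complex" assume v: "\<exists>i<p. v i \<noteq> 0"
    \<comment> \<open>The first coordinate is chosen to annihilate the first row of
      \<open>G\<close>; the form of \<open>G\<close> at \<open>w\<close> then equals that of the
      Schur complement at \<open>v\<close>.\<close>
    define w where "w i = (case i of 0 \<Rightarrow> - (\<Sum>j<p. G 0 (Suc j) * v j) / of_real a | Suc i \<Rightarrow> v i)" for i
    have "0 < Re (\<Sum>i<Suc p. cnj (w i) * (\<Sum>j<Suc p. G i j * w j))"
      by (rule Suc.prems(2)) (use v in \<open>auto simp: w_def\<close>)
    also have "(\<Sum>i<Suc p. cnj (w i) * (\<Sum>j<Suc p. G i j * w j)) =
        (\<Sum>i<p. cnj (v i) * (\<Sum>j<p. G' i j * v j))"
    proof -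
      have 0: "(\<Sum>j<Suc p. G 0 j * w j) = 0"
        using a by (simp add: sum.lessThan_Suc_shift w_def G00 del: sum.lessThan_Suc)
      have "(\<Sum>j<Suc p. G (Suc i) j * w j) = (\<Sum>j<p. G' i j * v j)" for i
        by (simp add: sum.lessThan_Suc_shift w_def G'_def left_diff_distrib sum_subtractf
            sum_distrib_left sum_divide_distrib mult.assoc del: sum.lessThan_Suc)
      then show ?thesis using 0 by (simp add: sum.lessThan_Suc_shift[of _ p] w_def del: sum.lessThan_Suc)
    qed
    finally show "0 < Re (\<Sum>i<p. cnj (v i) * (\<Sum>j<p. G' i j * v j))" .
  qed
  then obtain R where R: "\<And>i j. j < i \<Longrightarrow> R i j = 0" "\<And>i. i < p \<Longrightarrow> R i i \<in> \<real> \<and> 0 < Re (R i i)"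
    "\<And>i j. i < p \<Longrightarrow> j < p \<Longrightarrow> (\<Sum>k<p. cnj (R k i) * R k j) = G' i j"
    by blast
  define T where "T i j = (case i of 0 \<Rightarrow> G 0 j / of_real (sqrt a)
    | Suc i \<Rightarrow> (case j of 0 \<Rightarrow> 0 | Suc j \<Rightarrow> R i j))" for i j
  have sa: "complex_of_real (sqrt a) * complex_of_real (sqrt a) = of_real a"
    using a by (simp flip: of_real_mult)
  have G0: "G 0 0 / of_real (sqrt a) = of_real (sqrt a)"
    using a sa by (simp add: G00 field_simps)
  show ?case
  proof (intro exI[of _ "\<lambda>i j. if j < i then 0 else T i j"] conjI allI impI)
    fix i assume i: "i < Suc p"
    have "T i i \<in> \<real> \<and> 0 < Re (T i i)"
      using i R(2)[of "i - 1"] a G0 by (cases i) (auto simp: T_def)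
    then show "(if i < i then 0 else T i i) \<in> \<real>" "0 < Re (if i < i then 0 else T i i)" by auto
  next
    fix i j assume ij: "i < Suc p" "j < Suc p"
    have T: "(if j < i then 0 else T i j) = T i j" if "0 < i" for i j
      using R(1) that by (auto simp: T_def split: nat.split)
    have "(\<Sum>k<Suc p. cnj (T k i) * T k j) = G i j"
    proof -
      have "(\<Sum>k<Suc p. cnj (T k i) * T k j) = cnj (G 0 i) * G 0 j / of_real a + (\<Sum>k<p. cnj (T (Suc k) i) * T (Suc k) j)"
        using sa by (simp add: sum.lessThan_Suc_shift T_def del: sum.lessThan_Suc)
      also have "\<dots> = G i j"
      proof (cases i)
        case 0
        then show ?thesis using a by (simp add: T_def G00)
      next
        case (Suc i')
        show ?thesis
        proof (cases j)
          case 0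
          then show ?thesis using a Suc herm[of 0 i] ij by (simp add: T_def G00)
        next
          case (Suc j')
          then show ?thesis using \<open>i = Suc i'\<close> ij R(3)[of i' j'] herm[of 0 i] by (simp add: T_def G'_def)
        qed
      qed
      finally show ?thesis .
    qed
    moreover have "(if j < i then 0 else T i j) = T i j" for i j
      using T[of i j] by (cases "i = 0") auto
    ultimately show "(\<Sum>k<Suc p. cnj (if i < k then 0 else T k i) * (if j < k then 0 else T k j)) = G i j"
      by simp
  qed auto
qed

lemma cholesky:
  assumes G: "G \<in> carrier_mat p p" and pd: "pos_definite G"
  obtains R where "R \<in> Splus p" "adj R * R = G"
proof -
  have "\<exists>R. (\<forall>i j. j < i \<longrightarrow> R i j = 0) \<and> (\<forall>i<p. R i i \<in> \<real> \<and> 0 < Re (R i i)) \<and>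
    (\<forall>i<p. \<forall>j<p. (\<Sum>k<p. cnj (R k i) * R k j) = G $$ (i,j))"
  proof (rule cholesky_fun)
    fix i j assume "i < p" "j < p"
    then show "G $$ (j,i) = cnj (G $$ (i,j))"
      using pd G unfolding pos_definite_def by (metis adj_entry carrier_matD)
  next
    fix v :: "nat \<Rightarrow> complex" assume "\<exists>i<p. v i \<noteq> 0"
    then obtain i where "i < p" "v i \<noteq> 0" by blast
    then have "vec p v \<noteq> 0\<^sub>v p" by (metis index_vec index_zero_vec(1))
    then have "0 < Re ((G *\<^sub>v vec p v) \<bullet>c vec p v)"
      using pd G unfolding pos_definite_def by auto
    also have "(G *\<^sub>v vec p v) \<bullet>c vec p v = (\<Sum>i<p. cnj (v i) * (\<Sum>j<p. G $$ (i,j) * v j))"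
      using G by (auto simp: scalar_prod_def lessThan_atLeast0 mult.commute intro!: sum.cong)
    finally show "0 < Re (\<Sum>i<p. cnj (v i) * (\<Sum>j<p. G $$ (i,j) * v j))" .
  qed
  then obtain R where R: "\<forall>i j. j < i \<longrightarrow> R i j = 0" "\<forall>i<p. R i i \<in> \<real> \<and> 0 < Re (R i i)"
    "\<forall>i<p. \<forall>j<p. (\<Sum>k<p. cnj (R k i) * R k j) = G $$ (i,j)" by blast
  show ?thesis
  proof (rule that)
    show "mat p p (\<lambda>(i,j). R i j) \<in> Splus p" using R by (auto simp: Splus_def)
    show "adj (mat p p (\<lambda>(i,j). R i j)) * mat p p (\<lambda>(i,j). R i j) = G"
      using R G by (intro eq_matI) (auto simp: mult_entry)
  qed
qed

lemma gram_form_pos: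
  assumes "Z \<in> carrier_mat n p" "u \<in> carrier_vec p"
  shows "0 \<le> Re (((adj Z * Z) *\<^sub>v u) \<bullet>c u)"
    "Z *\<^sub>v u \<noteq> 0\<^sub>v n \<Longrightarrow> 0 < Re (((adj Z * Z) *\<^sub>v u) \<bullet>c u)"
  using conjugate_square_ge_0_vec[of "Z *\<^sub>v u"] conjugate_square_greater_0_vec[of "Z *\<^sub>v u" n] assms
  unfolding gram_form[OF assms] by (auto simp: less_eq_complex_def less_complex_def)

text \<open>Positive definiteness in the construction is always obtained by exhibiting a sum of Gram
  matrices of this kind.\<close>

lemma pos_definite_gram_sum:
  assumes X: "nonsing p X" and Y: "Y \<in> carrier_mat n p"
  shows "pos_definite (adj X * X + adj Y * Y)"
proof -
  have Xc: "X \<in> carrier_mat p p" using nonsing_carrier[OF X] .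
  have "0 < Re (((adj X * X + adj Y * Y) *\<^sub>v v) \<bullet>c v)" if v: "v \<in> carrier_vec p" "v \<noteq> 0\<^sub>v p" for v
  proof -
    have "X *\<^sub>v v \<noteq> 0\<^sub>v p"
      using X v det_0_iff_vec_prod_zero[OF Xc] by (auto simp: nonsing_def)
    moreover have "((adj X * X + adj Y * Y) *\<^sub>v v) \<bullet>c v =
        ((adj X * X) *\<^sub>v v) \<bullet>c v + ((adj Y * Y) *\<^sub>v v) \<bullet>c v"
      using Xc Y v
      by (subst add_mult_distrib_mat_vec[of _ p p]) (auto intro!: add_scalar_prod_distrib[of _ p])
    ultimately show ?thesis using gram_form_pos[OF Xc v(1)] gram_form_pos[OF Y v(1)] by simp
  qed
  then show ?thesis unfolding pos_definite_def using Xc Y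
    by (auto simp: adj_add adj_mult)
qed

text \<open>One step of the construction of the blocks \<open>g\<^sub>i\<close>: with \<open>S\<close>, \<open>T\<close> the two Gram matrices, the
  requirement on \<open>g\<close> is \<open>g g\<^sup>* = T\<^sup>-\<^sup>1 - S\<^sup>-\<^sup>1\<close>, whose inverse is \<open>E = T + T (S - T)\<^sup>-\<^sup>1 T\<close>; the
  Cholesky factor of \<open>K\<^sup>* E K\<close> fixes the unitary freedom in \<open>g\<close> so that \<open>g\<^sup>-\<^sup>1 K\<close> is triangular.\<close>

lemma gram_step:
  assumes F: "nonsing p F1" "nonsing p F2" and less: "gram_less F2 F1"
    and P: "P \<in> carrier_mat p p" "P * (adj F1 * F1) = 1\<^sub>m p" and K: "nonsing p K"
  obtains g R where "nonsing p g" "R \<in> Splus p" "g * R = K" "(P + g * adj g) * (adj F2 * F2) = 1\<^sub>m p"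
proof -
  define S where "S = adj F1 * F1"
  define T where "T = adj F2 * F2"
  note Fc = nonsing_carrier[OF F(1)] nonsing_carrier[OF F(2)] nonsing_carrier[OF K]
  have nS: "nonsing p S" and nT: "nonsing p T"
    unfolding S_def T_def using F by (auto intro: nonsing_mult nonsing_adj)
  have c: "S \<in> carrier_mat p p" "T \<in> carrier_mat p p" using nS nT nonsing_carrier by auto
  obtain L where L: "L \<in> Splus p" "adj L * L = S - T"
    using cholesky[of "S - T" p] less c unfolding gram_less_def S_def T_def by auto
  have nL: "nonsing p L" by (rule Splus_nonsing[OF L(1)])
  \<comment> \<open>\<open>Z\<close> is the inverse of \<open>S - T\<close>, written through the
    Cholesky factor so that \<open>T * Z * T\<close> is visibly the Gram matrix of
    \<open>W\<close>.\<close>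
  define Z where "Z = minv L * adj (minv L)"
  note Lc = nonsing_carrier[OF nL] nonsing_minv[OF nL]
  have Z: "Z \<in> carrier_mat p p" using Lc by (simp add: Z_def)
  have ZD: "Z * (S - T) = 1\<^sub>m p" "(S - T) * Z = 1\<^sub>m p"
    unfolding L(2)[symmetric] Z_def using Lc adj_minv_cancel[OF nL] minv_cancel[OF nL]
    by (simp_all add: mat_assoc)
  define W where "W = adj (minv L) * T"
  have W: "W \<in> carrier_mat p p" using Lc c by (simp add: W_def)
  define E where "E = T + T * Z * T"
  have aT: "adj T = T" unfolding T_def using Fc by (simp add: adj_mult)
  have EW: "E = T + adj W * W"
    unfolding E_def W_def Z_def using Lc c aT by (simp add: adj_mult mat_assoc)
  have E: "E \<in> carrier_mat p p" using c Z by (simp add: E_def)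
  \<comment> \<open>In this product form the inverse can be read off: it is
    \<open>minv S * (S - T) * minv T\<close>, the difference of the inverses of \<open>T\<close> and
    \<open>S\<close>.\<close>
  have ETZS: "E = T * Z * S"
  proof -
    have "T * Z * S = T * Z * ((S - T) + T)"
      using c by (intro arg_cong[of _ _ "\<lambda>X. T * Z * X"] eq_matI) auto
    also have "\<dots> = T * (Z * (S - T)) + T * Z * T"
      using c Z by (simp add: mat_distrib_left mat_assoc)
    also have "\<dots> = E" using c by (simp add: ZD E_def)
    finally show ?thesis by simp
  qed
  have "adj K * E * K = adj (F2 * K) * (F2 * K) + adj (W * K) * (W * K)"
    unfolding EW T_def using Fc W by (simp add: adj_mult mat_assoc mat_distrib_left mat_distrib_right)
  moreover have "pos_definite \<dots>"
    by (rule pos_definite_gram_sum[OF nonsing_mult[OF F(2) K], where n = p]) (use Fc W in auto)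
  ultimately obtain R where R: "R \<in> Splus p" "adj R * R = adj K * E * K"
    using cholesky[of "adj K * E * K" p] Fc E by auto
  have nR: "nonsing p R" by (rule Splus_nonsing[OF R(1)])
  note Rc = nonsing_carrier[OF nR] nonsing_minv[OF nR] and Kc = nonsing_minv[OF K]
  define g where "g = K * minv R"
  have ng: "nonsing p g" unfolding g_def by (intro nonsing_mult K nonsing_inv nR)
  have g: "g \<in> carrier_mat p p" using nonsing_carrier[OF ng] .
  have gR: "g * R = K" unfolding g_def using Rc Fc by (simp add: mat_assoc)
  have "E = adj (minv K) * (adj K * E * K) * minv K"
    using Kc Fc E adj_minv_cancel[OF K] minv_cancel[OF K] by (simp add: mat_assoc)
  also have "\<dots> = adj (minv K) * (adj R * R) * minv K" unfolding R(2) ..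
  finally have E': "E = adj (minv K) * (adj R * R) * minv K" .
  have gE: "(g * adj g) * E = 1\<^sub>m p"
    unfolding E' g_def using Kc Fc Rc
    by (simp add: adj_mult mat_assoc adj_minv_cancel[OF K] adj_minv_cancel[OF nR] minv_cancel[OF nR] minv_cancel[OF K])
  define Y where "Y = g * adj g"
  have Y: "Y \<in> carrier_mat p p" using g by (simp add: Y_def)
  \<comment> \<open>Cancelling \<open>S\<close> turns \<open>Y\<close> being inverse to
    \<open>E\<close> into \<open>Y * T * Z = P\<close>. Multiplication by \<open>S - T\<close> gives
    \<open>Y * T = P * (S - T)\<close>, and adding \<open>P * T\<close> leaves
    \<open>P * S = 1\<close>.\<close>
  have "(Y * T * Z) * S = 1\<^sub>m p"
    using gE Y c Z unfolding ETZS Y_def[symmetric] by (simp add: mat_assoc)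
  then have "((Y * T * Z) * S) * minv S = (P * S) * minv S" using P by (simp add: S_def)
  then have YP: "Y * T * Z = P" using Y c Z P nonsing_minv[OF nS] by (simp add: mat_assoc)
  have "P * (S - T) = Y * T * (Z * (S - T))"
    unfolding YP[symmetric] using Y c Z by (simp add: mat_assoc)
  then have "P * (S - T) = Y * T" using Y c by (simp add: ZD)
  then have "P * T + Y * T = P * T + P * (S - T)" by simp
  also have "\<dots> = P * S" using P c by (subst mat_diff_left) (auto intro!: eq_matI)
  finally have "(P + Y) * T = 1\<^sub>m p" using P Y c by (simp add: mat_distrib_right S_def)
  then show ?thesis using that[OF ng R(1) gR] by (simp add: Y_def T_def)
qed

section \<open>The Hessenberg matrix of a single cycle\<close>

definition dg :: "nat \<Rightarrow> (nat \<Rightarrow> complex) \<Rightarrow> complex mat" where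
  "dg p f = mat p p (\<lambda>(r,c). if r = c then f r else 0)"

lemma dg_dims [simp]: "dim_row (dg p f) = p" "dim_col (dg p f) = p" "dg p f \<in> carrier_mat p p"
  by (auto simp: dg_def)

lemma dg_entry [simp]: "r < p \<Longrightarrow> c < p \<Longrightarrow> dg p f $$ (r,c) = (if r = c then f r else 0)"
  by (simp add: dg_def)

lemma dg_mult: "dg p f * dg p g = dg p (\<lambda>r. f r * g r)"
proof (rule eq_matI)
  fix r c assume "r < dim_row (dg p (\<lambda>r. f r * g r))" "c < dim_col (dg p (\<lambda>r. f r * g r))"
  then have *: "r < p" "c < p" by auto
  have "(dg p f * dg p g) $$ (r,c) = (\<Sum>k<p. dg p f $$ (r,k) * dg p g $$ (k,c))"
    using * by (simp add: mult_entry del: dg_entry)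
  also have "\<dots> = (\<Sum>k<p. if k = r then f r * (if r = c then g r else 0) else 0)"
    by (rule sum.cong) (use * in auto)
  finally show "(dg p f * dg p g) $$ (r,c) = dg p (\<lambda>r. f r * g r) $$ (r,c)" using * by simp
qed auto

lemma dg_cong: "(\<And>r. r < p \<Longrightarrow> f r = g r) \<Longrightarrow> dg p f = dg p g"
  by (rule eq_matI) auto

lemma msum_dg: "msum p p (\<lambda>i. dg p (f i)) I = dg p (\<lambda>r. \<Sum>i\<in>I. f i r)"
  by (rule eq_matI) auto

lemma dg_one: "dg p (\<lambda>_. 1) = 1\<^sub>m p"
  by (rule eq_matI) auto

lemma dg_zero: "dg p (\<lambda>_. 0) = 0\<^sub>m p p"
  by (rule eq_matI) auto

lemma nonsing_dg: "(\<And>r. r < p \<Longrightarrow> f r \<noteq> 0) \<Longrightarrow> nonsing p (dg p f)"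
  by (rule nonsingI[of _ _ "dg p (\<lambda>r. inverse (f r))"])
    (auto simp: dg_mult dg_one[symmetric] intro!: dg_cong)

lemma proots_linear_factors: "proots (\<Prod>a\<leftarrow>xs. [:- a, 1:]) = mset xs" for xs :: "complex list"
proof (induction xs)
  case (Cons a xs)
  have "(\<Prod>a\<leftarrow>xs. [:- a, 1:]) \<noteq> 0" by (auto simp: prod_list_zero_iff)
  then have "proots ([:- a, 1:] * (\<Prod>a\<leftarrow>xs. [:- a, 1:])) = proots [:- a, 1:] + mset xs"
    using Cons by (subst proots_mult) auto
  then show ?case by (simp del: mult_pCons_left)
qed simp

lemma eigenvalue_mset_lower_triangular:
  assumes N: "N \<in> carrier_mat n n" and low: "\<And>i j. i < j \<Longrightarrow> j < n \<Longrightarrow> N $$ (i,j) = 0"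
  shows "eigenvalue_mset N = mset (diag_mat N)"
proof -
  have "char_poly N = char_poly N\<^sup>T" using N by simp
  also have "\<dots> = (\<Prod>a\<leftarrow>diag_mat N\<^sup>T. [:- a, 1:])"
    by (rule char_poly_upper_triangular[of _ n]) (use N low in \<open>auto simp: upper_triangular_def\<close>)
  also have "diag_mat N\<^sup>T = diag_mat N" using N by (auto simp: diag_mat_def)
  finally show ?thesis by (simp add: eigenvalue_mset_def proots_linear_factors)
qed

lemma eigenvalue_mset_intertwined:
  assumes "A \<in> carrier_mat n n" "B \<in> carrier_mat n n" "nonsing n Q" "A * Q = Q * B"
  shows "eigenvalue_mset A = eigenvalue_mset B"
proof -
  note Q = nonsing_carrier[OF assms(3)] nonsing_minv[OF assms(3)]
  have "A = A * Q * minv Q" using assms(1,2) Q by (simp add: mat_assoc)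
  then have "A = Q * B * minv Q" unfolding assms(4) .
  then have "similar_mat A B" using assms(1,2) Q by (intro similar_matI[of _ _ Q "minv Q" n]) auto
  then show ?thesis by (simp add: eigenvalue_mset_def char_poly_similar)
qed

text \<open>The matrix consists of \<open>p\<close> interleaved scalar problems, problem
  \<open>r\<close> taking the entries \<open>t * p + r\<close> of \<open>xs\<close>. No permutation
  is made: the scalar relations are assembled into one relation with an invertible upper triangular
  \<open>Q\<close> and a lower triangular \<open>N\<close>, whose diagonal is \<open>xs\<close> in
  its given order.\<close>

lemma eigenvalue_mset_diagonal_blocks:
  assumes len: "length xs = j * p"
    and diag: "\<And>r i. r < p \<Longrightarrow> i < j \<Longrightarrow> P r i i \<noteq> 0"
    and upper: "\<And>r i t. r < p \<Longrightarrow> t < i \<Longrightarrow> P r i t = 0"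
    and eq: "\<And>r i t. r < p \<Longrightarrow> i < j \<Longrightarrow> t < j \<Longrightarrow> (\<Sum>m<j. h r i m * P r m t) =
      P r i t * xs ! (t * p + r) + (if Suc t < j then P r i (Suc t) else 0)"
  shows "eigenvalue_mset (bmat p j j (\<lambda>i k. dg p (\<lambda>r. h r i k))) = mset xs"
proof -
  define Q where "Q = bmat p j j (\<lambda>i k. dg p (\<lambda>r. P r i k))"
  define e where "e r m t = (if m = t then xs ! (t * p + r) else if m = Suc t then 1 else 0)" for r m t
  define N where "N = bmat p j j (\<lambda>m t. dg p (\<lambda>r. e r m t))"
  have Qc: "Q \<in> carrier_mat (j * p) (j * p)" by (simp add: Q_def)
  have Qe: "Q $$ (s,t) = (if s mod p = t mod p then P (s mod p) (s div p) (t div p) else 0)"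
    if "s < j * p" "t < j * p" for s t
    using block_div_mod[OF that(1)] block_div_mod[OF that(2)] that by (simp add: Q_def bmat_def)
  have Ne: "N $$ (s,t) = (if s mod p = t mod p then e (s mod p) (s div p) (t div p) else 0)"
    if "s < j * p" "t < j * p" for s t
    using block_div_mod[OF that(1)] block_div_mod[OF that(2)] that by (simp add: N_def bmat_def)
  have "upper_triangular Q"
  proof (rule upper_triangularI)
    fix s t assume st: "t < s" "s < dim_row Q"
    then have "s < j * p" "t < j * p" using Qc by auto
    have "t div p < s div p" if "s mod p = t mod p"
    proof -
      have "t div p \<le> s div p" using st by (intro div_le_mono) auto
      moreover have "t div p \<noteq> s div p" using st that by (metis div_mult_mod_eq less_irrefl)
      ultimately show ?thesis by simp
    qed
    then show "Q $$ (s,t) = 0"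
      using Qe \<open>s < j * p\<close> \<open>t < j * p\<close> block_div_mod[of s j p] by (auto intro!: upper)
  qed
  then have "det Q = prod_list (diag_mat Q)" using Qc by (rule det_upper_triangular)
  moreover have "0 \<notin> set (diag_mat Q)"
    using Qc Qe block_div_mod[of _ j p] diag by (auto simp: diag_mat_def)
  ultimately have nQ: "nonsing (j * p) Q" using Qc by (auto simp: nonsing_def prod_list_zero_iff)
  have "eigenvalue_mset (bmat p j j (\<lambda>i k. dg p (\<lambda>r. h r i k))) = eigenvalue_mset N"
  proof (rule eigenvalue_mset_intertwined[OF _ _ nQ])
    have "bmat p j j (\<lambda>i k. dg p (\<lambda>r. h r i k)) * Q = bmat p j j (\<lambda>i t. dg p (\<lambda>r. \<Sum>m<j. h r i m * P r m t))"
      unfolding Q_def by (subst bmat_mult) (auto simp: dg_mult msum_dg)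
    also have "\<dots> = bmat p j j (\<lambda>i t. dg p (\<lambda>r. \<Sum>m<j. P r i m * e r m t))"
    proof (rule block_mat_eqI[of _ j p j])
      fix i t r c assume *: "i < j" "t < j" "r < p" "c < p"
      have "(\<Sum>m<j. P r i m * e r m t) = (\<Sum>m<j. (if m = t then P r i t * xs ! (t * p + r) else 0) +
          (if m = Suc t then P r i (Suc t) else 0))"
        by (rule sum.cong) (auto simp: e_def)
      also have "\<dots> = P r i t * xs ! (t * p + r) + (if Suc t < j then P r i (Suc t) else 0)"
        using * by (simp add: sum.distrib)
      finally have "(\<Sum>m<j. h r i m * P r m t) = (\<Sum>m<j. P r i m * e r m t)" using eq * by simp
      then show "bmat p j j (\<lambda>i t. dg p (\<lambda>r. \<Sum>m<j. h r i m * P r m t)) $$ (i * p + r, t * p + c) =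
          bmat p j j (\<lambda>i t. dg p (\<lambda>r. \<Sum>m<j. P r i m * e r m t)) $$ (i * p + r, t * p + c)"
        using * by auto
    qed auto
    also have "\<dots> = Q * N"
      unfolding Q_def N_def by (subst bmat_mult) (auto simp: dg_mult msum_dg)
    finally show "bmat p j j (\<lambda>i k. dg p (\<lambda>r. h r i k)) * Q = Q * N" .
  qed (auto simp: N_def)
  also have "\<dots> = mset (diag_mat N)"
  proof (rule eigenvalue_mset_lower_triangular[of _ "j * p"])
    fix s t assume st: "s < t" "t < j * p"
    have "e (s mod p) (s div p) (t div p) = 0" if "s mod p = t mod p"
    proof -
      have "s div p \<le> t div p" using st by (intro div_le_mono) auto
      moreover have "s div p \<noteq> t div p" using st that by (metis div_mult_mod_eq less_irrefl)
      ultimately show ?thesis by (simp add: e_def)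
    qed
    then show "N $$ (s,t) = 0" using Ne[of s t] st by simp
  qed (simp add: N_def)
  also have "diag_mat N = xs"
  proof (rule nth_equalityI)
    show "length (diag_mat N) = length xs" by (simp add: diag_mat_def len N_def)
    fix s assume "s < length (diag_mat N)"
    then have "s < j * p" by (simp add: diag_mat_def N_def)
    then show "diag_mat N ! s = xs ! s" using Ne[of s s] by (simp add: diag_mat_def e_def N_def)
  qed
  finally show ?thesis .
qed

lemma eigenvalue_mset_block_diagonal_similarity:
  assumes g: "\<And>i. i < j \<Longrightarrow> nonsing p (g i)" and G: "\<And>i k. i < j \<Longrightarrow> k < j \<Longrightarrow> G i k \<in> carrier_mat p p"
  shows "eigenvalue_mset (bmat p j j (\<lambda>i k. minv (g i) * G i k * g k)) = eigenvalue_mset (bmat p j j G)"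
proof -
  note c = nonsing_minv(1)[OF g] nonsing_carrier[OF g]
  define D where "D = bmat p j j (\<lambda>i k. if i = k then minv (g i) else 0\<^sub>m p p)"
  define D' where "D' = bmat p j j (\<lambda>i k. if i = k then g i else 0\<^sub>m p p)"
  have "D * D' = 1\<^sub>m (j * p)"
  proof (rule block_entry_eqI[of _ j p j])
    fix i k assume ik: "i < j" "k < j"
    have "block_entry p (D * D') i k = msum p p (\<lambda>m. (if i = m then minv (g i) else 0\<^sub>m p p) *
        (if m = k then g m else 0\<^sub>m p p)) {..<j}"
      unfolding D_def D'_def using c ik by (subst bmat_mult) auto
    also have "\<dots> = minv (g i) * (if i = k then g i else 0\<^sub>m p p)"
      by (subst msum_single[of _ i]) (use ik c in \<open>auto simp: carrier_matD[OF c(1)] carrier_matD[OF c(2)]\<close>)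
    also have "\<dots> = block_entry p (1\<^sub>m (j * p)) i k"
      using ik c(1)[of i] nonsing_minv[OF g[of i]] by (auto simp: block_entry_one)
    finally show "block_entry p (D * D') i k = block_entry p (1\<^sub>m (j * p)) i k" .
  qed (auto simp: D_def D'_def)
  then have nD: "nonsing (j * p) D" by (intro nonsingI[of _ _ D']) (auto simp: D_def D'_def)
  show ?thesis
  proof (rule eigenvalue_mset_intertwined[OF _ _ nD])
    have "bmat p j j (\<lambda>i k. minv (g i) * G i k * g k) * D =
        bmat p j j (\<lambda>i k. msum p p (\<lambda>m. minv (g i) * G i m * g m * (if m = k then minv (g m) else 0\<^sub>m p p)) {..<j})"
      unfolding D_def using c by (subst bmat_mult) (auto simp: carrier_matD[OF c(1)] carrier_matD[OF c(2)])
    moreover have "D * bmat p j j G =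
        bmat p j j (\<lambda>i k. msum p p (\<lambda>m. (if i = m then minv (g i) else 0\<^sub>m p p) * G m k) {..<j})"
      unfolding D_def using c G by (subst bmat_mult) auto
    moreover have "msum p p (\<lambda>m. minv (g i) * G i m * g m * (if m = k then minv (g m) else 0\<^sub>m p p)) {..<j} =
      msum p p (\<lambda>m. (if i = m then minv (g i) else 0\<^sub>m p p) * G m k) {..<j}" if "i < j" "k < j" for i k
    proof -
      have "msum p p (\<lambda>m. minv (g i) * G i m * g m * (if m = k then minv (g m) else 0\<^sub>m p p)) {..<j} =
          minv (g i) * G i k * g k * minv (g k)"
        by (subst msum_single[of _ k]) (use that c in \<open>auto simp: carrier_matD[OF c(1)] carrier_matD[OF c(2)]\<close>)
      also have "\<dots> = minv (g i) * G i k"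
        using that c(1)[of i] c(1)[of k] c(2)[of k] G[of i k] nonsing_minv[OF g[of k]] by (simp add: mat_assoc)
      also have "\<dots> = msum p p (\<lambda>m. (if i = m then minv (g i) else 0\<^sub>m p p) * G m k) {..<j}"
        by (subst msum_single[of _ i]) (use that c G[THEN carrier_matD(1)] G[THEN carrier_matD(2)] in
            \<open>auto simp: carrier_matD[OF c(1)]\<close>)
      finally show ?thesis .
    qed
    ultimately show "bmat p j j (\<lambda>i k. minv (g i) * G i k * g k) * D = D * bmat p j j G"
      by (auto intro!: block_mat_eqI[of _ j p j])
  qed auto
qed

text \<open>\<open>G j\<close> will be the subdiagonal block before rescaling. Taking
  \<open>K = G j * g j\<close> in \<open>gram_step\<close> makes the rescaled block, the inverse of
  \<open>g (Suc j)\<close> times \<open>K\<close>, equal to \<open>R j\<close> in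
  \<open>Splus\<close>.\<close>

lemma cycle_blocks:
  assumes F: "\<And>j. j \<le> M \<Longrightarrow> nonsing p (F j)"
    and less: "\<And>j. j < M \<Longrightarrow> gram_less (F (Suc j)) (F j)"
    and G: "\<And>j. j < M \<Longrightarrow> nonsing p (G j)"
  shows "\<exists>g R. g 0 = minv (F 0) \<and> (\<forall>j\<le>M. nonsing p (g j) \<and>
      msum p p (\<lambda>i. g i * adj (g i)) {..<Suc j} * (adj (F j) * F j) = 1\<^sub>m p) \<and>
    (\<forall>j<M. R j \<in> Splus p \<and> g (Suc j) * R j = G j * g j)"
proof -
  \<comment> \<open>The state pairs \<open>g j\<close> with the sum of all
    \<open>g i * adj g i\<close> up to \<open>j\<close>, which serves as the left inverse
    \<open>P\<close> in the next \<open>gram_step\<close>. Beyond index \<open>M\<close> the state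
    is unconstrained.\<close>
  define ok where "ok j x \<longleftrightarrow> (j \<le> M \<longrightarrow> nonsing p (fst x) \<and> snd x \<in> carrier_mat p p \<and>
    snd x * (adj (F j) * F j) = 1\<^sub>m p) \<and> (j = 0 \<longrightarrow> x = (minv (F 0), minv (F 0) * adj (minv (F 0))))"
    for j and x :: "complex mat \<times> complex mat"
  define st where "st j x y \<longleftrightarrow> (j < M \<longrightarrow> (\<exists>R\<in>Splus p. fst y * R = G j * fst x) \<and>
    snd y = snd x + fst y * adj (fst y))" for j and x y :: "complex mat \<times> complex mat"
  have "\<exists>f. \<forall>n. ok n (f n) \<and> st n (f n) (f (Suc n))"
  proof (rule dependent_nat_choice)
    note c = nonsing_carrier[OF F[of 0]] nonsing_minv[OF F[of 0]]
    show "\<exists>x. ok 0 x"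
      unfolding ok_def using c nonsing_inv[OF F[of 0]] adj_minv_cancel[OF F[of 0]]
      by (auto simp: mat_assoc)
  next
    fix x j assume x: "ok j x"
    show "\<exists>y. ok (Suc j) y \<and> st j x y"
    proof (cases "j < M")
      case True
      obtain g R where "nonsing p g" "R \<in> Splus p" "g * R = G j * fst x"
        "(snd x + g * adj g) * (adj (F (Suc j)) * F (Suc j)) = 1\<^sub>m p"
        by (rule gram_step[OF F[of j] F[of "Suc j"] less[OF True], of "snd x" "G j * fst x"])
          (use x True G in \<open>auto simp: ok_def intro!: nonsing_mult\<close>)
      then show ?thesis
        by (intro exI[of _ "(g, snd x + g * adj g)"]) (auto simp: ok_def st_def dest: nonsing_carrier)
    qed (auto simp: ok_def st_def)
  qed
  then obtain f where f: "\<And>n. ok n (f n)" "\<And>n. st n (f n) (f (Suc n))" by blast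
  have g0: "fst (f 0) = minv (F 0)" using f(1)[of 0] by (simp add: ok_def)
  have gc: "fst (f j) \<in> carrier_mat p p" if "j \<le> M" for j
    using f(1)[of j] that by (auto simp: ok_def nonsing_def)
  have sum: "j \<le> M \<Longrightarrow> snd (f j) = msum p p (\<lambda>i. fst (f i) * adj (fst (f i))) {..<Suc j}" for j
  proof (induction j)
    case 0
    have "snd (f 0) = fst (f 0) * adj (fst (f 0))" using f(1)[of 0] by (simp add: ok_def)
    then show ?case using gc[of 0] by (intro eq_matI) auto
  next
    case (Suc j)
    then have "snd (f (Suc j)) = snd (f j) + fst (f (Suc j)) * adj (fst (f (Suc j)))"
      using f(2)[of j] by (simp add: st_def)
    then show ?case using Suc gc[of "Suc j"] by (subst msum_Suc) auto
  qed
  have "\<forall>j. \<exists>R. j < M \<longrightarrow> R \<in> Splus p \<and> fst (f (Suc j)) * R = G j * fst (f j)"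
    using f(2) by (auto simp: st_def)
  then obtain R where "\<forall>j. j < M \<longrightarrow> R j \<in> Splus p \<and> fst (f (Suc j)) * R j = G j * fst (f j)" by metis
  then show ?thesis
    using g0 sum f(1) by (intro exI[of _ "\<lambda>j. fst (f j)"] exI[of _ R]) (auto simp: ok_def)
qed

text \<open>The row \<open>[g\<^sub>0, \<dots>, g\<^sub>M]\<close> spans the left kernel of the Hessenberg matrix without its last block
  column, so the GMRES residual after \<open>j\<close> steps has Gram matrix \<open>(\<Sum>i\<le>j. g\<^sub>i g\<^sub>i\<^sup>*)\<^sup>-\<^sup>1\<close>.\<close>

lemma cycle_data:
  assumes F: "\<And>j. j \<le> M \<Longrightarrow> F j \<in> Splus p"
    and less: "\<And>j. j < M \<Longrightarrow> gram_less (F (Suc j)) (F j)"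
    and size: "\<And>j. j \<le> M + 1 \<Longrightarrow> size (\<Theta> j) = j * p"
    and nz: "\<And>j. j \<le> M \<Longrightarrow> 0 \<notin># \<Theta> j"
  shows "\<exists>g H. g 0 = minv (F 0) \<and> (\<forall>i\<le>M. nonsing p (g i)) \<and>
    (\<forall>j\<le>M. msum p p (\<lambda>i. g i * adj (g i)) {..<Suc j} * (adj (F j) * F j) = 1\<^sub>m p) \<and>
    (\<forall>i j. H i j \<in> carrier_mat p p) \<and> (\<forall>i j. Suc j < i \<longrightarrow> H i j = 0\<^sub>m p p) \<and>
    (\<forall>j<M. H (Suc j) j \<in> Splus p) \<and>
    (\<forall>j<M. msum p p (\<lambda>i. g i * H i j) {..<Suc M} = 0\<^sub>m p p) \<and>
    (\<forall>j\<le>M + 1. eigenvalue_mset (bmat p j j H) = \<Theta> j)"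
proof -
  have "\<forall>j. \<exists>xs. mset xs = \<Theta> j" using ex_mset by blast
  then obtain xs where xs: "\<And>j. mset (xs j) = \<Theta> j" by metis
  have len: "length (xs j) = j * p" if "j \<le> M + 1" for j
    using size[OF that] xs by (metis size_mset)
  have nzx: "xs j ! (i * p + r) \<noteq> 0" if "j \<le> M" "i < j" "r < p" for j i r
    using nz[of j] xs[of j] len[of j] block_index[OF that(2,3)] that nth_mem[of "i * p + r" "xs j"]
    by (metis le_SucI Suc_eq_plus1 in_multiset_in_set)
  define q where "q r h P \<longleftrightarrow> (\<forall>i j. j \<le> M \<longrightarrow> j + 1 < i \<longrightarrow> h i j = 0) \<and> (\<forall>j<M. h (Suc j) j \<noteq> 0) \<and>
    (\<forall>j<M. (\<Sum>i<M + 1. h i j) = 0) \<and>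
    (\<forall>j\<le>M + 1. (\<forall>i<j. P j i i \<noteq> 0) \<and> (\<forall>i t. t < i \<longrightarrow> P j i t = 0) \<and>
      (\<forall>i<j. \<forall>t<j. (\<Sum>m<j. h i m * P j m t) =
        P j i t * xs j ! (t * p + r) + (if Suc t < j then P j i (Suc t) else 0)))"
    for r :: nat and h :: "nat \<Rightarrow> nat \<Rightarrow> complex" and P :: "nat \<Rightarrow> nat \<Rightarrow> nat \<Rightarrow> complex"
  have "\<forall>r. \<exists>h P. r < p \<longrightarrow> q r h P"
  proof
    fix r
    show "\<exists>h P. r < p \<longrightarrow> q r h P"
    proof (cases "r < p")
      case True
      have "\<exists>h P. q r h P"
        unfolding q_def
        by (rule hessenberg_with_ritz_values[of M "\<lambda>j t. xs j ! (t * p + r)"]) (use nzx True in auto)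
      then show ?thesis by blast
    qed auto
  qed
  then obtain h P where "\<forall>r. r < p \<longrightarrow> q r (h r) (P r)" by metis
  then have q: "q r (h r) (P r)" if "r < p" for r using that by blast
  \<comment> \<open>Ritz data first: \<open>G\<close> depends only on the prescribed multisets, and
    the norms enter afterwards through \<open>g\<close>.\<close>
  define G where "G i j = dg p (\<lambda>r. h r i j)" for i j
  have nG: "nonsing p (G (Suc j) j)" if "j < M" for j
    unfolding G_def by (rule nonsing_dg) (use q that in \<open>auto simp: q_def\<close>)
  obtain g R where g0: "g 0 = minv (F 0)" and g: "\<And>j. j \<le> M \<Longrightarrow> nonsing p (g j)"
    and gram: "\<And>j. j \<le> M \<Longrightarrow> msum p p (\<lambda>i. g i * adj (g i)) {..<Suc j} * (adj (F j) * F j) = 1\<^sub>m p"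
    and R: "\<And>j. j < M \<Longrightarrow> R j \<in> Splus p" "\<And>j. j < M \<Longrightarrow> g (Suc j) * R j = G (Suc j) j * g j"
    using cycle_blocks[of M p F "\<lambda>j. G (Suc j) j"] F[THEN Splus_nonsing] less nG by blast
  note c = nonsing_minv(1)[OF g] nonsing_carrier[OF g]
  note d = carrier_matD[OF c(1)] carrier_matD[OF c(2)]
  have Gd: "dim_row (G i j) = p" "dim_col (G i j) = p" for i j by (auto simp: G_def)
  \<comment> \<open>Multiplying by \<open>g i\<close> from the left cancels its inverse, so the
    vanishing column sums of \<open>G\<close> become the left kernel row. Column \<open>M\<close> is
    included, as it carries the eigenvalues of the whole matrix.\<close>
  define H where "H i j = (if i \<le> M \<and> j \<le> M then minv (g i) * G i j * g j else 0\<^sub>m p p)" for i j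
  have Hc: "H i j \<in> carrier_mat p p" for i j by (auto simp: H_def d)
  show ?thesis
  proof (intro exI[of _ g] exI[of _ H] conjI allI impI)
    fix i j :: nat assume ij: "Suc j < i"
    show "H i j = 0\<^sub>m p p"
    proof (cases "i \<le> M \<and> j \<le> M")
      case True
      then have "G i j = dg p (\<lambda>_. 0)" unfolding G_def using q ij by (intro dg_cong) (auto simp: q_def)
      then show ?thesis using True c(1)[of i] c(2)[of j] by (simp add: H_def dg_zero)
    qed (auto simp: H_def)
  next
    fix j assume j: "j < M"
    have "H (Suc j) j = minv (g (Suc j)) * (g (Suc j) * R j)"
      using j R(2)[OF j] c(2)[of j] c(1)[of "Suc j"] by (simp add: H_def mat_assoc Gd)
    also have "\<dots> = R j"
      using R(1)[OF j] j by (intro minv_cancel(2)[OF g]) (auto simp: Splus_def)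
    finally show "H (Suc j) j \<in> Splus p" using R(1)[OF j] by simp
  next
    fix j assume j: "j < M"
    have "msum p p (\<lambda>i. g i * H i j) {..<Suc M} = msum p p (\<lambda>i. G i j * g j) {..<Suc M}"
    proof (rule msum_cong[OF refl])
      fix i assume "i \<in> {..<Suc M}"
      then have i: "i \<le> M" by simp
      show "g i * H i j = G i j * g j"
        using i j c(1)[OF i] c(2)[OF i] c(2)[of j] minv_cancel(1)[OF g[OF i]] by (simp add: H_def mat_assoc Gd)
    qed
    also have "\<dots> = msum p p (\<lambda>i. G i j) {..<Suc M} * g j"
      using c(2)[of j] j by (subst msum_mult) (auto simp: Gd intro!: carrier_matI)
    also have "msum p p (\<lambda>i. G i j) {..<Suc M} = dg p (\<lambda>_. 0)"
      unfolding G_def msum_dg by (rule dg_cong) (use q j in \<open>auto simp: q_def\<close>)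
    finally show "msum p p (\<lambda>i. g i * H i j) {..<Suc M} = 0\<^sub>m p p"
      using c(2)[of j] j by (simp add: dg_zero)
  next
    fix j assume j: "j \<le> M + 1"
    have "bmat p j j H = bmat p j j (\<lambda>i k. minv (g i) * G i k * g k)"
      by (rule block_mat_eqI[of _ j p j]) (use j in \<open>auto simp: H_def\<close>)
    then have "eigenvalue_mset (bmat p j j H) = eigenvalue_mset (bmat p j j (\<lambda>i k. minv (g i) * G i k * g k))"
      by simp
    also have "\<dots> = eigenvalue_mset (bmat p j j G)"
      by (rule eigenvalue_mset_block_diagonal_similarity) (use j g in \<open>auto simp: Gd intro: carrier_matI\<close>)
    also have "\<dots> = mset (xs j)"
      unfolding G_def
      by (rule eigenvalue_mset_diagonal_blocks[where P = "\<lambda>r. P r j"]) (use len j q in \<open>auto simp: q_def\<close>)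
    finally show "eigenvalue_mset (bmat p j j H) = \<Theta> j" using xs by simp
  qed (use g0 g gram Hc in auto)
qed

section \<open>Coupling the cycles\<close>

lemma msum_orthonormal:
  assumes "finite I" "\<And>i. i \<in> I \<Longrightarrow> v i \<in> carrier_mat n p"
    "\<And>i. i \<in> I \<Longrightarrow> X i \<in> carrier_mat p p" "\<And>i. i \<in> I \<Longrightarrow> Y i \<in> carrier_mat p p"
    "\<And>i j. i \<in> I \<Longrightarrow> j \<in> I \<Longrightarrow> adj (v i) * v j = (if i = j then 1\<^sub>m p else 0\<^sub>m p p)"
  shows "adj (msum n p (\<lambda>i. v i * X i) I) * msum n p (\<lambda>i. v i * Y i) I = msum p p (\<lambda>i. adj (X i) * Y i) I"
proof -
  note d = assms(2)[THEN carrier_matD(1)] assms(2)[THEN carrier_matD(2)]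
    assms(3)[THEN carrier_matD(1)] assms(3)[THEN carrier_matD(2)]
    assms(4)[THEN carrier_matD(1)] assms(4)[THEN carrier_matD(2)]
  have "adj (msum n p (\<lambda>i. v i * X i) I) * msum n p (\<lambda>i. v i * Y i) I =
      msum p p (\<lambda>i. adj (v i * X i) * msum n p (\<lambda>j. v j * Y j) I) I"
    by (subst adj_msum) (auto simp: d msum_mult)
  also have "\<dots> = msum p p (\<lambda>i. adj (X i) * Y i) I"
  proof (rule msum_cong[OF refl])
    fix i assume i: "i \<in> I"
    have "adj (v i * X i) * msum n p (\<lambda>j. v j * Y j) I = msum p p (\<lambda>j. adj (v i * X i) * (v j * Y j)) I"
      using i by (subst mult_msum) (auto simp: d)
    also have "\<dots> = msum p p (\<lambda>j. if j = i then adj (X i) * Y i else 0\<^sub>m p p) I"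
    proof (rule msum_cong[OF refl])
      fix j assume j: "j \<in> I"
      have "adj (v i * X i) * (v j * Y j) = adj (X i) * ((adj (v i) * v j) * Y j)"
        using i j by (simp add: d adj_mult mat_assoc)
      then show "adj (v i * X i) * (v j * Y j) = (if j = i then adj (X i) * Y i else 0\<^sub>m p p)"
        using assms(5)[OF i j] i j assms(3)[OF i] assms(4)[OF j] by auto
    qed
    also have "\<dots> = adj (X i) * Y i"
      by (subst msum_single[of _ i]) (use i assms in \<open>auto simp: d\<close>)
    finally show "adj (v i * X i) * msum n p (\<lambda>j. v j * Y j) I = adj (X i) * Y i" .
  qed
  finally show ?thesis .
qed

lemma msum_sandwich:
  assumes "\<And>i. i \<in> I \<Longrightarrow> f i \<in> carrier_mat p p" "T \<in> carrier_mat p p" "U \<in> carrier_mat p p"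
  shows "msum p p (\<lambda>i. T * f i * U) I = T * msum p p f I * U"
proof -
  note d = assms(1)[THEN carrier_matD(1)] assms(1)[THEN carrier_matD(2)]
  have "T * msum p p f I = msum p p (\<lambda>i. T * f i) I"
    using assms by (subst mult_msum) auto
  moreover have "msum p p (\<lambda>i. T * f i) I * U = msum p p (\<lambda>i. T * f i * U) I"
    using assms by (subst msum_mult) (auto simp: d)
  ultimately show ?thesis by simp
qed

text \<open>Here cycles are numbered from 0, \<open>F k M\<close> is the block norm at the end of cycle \<open>k\<close> (arbitrary
  in the last cycle), and \<open>w k i\<close> is the unit block vector in position \<open>k M + i\<close>, which does not
  exist for the last one.\<close>

locale assembly =
  fixes p M l n :: nat and F g :: "nat \<Rightarrow> nat \<Rightarrow> complex mat" and H :: "nat \<Rightarrow> nat \<Rightarrow> nat \<Rightarrow> complex mat"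
  assumes M: "M \<ge> 1" and l: "l \<ge> 1" and n: "n = (l * M) * p"
    and F: "\<And>k j. k < l \<Longrightarrow> j \<le> M \<Longrightarrow> F k j \<in> Splus p"
    and link: "\<And>k. Suc k < l \<Longrightarrow> F k M = F (Suc k) 0"
    and g0: "\<And>k. k < l \<Longrightarrow> g k 0 = minv (F k 0)"
    and g: "\<And>k i. k < l \<Longrightarrow> i \<le> M \<Longrightarrow> nonsing p (g k i)"
    and gram: "\<And>k j. k < l \<Longrightarrow> j \<le> M \<Longrightarrow>
      msum p p (\<lambda>i. g k i * adj (g k i)) {..<Suc j} * (adj (F k j) * F k j) = 1\<^sub>m p"
    and H: "\<And>k i j. H k i j \<in> carrier_mat p p"
    and hess: "\<And>k i j. k < l \<Longrightarrow> Suc j < i \<Longrightarrow> H k i j = 0\<^sub>m p p"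
    and sub: "\<And>k j. k < l \<Longrightarrow> j < M \<Longrightarrow> H k (Suc j) j \<in> Splus p"
    and colsum: "\<And>k j. k < l \<Longrightarrow> j < M \<Longrightarrow> msum p p (\<lambda>i. g k i * H k i j) {..<Suc M} = 0\<^sub>m p p"
begin

lemma Hd [simp]: "dim_row (H k i j) = p" "dim_col (H k i j) = p"
  using H by (auto dest: carrier_matD)

lemma Fd: "k < l \<Longrightarrow> j \<le> M \<Longrightarrow> nonsing p (F k j)"
  using F Splus_nonsing by blast

lemma gd: "k < l \<Longrightarrow> i \<le> M \<Longrightarrow> dim_row (g k i) = p" "k < l \<Longrightarrow> i \<le> M \<Longrightarrow> dim_col (g k i) = p"
  "k < l \<Longrightarrow> i \<le> M \<Longrightarrow> dim_row (F k i) = p" "k < l \<Longrightarrow> i \<le> M \<Longrightarrow> dim_col (F k i) = p"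
  using g[of k i] Fd[of k i] nonsing_carrier carrier_matD by blast+

section \<open>Unit block vectors and orthonormality of the Arnoldi vectors of each cycle\<close>

definition e :: "nat \<Rightarrow> complex mat" where
  "e t = mat n p (\<lambda>(r,c). if r = t * p + c then 1 else 0)"

lemma e_dims [simp]: "dim_row (e t) = n" "dim_col (e t) = p"
  by (auto simp: e_def)

lemma e_gram:
  assumes "s < l * M" "t < l * M"
  shows "adj (e s) * e t = (if s = t then 1\<^sub>m p else 0\<^sub>m p p)"
proof (rule eq_matI)
  fix i j assume "i < dim_row (if s = t then 1\<^sub>m p else 0\<^sub>m p p :: complex mat)"
    "j < dim_col (if s = t then 1\<^sub>m p else 0\<^sub>m p p :: complex mat)"
  then have ij: "i < p" "j < p" by (auto split: if_splits)
  have lt: "s * p + i < n" using block_index[OF assms(1) ij(1)] by (simp add: n)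
  have "(adj (e s) * e t) $$ (i,j) = (\<Sum>r<n. if r = s * p + i then (if s * p + i = t * p + j then 1 else 0) else 0)"
  proof -
    have "(adj (e s) * e t) $$ (i,j) = (\<Sum>r<n. adj (e s) $$ (i,r) * e t $$ (r,j))"
      using ij by (simp add: mult_entry del: adj_entry)
    also have "\<dots> = (\<Sum>r<n. if r = s * p + i then (if s * p + i = t * p + j then 1 else 0) else 0)"
      by (rule sum.cong) (use ij in \<open>auto simp: e_def\<close>)
    finally show ?thesis .
  qed
  also have "\<dots> = (if s * p + i = t * p + j then 1 else 0)" using lt by simp
  also have "s * p + i = t * p + j \<longleftrightarrow> s = t \<and> i = j"
  proof -
    have "(s * p + i) div p = s" "(s * p + i) mod p = i" "(t * p + j) div p = t" "(t * p + j) mod p = j"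
      using ij by auto
    then show ?thesis by metis
  qed
  finally show "(adj (e s) * e t) $$ (i,j) = (if s = t then 1\<^sub>m p else 0\<^sub>m p p) $$ (i,j)"
    using ij by auto
qed auto

definition w :: "nat \<Rightarrow> nat \<Rightarrow> complex mat" where
  "w k i = (if i = M \<and> Suc k = l then 0\<^sub>m n p else e (k * M + i))"

text \<open>Coordinates of the next start vector: the residual at the end of cycle \<open>k\<close>
  is the sum of \<open>v k i * X k i\<close>, multiplied on the right by its block norm
  \<open>F k M\<close>.\<close>

definition X :: "nat \<Rightarrow> nat \<Rightarrow> complex mat" where
  "X k i = adj (g k i) * adj (F k M)"

primrec s :: "nat \<Rightarrow> complex mat" where
  "s 0 = e 0"
| "s (Suc k) = s k * X k 0 + msum n p (\<lambda>i. w k (Suc i) * X k (Suc i)) {..<M}"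

definition v :: "nat \<Rightarrow> nat \<Rightarrow> complex mat" where
  "v k i = (if i = 0 then s k else w k i)"

lemma w_dims [simp]: "dim_row (w k i) = n" "dim_col (w k i) = p"
  by (auto simp: w_def)

lemma Xd: "k < l \<Longrightarrow> i \<le> M \<Longrightarrow> dim_row (X k i) = p" "k < l \<Longrightarrow> i \<le> M \<Longrightarrow> dim_col (X k i) = p"
  by (auto simp: X_def gd)

lemma s_dims: "k < l \<Longrightarrow> dim_row (s k) = n \<and> dim_col (s k) = p"
  by (cases k) auto

lemma v_dims: "k < l \<Longrightarrow> dim_row (v k i) = n" "k < l \<Longrightarrow> dim_col (v k i) = p"
  using s_dims by (auto simp: v_def)

lemma v_carrier: "k < l \<Longrightarrow> v k i \<in> carrier_mat n p"
  using v_dims by auto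

lemma s_Suc: "Suc k < l \<Longrightarrow> s (Suc k) = msum n p (\<lambda>i. v k i * X k i) {..<Suc M}"
  by (subst msum_Suc_shift) (auto simp: v_def s_dims Xd)

lemma index_bound: "k < l \<Longrightarrow> i \<le> M \<Longrightarrow> i < M \<or> Suc k < l \<Longrightarrow> k * M + i < l * M"
  using block_index[of k l i M] block_index[of "Suc k" l 0 M] M by (cases "i = M") auto

text \<open>\<open>s k\<close> is supported in the block positions up to \<open>k * M\<close>, so
  every later unit vector is fresh for it.\<close>

lemma e_s: "k < l \<Longrightarrow> k * M < t \<Longrightarrow> t < l * M \<Longrightarrow> adj (e t) * s k = 0\<^sub>m p p"
proof (induction k)
  case 0
  then show ?case using e_gram[of t 0] M by simp
next
  case (Suc k)
  have "adj (e t) * s (Suc k) = msum p p (\<lambda>i. adj (e t) * (v k i * X k i)) {..<Suc M}"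
    unfolding s_Suc[OF Suc.prems(1)] by (subst mult_msum) (use Suc.prems(1) in \<open>auto simp: v_dims Xd\<close>)
  also have "\<dots> = 0\<^sub>m p p"
  proof (rule msum_zero)
    fix i assume "i \<in> {..<Suc M}"
    then have i: "i \<le> M" by simp
    have "adj (e t) * v k i = 0\<^sub>m p p"
    proof (cases "i = 0")
      case True
      then show ?thesis using Suc by (simp add: v_def)
    next
      case False
      have "k * M + i < t" using i Suc.prems by simp
      then show ?thesis using False i Suc.prems e_gram[of t "k * M + i"] by (simp add: v_def w_def)
    qed
    then show "adj (e t) * (v k i * X k i) = 0\<^sub>m p p"
      using i Suc.prems Xd[of k i] v_dims[of k i] by (simp flip: mat_assoc)
  qed
  finally show ?case .
qed

text \<open>Normalization of \<open>s k\<close> is a premise because the two facts are interlocked: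
  \<open>s_orthonormal\<close> passes from \<open>s k\<close> to \<open>s (Suc k)\<close> by means
  of this lemma.\<close>

lemma orthonormal_step:
  assumes k: "k < l" and ss: "adj (s k) * s k = 1\<^sub>m p"
    and ij: "i \<le> M" "j \<le> M" "i < M \<or> Suc k < l" "j < M \<or> Suc k < l"
  shows "adj (v k i) * v k j = (if i = j then 1\<^sub>m p else 0\<^sub>m p p)"
proof -
  have w: "w k i = e (k * M + i)" if "i \<le> M" "i < M \<or> Suc k < l" for i using that by (auto simp: w_def)
  have es: "adj (e (k * M + i)) * s k = 0\<^sub>m p p" if "0 < i" "i \<le> M" "i < M \<or> Suc k < l" for i
    using index_bound[OF k that(2,3)] that k by (intro e_s) auto
  have se: "adj (s k) * e (k * M + i) = 0\<^sub>m p p" if "0 < i" "i \<le> M" "i < M \<or> Suc k < l" for i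
    using es[OF that] adj_mult[of "adj (e (k * M + i))" "s k"] s_dims[OF k] by simp
  show ?thesis
    using ij ss es se w e_gram index_bound[OF k] by (auto simp: v_def)
qed

text \<open>The Gram matrix of \<open>s (Suc k)\<close> is \<open>F k M * P * adj (F k M)\<close>,
  and \<open>P\<close> is the inverse of \<open>adj (F k M) * F k M\<close> by
  \<open>gram\<close>.\<close>

lemma s_orthonormal: "k < l \<Longrightarrow> adj (s k) * s k = 1\<^sub>m p"
proof (induction k)
  case 0
  then show ?case using e_gram[of 0 0] M l by simp
next
  case (Suc k)
  then have k: "k < l" by simp
  note c = nonsing_carrier[OF Fd[OF k order.refl]] nonsing_minv[OF Fd[OF k order.refl]]
  define P where "P = msum p p (\<lambda>i. g k i * adj (g k i)) {..<Suc M}"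
  have P: "P \<in> carrier_mat p p" by (simp add: P_def)
  have "adj (s (Suc k)) * s (Suc k) = msum p p (\<lambda>i. adj (X k i) * X k i) {..<Suc M}"
    unfolding s_Suc[OF Suc.prems]
    by (rule msum_orthonormal[OF _ v_carrier[OF k]])
      (use k Suc in \<open>auto simp: less_Suc_eq_le Xd orthonormal_step intro!: carrier_matI\<close>)
  also have "\<dots> = msum p p (\<lambda>i. F k M * (g k i * adj (g k i)) * adj (F k M)) {..<Suc M}"
    by (rule msum_cong) (use k in \<open>auto simp: X_def adj_mult mat_assoc gd\<close>)
  also have "\<dots> = F k M * P * adj (F k M)"
    unfolding P_def by (rule msum_sandwich) (use k c in \<open>auto simp: gd\<close>)
  also have "\<dots> = 1\<^sub>m p"
  proof -
    have "P * (adj (F k M) * F k M) = 1\<^sub>m p" unfolding P_def by (rule gram) (use k in auto)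
    then have "(F k M * P * adj (F k M)) * F k M = 1\<^sub>m p * F k M"
      using P c by (simp add: mat_assoc)
    then have "(F k M * P * adj (F k M)) * F k M * minv (F k M) = 1\<^sub>m p * F k M * minv (F k M)" by simp
    then show ?thesis using P c by (simp add: mat_assoc)
  qed
  finally show ?case .
qed

lemma v_orthonormal:
  "k < l \<Longrightarrow> i \<le> M \<Longrightarrow> j \<le> M \<Longrightarrow> i < M \<or> Suc k < l \<Longrightarrow> j < M \<or> Suc k < l \<Longrightarrow>
    adj (v k i) * v k j = (if i = j then 1\<^sub>m p else 0\<^sub>m p p)"
  by (rule orthonormal_step[OF _ s_orthonormal])

section \<open>The matrix \<open>A\<close>, defined on unit block vectors so that the Arnoldi
  relations hold\<close>

definition rhs :: "nat \<Rightarrow> nat \<Rightarrow> complex mat" where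
  "rhs k j = msum n p (\<lambda>i. v k i * H k i j) {..<Suc M}"

text \<open>The image of the unit vector in block position \<open>t\<close>. At a positive multiple
  of \<open>M\<close> this unit vector ends one cycle and is not itself the start of the next, so
  its image is solved from the required image of the start vector. The right-hand sides do not
  mention \<open>A\<close>, so nothing is circular.\<close>

definition a :: "nat \<Rightarrow> complex mat" where
  "a t = (if t mod M > 0 \<or> t = 0 then rhs (t div M) (t mod M)
    else (rhs (t div M) 0 - msum n p (\<lambda>i. rhs (t div M - 1) i * X (t div M - 1) i) {..<M}) *
      minv (X (t div M - 1) M))"

definition A :: "complex mat" where "A = bcols n p (l * M) a"

lemma A: "A \<in> carrier_mat n n"
  unfolding A_def using block_carrier(1)[of n p "l * M" a] by (simp add: n)

lemma rhs_dims [simp]: "dim_row (rhs k j) = n" "dim_col (rhs k j) = p" "rhs k j \<in> carrier_mat n p" by (auto simp: rhs_def)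

lemma X_nonsing: "k < l \<Longrightarrow> i \<le> M \<Longrightarrow> nonsing p (X k i)"
  unfolding X_def by (intro nonsing_mult nonsing_adj g Fd) auto

lemma A_e:
  assumes t: "t < l * M" and a: "a t \<in> carrier_mat n p"
  shows "A * e t = a t"
proof (rule eq_matI)
  fix i c assume "i < dim_row (a t)" "c < dim_col (a t)"
  then have ic: "i < n" "c < p" using a by auto
  have lt: "t * p + c < n" using block_index[OF t ic(2)] by (simp add: n)
  have "(A * e t) $$ (i,c) = (\<Sum>r<n. if r = t * p + c then A $$ (i, t * p + c) else 0)"
  proof -
    have "(A * e t) $$ (i,c) = (\<Sum>r<n. A $$ (i,r) * e t $$ (r,c))"
      using ic A by (simp add: mult_entry)
    also have "\<dots> = (\<Sum>r<n. if r = t * p + c then A $$ (i, t * p + c) else 0)"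
      by (rule sum.cong) (use ic in \<open>auto simp: e_def\<close>)
    finally show ?thesis .
  qed
  also have "\<dots> = A $$ (i, t * p + c)" using lt by simp
  also have "\<dots> = a t $$ (i,c)" unfolding A_def using ic t by simp
  finally show "(A * e t) $$ (i,c) = a t $$ (i,c)" .
qed (use a A in auto)

lemma A_w:
  assumes "k < l" "0 < i" "i < M" shows "A * w k i = rhs k i"
proof -
  have "a (k * M + i) = rhs k i" using assms by (simp add: a_def)
  then show ?thesis using A_e[of "k * M + i"] index_bound[of k i] assms by (auto simp: w_def)
qed

text \<open>The exceptional branch of \<open>a\<close> is made for this: the images of the earlier
  summands of \<open>s (Suc k)\<close> are subtracted, and \<open>X k M\<close> is inverted.\<close>

lemma A_s: "k < l \<Longrightarrow> A * s k = rhs k 0"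
proof (induction k)
  case 0
  have "a 0 = rhs 0 0" using M by (simp add: a_def)
  then show ?case using A_e[of 0] l M by auto
next
  case (Suc k)
  then have k: "k < l" by simp
  have nX: "nonsing p (X k M)" by (rule X_nonsing) (use k in auto)
  note XM = nonsing_carrier[OF nX] nonsing_minv[OF nX]
  let ?Y = "msum n p (\<lambda>i. rhs k i * X k i) {..<M}"
  have Av: "A * v k i = rhs k i" if "i < M" for i
    using that k Suc.IH A_w[of k i] by (auto simp: v_def)
  have "a (Suc k * M) = (rhs (Suc k) 0 - ?Y) * minv (X k M)"
    using M by (simp add: a_def)
  moreover have "v k M = e (Suc k * M)" using M Suc.prems by (simp add: v_def w_def add.commute)
  ultimately have AvM: "A * v k M = (rhs (Suc k) 0 - ?Y) * minv (X k M)"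
    using A_e[of "Suc k * M"] block_index[of "Suc k" l 0 M] M Suc.prems XM by simp
  have "s (Suc k) = msum n p (\<lambda>i. v k i * X k i) {..<M} + v k M * X k M"
    unfolding s_Suc[OF Suc.prems] by (subst msum_Suc) (use k XM in \<open>auto simp: v_dims\<close>)
  then have "A * s (Suc k) = A * msum n p (\<lambda>i. v k i * X k i) {..<M} + A * (v k M * X k M)"
    using A k XM by (simp add: mat_distrib_left v_dims)
  also have "A * msum n p (\<lambda>i. v k i * X k i) {..<M} = ?Y"
    using A k by (subst mult_msum) (auto simp: v_dims Xd Av mat_assoc[symmetric] intro!: msum_cong)
  also have "A * (v k M * X k M) = rhs (Suc k) 0 - ?Y"
  proof -
    have "A * (v k M * X k M) = (A * v k M) * X k M" using A k XM by (simp add: mat_assoc v_dims)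
    also have "\<dots> = rhs (Suc k) 0 - ?Y" unfolding AvM using XM by (simp add: mat_assoc)
    finally show ?thesis .
  qed
  also have "?Y + (rhs (Suc k) 0 - ?Y) = rhs (Suc k) 0" by (rule eq_matI) auto
  finally show ?case .
qed

lemma A_v: "k < l \<Longrightarrow> j < M \<Longrightarrow> A * v k j = rhs k j"
  using A_s A_w by (auto simp: v_def)

section \<open>Predicted residuals and their characterization\<close>

lemma rhs_eq:
  assumes "k < l" "Suc j \<le> m" "m \<le> M"
  shows "rhs k j = msum n p (\<lambda>i. v k i * H k i j) {..<Suc m}"
  unfolding rhs_def by (rule msum_mono_neutral) (use assms in \<open>auto simp: hess v_dims\<close>)

text \<open>The combination of the kernel row with Gram matrix \<open>adj (F k j) * F k j\<close>.
  At the very end the vector \<open>v k M\<close> is zero and the formula would fail; there the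
  residual itself is zero.\<close>

definition res :: "nat \<Rightarrow> nat \<Rightarrow> complex mat" where
  "res k j = (if Suc k = l \<and> j = M then 0\<^sub>m n p else
    msum n p (\<lambda>i. v k i * (adj (g k i) * (adj (F k j) * F k j))) {..<Suc j})"

lemma res_carrier [simp]: "res k j \<in> carrier_mat n p" "dim_row (res k j) = n" "dim_col (res k j) = p"
  by (auto simp: res_def)

lemma res_0: assumes k: "k < l" shows "res k 0 = v k 0 * F k 0"
proof -
  note c = nonsing_carrier[OF Fd[OF k le0]] nonsing_minv[OF Fd[OF k le0]]
  have "adj (g k 0) * (adj (F k 0) * F k 0) = F k 0"
    using adj_minv_cancel(4)[OF Fd[OF k le0], of "F k 0"] c by (simp add: g0[OF k])
  then have "res k 0 = msum n p (\<lambda>i. v k 0 * F k 0) {..<Suc 0}"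
    using M by (auto simp: res_def intro!: msum_cong)
  then show ?thesis using k c by (auto simp: v_dims intro!: eq_matI)
qed

lemma res_link: assumes "Suc k < l" shows "res k M = res (Suc k) 0"
proof -
  have k: "k < l" using assms by simp
  have "res k M = msum n p (\<lambda>i. v k i * X k i * F k M) {..<Suc M}"
    using assms by (auto simp: res_def X_def gd v_dims mat_assoc intro!: msum_cong)
  also have "\<dots> = s (Suc k) * F k M"
    unfolding s_Suc[OF assms] by (subst msum_mult) (use k in \<open>auto simp: gd v_dims Xd\<close>)
  also have "\<dots> = res (Suc k) 0" using res_0[OF assms] link[OF assms] by (simp add: v_def)
  finally show ?thesis .
qed

text \<open>With \<open>T\<close> the prescribed Gram matrix and \<open>P\<close> its inverse,
  orthonormality of the vectors gives \<open>T * P * T = T\<close>.\<close>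

lemma res_gram:
  assumes k: "k < l" and j: "j \<le> M" "j < M \<or> Suc k < l"
  shows "adj (res k j) * res k j = adj (F k j) * F k j"
proof -
  define T where "T = adj (F k j) * F k j"
  have T: "T \<in> carrier_mat p p" "adj T = T" using k j by (auto simp: T_def gd adj_mult)
  define P where "P = msum p p (\<lambda>i. g k i * adj (g k i)) {..<Suc j}"
  have PT: "P * T = 1\<^sub>m p" unfolding P_def T_def by (rule gram[OF k j(1)])
  have "adj (res k j) * res k j = msum p p (\<lambda>i. adj (adj (g k i) * T) * (adj (g k i) * T)) {..<Suc j}"
  proof -
    have "res k j = msum n p (\<lambda>i. v k i * (adj (g k i) * T)) {..<Suc j}"
      using j by (auto simp: res_def T_def)
    moreover have "adj (msum n p (\<lambda>i. v k i * (adj (g k i) * T)) {..<Suc j}) *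
        msum n p (\<lambda>i. v k i * (adj (g k i) * T)) {..<Suc j} =
        msum p p (\<lambda>i. adj (adj (g k i) * T) * (adj (g k i) * T)) {..<Suc j}"
      by (rule msum_orthonormal[OF _ v_carrier[OF k]])
        (use k j T in \<open>auto simp: less_Suc_eq_le gd v_orthonormal\<close>)
    ultimately show ?thesis by simp
  qed
  also have "\<dots> = msum p p (\<lambda>i. T * (g k i * adj (g k i)) * T) {..<Suc j}"
    by (rule msum_cong) (use k j T in \<open>auto simp: adj_mult mat_assoc gd\<close>)
  also have "\<dots> = T * P * T"
    unfolding P_def by (rule msum_sandwich) (use k j T in \<open>auto simp: gd\<close>)
  also have "\<dots> = T * (P * T)" using T by (intro mat_assoc) (auto simp: P_def)
  also have "\<dots> = T" using PT T by simp
  finally show ?thesis by (simp add: T_def)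
qed

text \<open>By orthonormality the product is the adjoint of a column sum of
  \<open>g k i * H k i m\<close>, times a fixed matrix. For \<open>m < j\<close> the terms beyond
  \<open>j\<close> vanish by the Hessenberg shape, so \<open>colsum\<close> applies to the truncated
  sum.\<close>

lemma res_orth:
  assumes k: "k < l" and m: "m < j" and j: "j \<le> M"
  shows "adj (A * v k m) * res k j = 0\<^sub>m p p"
proof (cases "Suc k = l \<and> j = M")
  case True
  then show ?thesis using A k by (simp add: res_def v_dims)
next
  case False
  define T where "T = adj (F k j) * F k j"
  have T: "T \<in> carrier_mat p p" using k j by (auto simp: T_def gd)
  have "A * v k m = msum n p (\<lambda>i. v k i * H k i m) {..<Suc j}"
    using A_v[OF k, of m] rhs_eq[OF k, of m j] m j by simp
  moreover have "res k j = msum n p (\<lambda>i. v k i * (adj (g k i) * T)) {..<Suc j}"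
    using False j by (auto simp: res_def T_def)
  moreover have "adj (msum n p (\<lambda>i. v k i * H k i m) {..<Suc j}) *
      msum n p (\<lambda>i. v k i * (adj (g k i) * T)) {..<Suc j} =
      msum p p (\<lambda>i. adj (H k i m) * (adj (g k i) * T)) {..<Suc j}"
    by (rule msum_orthonormal[OF _ v_carrier[OF k]])
      (use k j T False in \<open>auto simp: less_Suc_eq_le gd H v_orthonormal\<close>)
  ultimately have "adj (A * v k m) * res k j = msum p p (\<lambda>i. adj (H k i m) * (adj (g k i) * T)) {..<Suc j}"
    by simp
  also have "\<dots> = msum p p (\<lambda>i. adj (g k i * H k i m) * T) {..<Suc j}"
    by (rule msum_cong) (use k j T in \<open>auto simp: adj_mult mat_assoc gd\<close>)
  also have "\<dots> = adj (msum p p (\<lambda>i. g k i * H k i m) {..<Suc j}) * T"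
  proof -
    have "adj (msum p p (\<lambda>i. g k i * H k i m) {..<Suc j}) = msum p p (\<lambda>i. adj (g k i * H k i m)) {..<Suc j}"
      by (rule adj_msum) (use k j in \<open>auto simp: gd\<close>)
    then show ?thesis using T by (simp only:) (subst msum_mult, use k j in \<open>auto simp: gd\<close>)
  qed
  also have "msum p p (\<lambda>i. g k i * H k i m) {..<Suc j} = msum p p (\<lambda>i. g k i * H k i m) {..<Suc M}"
    by (rule msum_mono_neutral[symmetric]) (use k m j in \<open>auto simp: hess gd\<close>)
  also have "\<dots> = 0\<^sub>m p p" by (rule colsum) (use k m j in auto)
  finally show ?thesis using T by simp
qed

lemma arnoldi: assumes k: "k < l" shows "arnoldi n p A (res k 0) M (v k) (H k) (F k 0)"
proof
  show "res k 0 = v k 0 * F k 0" by (rule res_0[OF k])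
  show "nonsing p (F k 0)" by (rule Fd) (use k in auto)
  fix j assume j: "Suc j < M"
  show "A * v k j = msum n p (\<lambda>i. v k i * H k i j) {..<Suc (Suc j)}"
    using A_v[OF k, of j] rhs_eq[OF k, of j "Suc j"] j by simp
  show "nonsing p (H k (Suc j) j)" by (rule Splus_nonsing[OF sub]) (use k j in auto)
qed (use A k H v_carrier in auto)

text \<open>Since the columns of \<open>[g\<^sub>i H\<^sub>i\<^sub>j]\<close> sum to zero, \<open>A v\<^sub>m\<close> is a combination of the differences
  \<open>u\<^sub>i - u\<^sub>0\<close> with \<open>u\<^sub>i = v\<^sub>i g\<^sub>i\<^sup>-\<^sup>1\<close> and \<open>i \<le> m + 1\<close>; hence all of them lie in the image of the Krylov space.\<close>

lemma differences:
  assumes k: "k < l" and i: "i \<le> M"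
  shows "\<exists>Y\<in>block_krylov i A (res k 0). A * Y = v k i * minv (g k i) - v k 0 * minv (g k 0)"
proof -
  note subk = sub[OF k]
  interpret arnoldi n p A "res k 0" M "v k" "H k" "F k 0" by (rule arnoldi[OF k])
  define u where "u i = v k i * minv (g k i)" for i
  have mg: "minv (g k i) \<in> carrier_mat p p" if "i \<le> M" for i using nonsing_minv[OF g[OF k that]] by simp
  have ud: "dim_row (u i) = n" "dim_col (u i) = p" if "i \<le> M" for i
    using k mg[OF that] by (auto simp: u_def v_dims)
  have vu: "v k i = u i * g k i" if "i \<le> M" for i
    unfolding u_def using k mg[OF that] nonsing_minv[OF g[OF k that]] nonsing_carrier[OF g[OF k that]]
    by (simp add: mat_assoc v_dims)
  have "\<exists>Y\<in>block_krylov i A (res k 0). A * Y = u i - u 0" using i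
  proof (induction i rule: less_induct)
    case (less i)
    show ?case
    proof (cases i)
      case 0
      have "A * 0\<^sub>m n p = u 0 - u 0" using A ud[of 0] by (intro eq_matI) auto
      then show ?thesis unfolding 0 by (rule bexI[OF _ K_zero])
    next
      case (Suc m)
      have m: "m < M" using less.prems Suc by simp
      have "\<forall>i. \<exists>Y. i \<le> m \<longrightarrow> Y \<in> K i \<and> A * Y = u i - u 0"
        using less.IH less.prems Suc by (auto simp: less_Suc_eq_le)
      then obtain Y where Y: "\<And>i. i \<le> m \<Longrightarrow> Y i \<in> K i" "\<And>i. i \<le> m \<Longrightarrow> A * Y i = u i - u 0" by metis
      define C where "C i = g k i * H k i m" for i
      have C: "C i \<in> carrier_mat p p" if "i \<le> M" for i using that k by (simp add: C_def gd)
      note Cd = C[THEN carrier_matD(1)] C[THEN carrier_matD(2)]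
      have C0: "msum p p C {..<Suc (Suc m)} = 0\<^sub>m p p"
      proof -
        have "msum p p C {..<Suc (Suc m)} = msum p p C {..<Suc M}"
          by (rule msum_mono_neutral[symmetric]) (use k m in \<open>auto simp: C_def hess gd\<close>)
        moreover have "C = (\<lambda>i. g k i * H k i m)" by (rule ext) (simp add: C_def)
        ultimately show ?thesis using colsum[OF k m] by (simp only:)
      qed
      have "A * v k m = msum n p (\<lambda>i. u i * C i) {..<Suc (Suc m)}"
        using A_v[OF k m] rhs_eq[OF k, of m "Suc m"] m k
        by (auto simp: vu C_def mat_assoc gd ud intro!: msum_cong)
      moreover have "msum n p (\<lambda>i. u 0 * C i) {..<Suc (Suc m)} = 0\<^sub>m n p"
      proof -
        have "msum n p (\<lambda>i. u 0 * C i) {..<Suc (Suc m)} = u 0 * msum p p C {..<Suc (Suc m)}"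
          using m by (subst mult_msum) (auto simp: C ud)
        then show ?thesis using C0 ud[of 0] by simp
      qed
      ultimately have "A * v k m = msum n p (\<lambda>i. u i * C i) {..<Suc (Suc m)} - msum n p (\<lambda>i. u 0 * C i) {..<Suc (Suc m)}"
        by (auto intro!: eq_matI)
      also have "\<dots> = msum n p (\<lambda>i. u i * C i - u 0 * C i) {..<Suc (Suc m)}"
        by (rule msum_diff[symmetric]) (use m in \<open>auto simp: Cd ud\<close>)
      also have "\<dots> = msum n p (\<lambda>i. (u i - u 0) * C i) {..<Suc (Suc m)}"
        by (rule msum_cong) (use m in \<open>auto simp: mat_diff_right ud Cd\<close>)
      also have "\<dots> = msum n p (\<lambda>i. (u i - u 0) * C i) {..<Suc m} + (u i - u 0) * C i"
        unfolding Suc by (rule msum_Suc) (use m in \<open>auto simp: ud Cd\<close>)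
      also have "msum n p (\<lambda>i. (u i - u 0) * C i) {..<Suc m} = A * msum n p (\<lambda>i. Y i * C i) {..<Suc m}"
      proof -
        have Yc: "dim_row (Y i) = n" "dim_col (Y i) = p" if "i \<le> m" for i
          using K_carrier[OF Y(1)[OF that]] by auto
        have "A * msum n p (\<lambda>i. Y i * C i) {..<Suc m} = msum n p (\<lambda>i. A * (Y i * C i)) {..<Suc m}"
          using A m by (subst mult_msum) (auto simp: Yc Cd)
        also have "\<dots> = msum n p (\<lambda>i. (u i - u 0) * C i) {..<Suc m}"
          using A m by (intro msum_cong) (auto simp: Yc Cd Y(2)[symmetric] mat_assoc)
        finally show ?thesis by simp
      qed
      finally have eq: "A * v k m = A * msum n p (\<lambda>i. Y i * C i) {..<Suc m} + (u i - u 0) * C i" .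
      \<comment> \<open>The coefficient of the only difference not yet known to be reachable; it is
        invertible because the subdiagonal block is.\<close>
      have nC: "nonsing p (C i)"
        unfolding C_def Suc by (intro nonsing_mult g[OF k] Splus_nonsing subk) (use m in auto)
      note Ci = nonsing_carrier[OF nC] nonsing_minv[OF nC]
      define Z where "Z = v k m - msum n p (\<lambda>i. Y i * C i) {..<Suc m}"
      have "msum n p (\<lambda>i. Y i * C i) {..<Suc m} \<in> K i"
        using m Suc by (intro K_msum K_mult K_mono[OF Y(1)] C) auto
      then have Z: "Z \<in> K i" unfolding Z_def using v_in_K[OF m] Suc by (intro K_diff) auto
      have "A * Z = (u i - u 0) * C i"
      proof -
        let ?S = "msum n p (\<lambda>i. Y i * C i) {..<Suc m}"
        have "A * Z = A * v k m - A * ?S"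
          unfolding Z_def using A k by (intro mat_diff_left) (auto simp: v_dims)
        also have "\<dots> = (u i - u 0) * C i"
        proof -
          have "A * ?S \<in> carrier_mat n p" "(u i - u 0) * C i \<in> carrier_mat n p"
            using A Ci ud[of 0] by auto
          then show ?thesis unfolding eq by (intro eq_matI) auto
        qed
        finally show ?thesis .
      qed
      then have "A * (Z * minv (C i)) = u i - u 0"
        using A K_carrier[OF Z] Ci ud[of 0] by (simp flip: mat_assoc) (simp add: mat_assoc)
      then show ?thesis using K_mult[OF Z, of "minv (C i)"] Ci by blast
    qed
  qed
  then show ?thesis by (simp add: u_def)
qed

text \<open>The residual is an affine combination of the \<open>u i\<close>: its coefficients
  \<open>C i\<close> sum to the identity by \<open>gram\<close>. Subtracting \<open>u 0\<close>,
  which is the initial residual, leaves a combination of the differences treated in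
  \<open>differences\<close>.\<close>

lemma res_reachable:
  assumes k: "k < l" and j: "j \<le> M"
  shows "\<exists>Y\<in>block_krylov j A (res k 0). A * Y = res k 0 - res k j"
proof -
  interpret arnoldi n p A "res k 0" M "v k" "H k" "F k 0" by (rule arnoldi[OF k])
  define u where "u i = v k i * minv (g k i)" for i
  have mg: "minv (g k i) \<in> carrier_mat p p" if "i \<le> M" for i using nonsing_minv[OF g[OF k that]] by simp
  have ud: "dim_row (u i) = n" "dim_col (u i) = p" if "i \<le> M" for i
    using k mg[OF that] by (auto simp: u_def v_dims)
  have vu: "v k i = u i * g k i" if "i \<le> M" for i
    unfolding u_def using k mg[OF that] nonsing_minv[OF g[OF k that]] nonsing_carrier[OF g[OF k that]]
    by (simp add: mat_assoc v_dims)
  have u0: "u 0 = res k 0"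
  proof -
    note c = nonsing_carrier[OF Fd[OF k le0]] nonsing_minv[OF Fd[OF k le0]]
    have "minv (g k 0) = minv (g k 0) * (g k 0 * F k 0)"
      using c mg[of 0] by (simp add: g0[OF k])
    also have "\<dots> = F k 0" using c by (intro minv_cancel(2)[OF g[OF k le0]]) auto
    finally show ?thesis by (simp add: u_def res_0[OF k])
  qed
  have "\<forall>i. \<exists>Y. i \<le> M \<longrightarrow> Y \<in> K i \<and> A * Y = u i - u 0"
    using differences[OF k] by (auto simp: u_def)
  then obtain Y where Y: "\<And>i. i \<le> M \<Longrightarrow> Y i \<in> K i" "\<And>i. i \<le> M \<Longrightarrow> A * Y i = u i - u 0" by metis
  have Yc: "dim_row (Y i) = n" "dim_col (Y i) = p" if "i \<le> M" for i
    using K_carrier[OF Y(1)[OF that]] by auto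
  have "\<exists>Z\<in>K j. A * Z = res k j - u 0"
  proof (cases "Suc k = l \<and> j = M")
    case True
    \<comment> \<open>At the end of the last cycle both sides are zero, as the last vector does not
      exist; the single difference \<open>u M - u 0\<close> already suffices.\<close>
    then have "u j = res k j" using mg[of j] j M by (simp add: u_def v_def w_def res_def)
    then show ?thesis using Y[OF j] by auto
  next
    case False
    define T where "T = adj (F k j) * F k j"
    define C where "C i = g k i * adj (g k i) * T" for i
    have T: "T \<in> carrier_mat p p" using k j by (auto simp: T_def gd)
    have C: "C i \<in> carrier_mat p p" if "i \<le> M" for i using that k T by (simp add: C_def gd)
    note Cd = C[THEN carrier_matD(1)] C[THEN carrier_matD(2)]
    have C1: "msum p p C {..<Suc j} = 1\<^sub>m p"
    proof -
      have "msum p p C {..<Suc j} = msum p p (\<lambda>i. g k i * adj (g k i)) {..<Suc j} * T"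
        unfolding C_def using k j T by (subst msum_mult) (auto simp: gd)
      then show ?thesis using gram[OF k j] by (simp add: T_def)
    qed
    have "res k j = msum n p (\<lambda>i. u i * C i) {..<Suc j}"
      using False k j T by (auto simp: res_def vu C_def T_def[symmetric] mat_assoc gd ud intro!: msum_cong)
    moreover have "u 0 = msum n p (\<lambda>i. u 0 * C i) {..<Suc j}"
    proof -
      have "msum n p (\<lambda>i. u 0 * C i) {..<Suc j} = u 0 * msum p p C {..<Suc j}"
        using j by (subst mult_msum) (auto simp: C ud)
      then show ?thesis using C1 ud[of 0] by simp
    qed
    ultimately have "res k j - u 0 = msum n p (\<lambda>i. u i * C i) {..<Suc j} - msum n p (\<lambda>i. u 0 * C i) {..<Suc j}"
      by simp
    also have "\<dots> = msum n p (\<lambda>i. u i * C i - u 0 * C i) {..<Suc j}"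
      by (rule msum_diff[symmetric]) (use j in \<open>auto simp: Cd ud\<close>)
    also have "\<dots> = msum n p (\<lambda>i. A * (Y i * C i)) {..<Suc j}"
      using A j by (intro msum_cong) (auto simp: Yc Cd ud mat_assoc[symmetric] Y(2) mat_diff_right)
    also have "\<dots> = A * msum n p (\<lambda>i. Y i * C i) {..<Suc j}"
      using A j by (subst mult_msum) (auto simp: Yc Cd)
    finally have "A * msum n p (\<lambda>i. Y i * C i) {..<Suc j} = res k j - u 0" by simp
    moreover have "msum n p (\<lambda>i. Y i * C i) {..<Suc j} \<in> K j"
      using j by (intro K_msum K_mult K_mono[OF Y(1)] C) auto
    ultimately show ?thesis by blast
  qed
  then obtain Z where Z: "Z \<in> K j" "A * Z = res k j - u 0" by blast
  have "A * (Z * (- 1\<^sub>m p)) = (A * Z) * (- 1\<^sub>m p)" using A K_carrier[OF Z(1)] by (simp add: mat_assoc)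
  also have "\<dots> = res k 0 - res k j"
    unfolding Z(2) u0 by (rule eq_matI) auto
  finally show ?thesis using K_mult[OF Z(1), of "- 1\<^sub>m p"] by auto
qed

text \<open>A choice, because \<open>A\<close> is not known to be injective; only the resulting
  residual matters.\<close>

definition step :: "nat \<Rightarrow> nat \<Rightarrow> complex mat" where
  "step k j = (SOME Y. Y \<in> block_krylov j A (res k 0) \<and> A * Y = res k 0 - res k j)"

lemma step:
  assumes "k < l" "j \<le> M"
  shows "step k j \<in> block_krylov j A (res k 0)" "A * step k j = res k 0 - res k j"
  using someI_ex[OF res_reachable[OF assms, unfolded Bex_def]] by (auto simp: step_def)

lemma step_carrier: assumes "k < l" "j \<le> M" shows "step k j \<in> carrier_mat n p"
proof -
  interpret krylov n p A "res k 0" by unfold_locales (use A in auto)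
  show ?thesis by (rule K_carrier[OF step(1)[OF assms]])
qed

primrec x0 :: "nat \<Rightarrow> complex mat" where
  "x0 0 = 0\<^sub>m n p"
| "x0 (Suc k) = x0 k + step k M"

definition B :: "complex mat" where "B = res 0 0"

lemma B: "B \<in> carrier_mat n p" by (simp add: B_def)

lemma residual_step:
  assumes "k < l" "j \<le> M" "Y \<in> carrier_mat n p" "residual A B Y = res k 0"
  shows "residual A B (Y + step k j) = res k j"
  using residual_add[OF A B assms(3) step_carrier[OF assms(1,2)]] step(2)[OF assms(1,2)] assms(4)
  by (auto intro!: eq_matI)

lemma x0: "k < l \<Longrightarrow> x0 k \<in> carrier_mat n p \<and> residual A B (x0 k) = res k 0"
proof (induction k)
  case 0
  have "residual A B (0\<^sub>m n p) = B" using A B by (auto simp: residual_def intro!: eq_matI)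
  then show ?case by (simp add: B_def)
next
  case (Suc k)
  then show ?case
    using residual_step[of k M "x0 k"] step_carrier[of k M] res_link[of k] by auto
qed

definition iter :: "nat \<Rightarrow> nat \<Rightarrow> complex mat" where
  "iter k j = (if j = 0 then x0 (k - 1) else x0 (k - 1) + step (k - 1) j)"

lemma residual_iter: "k < l \<Longrightarrow> j \<le> M \<Longrightarrow> residual A B (iter (Suc k) j) = res k j"
  using x0[of k] residual_step[of k j "x0 k"] by (simp add: iter_def)

text \<open>Optimality of every iterate comes from \<open>gmres_iterateI\<close>, whose
  orthogonality premise \<open>K_orth\<close> reduces to \<open>res_orth\<close>.\<close>

lemma restarted: "restarted_block_gmres A B M l iter"
  unfolding restarted_block_gmres_def
proof (intro conjI ballI)
  show "iter 1 0 = 0\<^sub>m (dim_row B) (dim_col B)" using B by (simp add: iter_def)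
next
  fix k assume "k \<in> {1..<l}"
  then show "iter (k + 1) 0 = iter k M" using M by (cases k) (auto simp: iter_def)
next
  fix k j assume "k \<in> {1..l}" and j: "j \<in> {1..M}"
  then obtain k' where k: "k = Suc k'" "k' < l" by (cases k) auto
  interpret arnoldi n p A "res k' 0" M "v k'" "H k'" "F k' 0" by (rule arnoldi[OF k(2)])
  have x: "x0 k' \<in> carrier_mat n p" "residual A B (x0 k') = res k' 0" using x0[OF k(2)] by auto
  have jM: "j \<le> M" using j by simp
  have "res k' 0 - A * step k' j = res k' j"
    unfolding step(2)[OF k(2) jM] by (rule eq_matI) auto
  then have "gmres_iterate A B (x0 k') j (x0 k' + step k' j)"
    using step(1)[OF k(2) jM] K_orth[OF _ jM] res_orth[OF k(2) _ jM] x
    by (intro gmres_iterateI[OF A B x(1)]) auto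
  then show "gmres_iterate A B (iter k 0) j (iter k j)" using j k by (simp add: iter_def)
qed

section \<open>Hessenberg matrices and block Arnoldi relations of the constructed pair\<close>

definition hmat :: "nat \<Rightarrow> complex mat" where
  "hmat k = bmat p (M + 1) (M + 1) (H k)"

lemma hmat_carrier: "hmat k \<in> carrier_mat ((M + 1) * p) ((M + 1) * p)"
  unfolding hmat_def by (rule block_carrier)

lemma block_entry_hmat: "i \<le> M \<Longrightarrow> j \<le> M \<Longrightarrow> block_entry p (hmat k) i j = H k i j"
  unfolding hmat_def by (rule block_entry_bmat) (auto simp: H)

lemma block_hessenberg_hmat: "k < l \<Longrightarrow> block_hessenberg p (M + 1) (hmat k)"
  unfolding block_hessenberg_def using hmat_carrier[of k] hess sub by (auto simp: block_entry_hmat)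

definition V :: "nat \<Rightarrow> complex mat" where "V k = bcols n p M (v k)"

lemma V: "V k \<in> carrier_mat n (M * p)" by (simp add: V_def)

lemma bcol_V: "k < l \<Longrightarrow> i < M \<Longrightarrow> bcol n p (V k) i = v k i"
  unfolding V_def by (rule bcol_bcols) (use v_carrier in auto)

lemma orthonormal_start_V: assumes k: "k < l" shows "orthonormal_start p M (res k 0) (V k)"
  unfolding orthonormal_start_def
proof (intro conjI exI)
  note c = nonsing_carrier[OF Fd[OF k le0]] nonsing_minv[OF Fd[OF k le0]]
  show "V k \<in> carrier_mat (dim_row (res k 0)) (M * p)" by (simp add: V)
  show "adj (V k) * V k = 1\<^sub>m (M * p)"
  proof (rule block_entry_eqI[of _ M p M])
    fix i j assume ij: "i < M" "j < M"
    show "block_entry p (adj (V k) * V k) i j = block_entry p (1\<^sub>m (M * p)) i j"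
      using block_entry_gram[OF V V ij, of k k] ij k v_orthonormal[of k i j]
      by (simp add: block_entry_one bcol_V)
  qed (use V[of k] in auto)
  show "has_block_norm (res k 0) (F k 0)"
    using F[OF k le0] res_gram[OF k, of 0] M by (simp add: has_block_norm_def)
  show "inverts_mat (F k 0) (minv (F k 0))" "inverts_mat (minv (F k 0)) (F k 0)"
    using c by (auto simp: inverts_mat_def)
  have "leading_part n p (V k) = v k 0"
    using leading_part_bcol[of p "V k" n] V[of k] M bcol_V[OF k, of 0] by simp
  then show "leading_part (dim_row (res k 0)) p (V k) = res k 0 * minv (F k 0)"
    using c k by (simp add: res_0[OF k] mat_assoc v_dims)
qed

lemma block_arnoldi_V: assumes k: "Suc k < l" shows "block_arnoldi p M A (res k 0) (hmat k)"
proof -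
  have k': "k < l" using k by simp
  have W: "v k M \<in> carrier_mat n p" by (rule v_carrier[OF k'])
  have "adj (V k) * v k M = 0\<^sub>m (M * p) p"
  proof (rule block_entry_eqI[of _ M p 1])
    fix i j assume "i < M" "j < (1::nat)"
    then have ij: "i < M" "j = 0" by auto
    have "bcol n p (v k M) 0 = v k M" using W by (intro eq_matI) auto
    then have "block_entry p (adj (V k) * v k M) i j = adj (v k i) * v k M"
      using block_entry_gram[OF V, of "v k M" 1 i 0] W ij bcol_V[OF k' ij(1)] by simp
    also have "\<dots> = 0\<^sub>m p p" using v_orthonormal[of k i M] ij k by simp
    also have "\<dots> = block_entry p (0\<^sub>m (M * p) p) i j"
      using ij block_index[of i M _ p] by (intro eq_matI) auto
    finally show "block_entry p (adj (V k) * v k M) i j = block_entry p (0\<^sub>m (M * p) p) i j" .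
  qed (use V[of k] W in auto)
  moreover have "A * V k = append_columns (V k) (v k M) * leading_part ((M + 1) * p) (M * p) (hmat k)"
  proof (rule block_cols_eqI[of _ n M p])
    fix j assume j: "j < M"
    have "bcol n p (A * V k) j = msum n p (\<lambda>i. v k i * H k i j) {..<Suc M}"
      using bcol_mult_left[OF A V j, of k] bcol_V[OF k' j] A_v[OF k' j] by (simp add: rhs_def)
    also have "\<dots> = msum n p (\<lambda>i. (if i < M then bcol n p (V k) i else v k M) * block_entry p (hmat k) i j) {..<M + 1}"
      using j k' by (intro msum_cong) (auto simp: bcol_V block_entry_hmat less_Suc_eq)
    also have "\<dots> = bcol n p (append_columns (V k) (v k M) * leading_part ((M + 1) * p) (M * p) (hmat k)) j"
      by (rule bcol_arnoldi[OF V W j hmat_carrier, symmetric])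
    finally show "bcol n p (A * V k) j =
      bcol n p (append_columns (V k) (v k M) * leading_part ((M + 1) * p) (M * p) (hmat k)) j" .
  qed (use A V[of k] in auto)
  ultimately show ?thesis
    unfolding block_arnoldi_def
    using orthonormal_start_V[OF k'] W v_orthonormal[of k M M] k by (intro exI[of _ "V k"] exI[of _ "v k M"]) auto
qed

lemma block_arnoldi_final_V: assumes k: "Suc k = l" shows "block_arnoldi_final p M A (res k 0) (hmat k)"
proof -
  have k': "k < l" using k by simp
  have "A * V k = V k * leading_part (M * p) (M * p) (hmat k)"
  proof (rule block_cols_eqI[of _ n M p])
    fix j assume j: "j < M"
    have "bcol n p (A * V k) j = msum n p (\<lambda>i. v k i * H k i j) {..<Suc M}"
      using bcol_mult_left[OF A V j, of k] bcol_V[OF k' j] A_v[OF k' j] by (simp add: rhs_def)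
    \<comment> \<open>In the last cycle \<open>v k M\<close> is zero, so the last block row of the
      Hessenberg matrix drops out.\<close>
    also have "\<dots> = msum n p (\<lambda>i. v k i * H k i j) {..<M}"
      by (rule msum_mono_neutral) (use k M in \<open>auto simp: v_def w_def not_less_eq less_Suc_eq\<close>)
    also have "\<dots> = msum n p (\<lambda>i. bcol n p (V k) i * block_entry p (leading_part (M * p) (M * p) (hmat k)) i j) {..<M}"
      using j k' by (intro msum_cong) (auto simp: bcol_V block_entry_hmat)
    also have "\<dots> = bcol n p (V k * leading_part (M * p) (M * p) (hmat k)) j"
      by (rule bcol_mult[OF V _ j, symmetric]) simp
    finally show "bcol n p (A * V k) j = bcol n p (V k * leading_part (M * p) (M * p) (hmat k)) j" .
  qed (use A V[of k] in auto)
  then show ?thesis unfolding block_arnoldi_final_def using orthonormal_start_V[OF k'] by blast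
qed

lemma realizes: "realizes n p M l (\<lambda>k. F (k - 1)) A B (\<lambda>k. hmat (k - 1))"
  unfolding realizes_def
proof (intro conjI A B exI[of _ iter] restarted ballI allI impI)
  fix k j assume "k \<in> {1..l}" and j: "j < M"
  then obtain k' where k: "k = Suc k'" "k' < l" by (cases k) auto
  then show "has_block_norm (residual A B (iter k j)) (F (k - 1) j)"
    using j F[OF k(2), of j] res_gram[OF k(2), of j] residual_iter[OF k(2), of j]
    by (simp add: has_block_norm_def)
next
  show "associated_hessenberg p M l A (\<lambda>k. residual A B (iter k 0)) (\<lambda>k. hmat (k - 1))"
    unfolding associated_hessenberg_def
  proof (intro conjI ballI)
    fix k assume "k \<in> {1..l}"
    then show "block_hessenberg p (M + 1) (hmat (k - 1))" by (intro block_hessenberg_hmat) auto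
  next
    fix k assume "k \<in> {1..<l}"
    then obtain k' where k: "k = Suc k'" "Suc k' < l" by (cases k) auto
    then show "block_arnoldi p M A (residual A B (iter k 0)) (hmat (k - 1))"
      using residual_iter[of k' 0] block_arnoldi_V[of k'] by simp
  next
    obtain k' where "l = Suc k'" using l by (cases l) auto
    then show "block_arnoldi_final p M A (residual A B (iter l 0)) (hmat (l - 1))"
      using residual_iter[of k' 0] block_arnoldi_final_V[of k'] by simp
  qed
qed

end

section \<open>Prescribed residual norms and Ritz values\<close>

text \<open>Provides an artificial norm for the end of the last cycle. The factor 3/5 belongs to the
  triple 3, 4, 5: the difference of the Gram matrices is the Gram matrix of 4/5 times
  \<open>R\<close>.\<close>

lemma gram_less_smult:
  assumes R: "nonsing p R"
  shows "gram_less (3/5 \<cdot>\<^sub>m R) R"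
proof -
  note Rc = nonsing_carrier[OF R]
  have "nonsing p (4/5 \<cdot>\<^sub>m R)"
    using R Rc by (simp add: nonsing_def)
  then have "pos_definite (adj (4/5 \<cdot>\<^sub>m R) * (4/5 \<cdot>\<^sub>m R) + adj (0\<^sub>m p p) * 0\<^sub>m p p)"
    by (rule pos_definite_gram_sum[where n = p]) auto
  also have "adj (4/5 \<cdot>\<^sub>m R) * (4/5 \<cdot>\<^sub>m R) + adj (0\<^sub>m p p) * 0\<^sub>m p p =
      adj R * R - adj (3/5 \<cdot>\<^sub>m R) * (3/5 \<cdot>\<^sub>m R)"
  proof (rule eq_matI)
    fix i j assume "i < dim_row (adj R * R - adj (3/5 \<cdot>\<^sub>m R) * (3/5 \<cdot>\<^sub>m R))"
      "j < dim_col (adj R * R - adj (3/5 \<cdot>\<^sub>m R) * (3/5 \<cdot>\<^sub>m R))"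
    then have ij: "i < p" "j < p" using Rc by auto
    have s: "(adj (c \<cdot>\<^sub>m R) * (c \<cdot>\<^sub>m R)) $$ (i,j) = (cnj c * c) * (\<Sum>k<p. cnj (R $$ (k,i)) * R $$ (k,j))" for c
      using ij Rc by (simp add: mult_entry sum_distrib_left mult_ac)
    have "(adj R * R) $$ (i,j) = (\<Sum>k<p. cnj (R $$ (k,i)) * R $$ (k,j))"
      using ij Rc by (simp add: mult_entry)
    then show "(adj (4/5 \<cdot>\<^sub>m R) * (4/5 \<cdot>\<^sub>m R) + adj (0\<^sub>m p p) * 0\<^sub>m p p) $$ (i,j) =
        (adj R * R - adj (3/5 \<cdot>\<^sub>m R) * (3/5 \<cdot>\<^sub>m R)) $$ (i,j)"
      using ij Rc by (simp add: s field_simps)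
  qed (use Rc in auto)
  finally show ?thesis by (simp add: gram_less_def)
qed

lemma Splus_smult: "R \<in> Splus p \<Longrightarrow> 3/5 \<cdot>\<^sub>m R \<in> Splus p"
  by (auto simp: Splus_def upper_triangular_def)

theorem ritz_values_assignable:
  fixes F :: "nat \<Rightarrow> nat \<Rightarrow> complex mat" and \<Lambda> :: "nat \<Rightarrow> complex multiset"
  assumes M: "M \<ge> 1" and l: "l \<ge> 1" and n: "n = (l * M) * p"
    and F: "\<And>k j. k \<in> {1..l} \<Longrightarrow> j < M \<Longrightarrow> F k j \<in> Splus p"
    and less: "\<And>k j. k \<in> {1..l} \<Longrightarrow> j + 1 < M \<Longrightarrow> gram_less (F k (j + 1)) (F k j)"
    and trans: "\<And>k. k \<in> {1..<l} \<Longrightarrow> gram_less (F (k + 1) 0) (F k (M - 1))"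
    and \<Lambda>: "\<And>k. k \<in> {1..l} \<Longrightarrow> size (\<Lambda> k) = (M + 1) * p"
    and \<Theta>: "\<And>k j. k \<in> {1..l} \<Longrightarrow> j \<in> {1..M} \<Longrightarrow> size (\<Theta> k j) = j * p \<and> 0 \<notin># \<Theta> k j"
  shows "\<exists>A B H. realizes n p M l F A B H \<and>
    (\<forall>k\<in>{1..l}. eigenvalue_mset (H k) = \<Lambda> k \<and> (\<forall>j\<in>{1..M}. ritz_values p j (H k) = \<Theta> k j))"
proof -
  \<comment> \<open>Index \<open>M\<close> is added to each cycle: the first norm of the next cycle,
    or in the last cycle any strictly smaller one. The transition condition thereby becomes an
    ordinary decrease within the cycle.\<close>
  define F' where "F' k j = (if j < M then F (Suc k) j else if Suc k < l then F (Suc (Suc k)) 0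
    else 3/5 \<cdot>\<^sub>m F (Suc k) (M - 1))" for k j
  have F': "F' k j \<in> Splus p" if "k < l" for k j
    using that M F[of "Suc k" j] F[of "Suc (Suc k)" 0] Splus_smult[OF F[of "Suc k" "M - 1"]]
    by (auto simp: F'_def)
  have less': "gram_less (F' k (Suc j)) (F' k j)" if "k < l" "j < M" for k j
  proof (cases "Suc j < M")
    case True
    then show ?thesis using less[of "Suc k" j] that by (simp add: F'_def)
  next
    case False
    then have j: "j = M - 1" using that by simp
    show ?thesis
    proof (cases "Suc k < l")
      case True
      then show ?thesis using trans[of "Suc k"] False j that by (simp add: F'_def)
    next
      case last: False
      have "nonsing p (F (Suc k) (M - 1))"
        using that M by (intro Splus_nonsing F) auto
      then show ?thesis using gram_less_smult last False j that by (simp add: F'_def)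
    qed
  qed
  \<comment> \<open>Ritz values and eigenvalues form one sequence indexed by the order of the
    leading part, the whole matrix having index \<open>M + 1\<close>.\<close>
  define \<Xi> where "\<Xi> k j = (if j = 0 then {#} else if j \<le> M then \<Theta> (Suc k) j else \<Lambda> (Suc k))" for k j
  define q where "q k g H \<longleftrightarrow> g 0 = minv (F' k 0) \<and> (\<forall>i\<le>M. nonsing p (g i)) \<and>
    (\<forall>j\<le>M. msum p p (\<lambda>i. g i * adj (g i)) {..<Suc j} * (adj (F' k j) * F' k j) = 1\<^sub>m p) \<and>
    (\<forall>i j. H i j \<in> carrier_mat p p) \<and> (\<forall>i j. Suc j < i \<longrightarrow> H i j = 0\<^sub>m p p) \<and>
    (\<forall>j<M. H (Suc j) j \<in> Splus p) \<and>
    (\<forall>j<M. msum p p (\<lambda>i. g i * H i j) {..<Suc M} = 0\<^sub>m p p) \<and>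
    (\<forall>j\<le>M + 1. eigenvalue_mset (bmat p j j H) = \<Xi> k j)" for k g and H :: "nat \<Rightarrow> nat \<Rightarrow> complex mat"
  have "\<exists>g H. q k g H" if k: "k < l" for k
  proof -
    have sk: "Suc k \<in> {1..l}" using k by simp
    have "size (\<Xi> k j) = j * p" if "j \<le> M + 1" for j
      using \<Lambda>[OF sk] \<Theta>[OF sk, of j] that by (auto simp: \<Xi>_def le_Suc_eq)
    moreover have "0 \<notin># \<Xi> k j" if "j \<le> M" for j
      using \<Theta>[OF sk, of j] that by (auto simp: \<Xi>_def)
    ultimately show ?thesis
      unfolding q_def by (intro cycle_data F'[OF k] less'[OF k]) auto
  qed
  then have "\<forall>k. \<exists>g H. k < l \<longrightarrow> q k g H" by blast
  then obtain g H where "\<forall>k. k < l \<longrightarrow> q k (g k) (H k)" by metis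
  then have q: "q k (g k) (H k)" if "k < l" for k using that by blast
  \<comment> \<open>The choice of \<open>H\<close> says nothing about \<open>k \<ge> l\<close>,
    whereas the locale asks for the right dimensions at every \<open>k\<close>; zero blocks fill the
    gap.\<close>
  define H' where "H' k = (if k < l then H k else (\<lambda>_ _. 0\<^sub>m p p))" for k
  interpret assembly p M l n F' g H'
  proof
    fix k i j
    show "H' k i j \<in> carrier_mat p p" using q[of k] by (auto simp: H'_def q_def)
  qed (use M l n F' q in \<open>auto simp: H'_def q_def F'_def\<close>)
  have ev: "eigenvalue_mset (bmat p j j (H' k)) = \<Xi> k j" if "k < l" "j \<le> M + 1" for k j
    using q[OF that(1)] that by (simp add: q_def H'_def)
  have "realizes n p M l F A B (\<lambda>k. hmat (k - 1))"
  proof -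
    have "F' (k - 1) j = F k j" if "k \<in> {1..l}" "j < M" for k j
      using that by (simp add: F'_def)
    then show ?thesis using realizes unfolding Defs.realizes_def by simp
  qed
  moreover have "eigenvalue_mset (hmat (k - 1)) = \<Lambda> k \<and>
      (\<forall>j\<in>{1..M}. ritz_values p j (hmat (k - 1)) = \<Theta> k j)" if "k \<in> {1..l}" for k
  proof (intro conjI ballI)
    have k: "k - 1 < l" "Suc (k - 1) = k" using that by auto
    show "eigenvalue_mset (hmat (k - 1)) = \<Lambda> k"
      using ev[OF k(1), of "M + 1"] k(2) unfolding hmat_def by (simp add: \<Xi>_def)
    fix j assume j: "j \<in> {1..M}"
    have "leading_part (j * p) (j * p) (hmat (k - 1)) = bmat p j j (H' (k - 1))"
      unfolding hmat_def by (rule leading_part_bmat) (use j in auto)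
    then show "ritz_values p j (hmat (k - 1)) = \<Theta> k j"
      using ev[OF k(1), of j] k(2) j by (simp add: ritz_values_def \<Xi>_def)
  qed
  ultimately show ?thesis by blast
qed

theorem corollary5p10:
  fixes p M l N n :: nat and F :: "nat \<Rightarrow> nat \<Rightarrow> complex mat"
  assumes "p \<ge> 1" and "M \<ge> 1" and "l \<ge> 1" and "N = l * M" and "n = N * p"
    and F_Splus: "\<And>k j. k \<in> {1..l} \<Longrightarrow> j < M \<Longrightarrow> F k j \<in> Splus p"
    and F_decreasing: "\<And>k j. k \<in> {1..l} \<Longrightarrow> j + 1 < M \<Longrightarrow> gram_le (F k (j + 1)) (F k j)"
    and F_transition: "\<And>k. k \<in> {1..<l} \<Longrightarrow> gram_less (F (k + 1) 0) (F k (M - 1))"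
  shows
    "((\<forall>k\<in>{1..l}. \<forall>j. j + 1 < M \<longrightarrow> gram_less (F k (j + 1)) (F k j)) \<longrightarrow>
       (\<forall>(\<Lambda> :: nat \<Rightarrow> complex multiset) (\<Theta> :: nat \<Rightarrow> nat \<Rightarrow> complex multiset).
          (\<forall>k\<in>{1..l}. size (\<Lambda> k) = (M + 1) * p) \<longrightarrow>
          (\<forall>k\<in>{1..l}. \<forall>j\<in>{1..M}. size (\<Theta> k j) = j * p \<and> 0 \<notin># \<Theta> k j) \<longrightarrow>
          (\<exists>A B H. realizes n p M l F A B H \<and>
             (\<forall>k\<in>{1..l}. eigenvalue_mset (H k) = \<Lambda> k \<and>
                (\<forall>j\<in>{1..M}. ritz_values p j (H k) = \<Theta> k j)))))
     \<and>
     (\<forall>k\<in>{1..l}. \<forall>j\<in>{1..M - 1}.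
        (\<exists>u\<in>carrier_vec p. u \<noteq> 0\<^sub>v p \<and>
           ((mat_adjoint (F k j) * F k j) *\<^sub>v u) \<bullet>c u =
           ((mat_adjoint (F k (j - 1)) * F k (j - 1)) *\<^sub>v u) \<bullet>c u) \<longrightarrow>
        (\<forall>A B H. realizes n p M l F A B H \<longrightarrow> 0 \<in># ritz_values p j (H k)))"
proof (intro conjI impI allI ballI)
  fix \<Lambda> :: "nat \<Rightarrow> complex multiset" and \<Theta> :: "nat \<Rightarrow> nat \<Rightarrow> complex multiset"
  assume "\<forall>k\<in>{1..l}. \<forall>j. j + 1 < M \<longrightarrow> gram_less (F k (j + 1)) (F k j)"
    "\<forall>k\<in>{1..l}. size (\<Lambda> k) = (M + 1) * p"
    "\<forall>k\<in>{1..l}. \<forall>j\<in>{1..M}. size (\<Theta> k j) = j * p \<and> 0 \<notin># \<Theta> k j"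
  then show "\<exists>A B H. realizes n p M l F A B H \<and>
      (\<forall>k\<in>{1..l}. eigenvalue_mset (H k) = \<Lambda> k \<and> (\<forall>j\<in>{1..M}. ritz_values p j (H k) = \<Theta> k j))"
    using assms by (intro ritz_values_assignable) auto
next
  fix k j A B H
  assume k: "k \<in> {1..l}" and j: "j \<in> {1..M - 1}" and re: "realizes n p M l F A B H"
    and "\<exists>u\<in>carrier_vec p. u \<noteq> 0\<^sub>v p \<and>
      ((mat_adjoint (F k j) * F k j) *\<^sub>v u) \<bullet>c u =
      ((mat_adjoint (F k (j - 1)) * F k (j - 1)) *\<^sub>v u) \<bullet>c u"
  then obtain u where "u \<in> carrier_vec p" "u \<noteq> 0\<^sub>v p"
    "((mat_adjoint (F k j) * F k j) *\<^sub>v u) \<bullet>c u =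
      ((mat_adjoint (F k (j - 1)) * F k (j - 1)) *\<^sub>v u) \<bullet>c u" by blast
  then show "0 \<in># ritz_values p j (H k)"
    using stagnation_zero_ritz_value[OF assms(2) re k j] F_Splus[OF k, of "j - 1"] j by auto
qed

end
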